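(* Let $U(x,\lambda)$ and $\widehat U(x,\lambda)$ be the fundamental matrices of the integral system $S[R_1,R_2]$ and of its dual system $\widehat S[R_1,R_2]$, respectively, and let $m_N$ and $\widehat m_N$ be the Neumann $m$-functions of $S[R_1,R_2]$ and $\widehat S[R_1,R_2]$, respectively. Then: (i) For $x\in[0,b)$ and $\lambda\in\mathbb{C}\setminus\{0\}$ the matrices $U(x,\lambda)$ and $\widehat U(x,\lambda)$ are related by $$\widehat U(x,\lambda)=D(\lambda)^{-1}U(x,\lambda)D(\lambda),\qquad D(\lambda)=\begin{pmatrix}0&-\lambda^{-1}\\1&0\end{pmatrix}.$$ (ii) If the system $S[R_1,R_2]$ is singular at $b$, then for $\lambda\in\mathbb{C}\setminus\mathbb{R}$ $$\widehat m_N(\lambda)=-\frac{1}{\lambda\, m_N(\lambda)}.$$ (iii) If $S[R_1,R_2]$ is regular at $b$, then for $\lambda\in\mathbb{C}\setminus\mathbb{R}$ $$\widehat m_N(\lambda)=\frac{\widehat s_2(b,\lambda)}{\widehat c_2(b,\lambda)}=-\frac{c_1(b,\lambda)}{\lambda s_1(b,\lambda)}=-\frac{1}{\lambda\, m_{ND}(\lambda)},$$ where $m_{ND}(\lambda)=s_1(b,\lambda)/c_1(b,\lambda)$ is the Neumann $m$-function of $S[R_1,R_2]$ subject to the boundary condition $u_1(b)=0$. (iv) The principal Titchmarsh-Weyl coefficients $q$ of $S[R_1,R_2]$ and $\widehat q$ of $\widehat S[R_1,R_2]$ are connected by $$\widehat q(\lambda)=-\frac{1}{\lambda\, q(\lambda)},\qquad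 \lambda\in\mathbb{C}\setminus[0,\infty).$$
   Context: **Integral systems.** Let $0<b\le\infty$ and let $R_1,R_2:[0,b)\to\mathbb{R}$ be nondecreasing left-continuous functions with $R_1(0)=R_2(0)=0$; put $R_j(b):=\lim_{x\to b}R_j(x)\in[0,\infty]$. $dR_j$ is the Lebesgue-Stieltjes measure of $R_j$ on $[0,b)$ (so $dR_j(\{x\})$ is the jump $\lim_{t\downarrow x}R_j(t)-R_j(x)$). Convention: $\int_a^x f\,d\sigma:=\int_{[a,x)}f\,d\sigma$. The integral system $S[R_1,R_2]$ with spectral parameter $\lambda\in\mathbb{C}$ is $$u_1(x)=u_1(0)+\int_0^x u_2\,dR_1,\qquad u_2(x)=u_2(0)-\lambda\int_0^x u_1\,dR_2,\qquad x\in[0,b).$$ For every initial value it has a unique solution. $c(\cdot,\lambda)=[c_1\ c_2]^T$ and $s(\cdot,\lambda)=[s_1\ s_2]^T$ are its solutions with $c_1(0,\lambda)=1$, $c_2(0,\lambda)=0$, $s_1(0,\lambda)=0$, $s_2(0,\lambda)=1$, and the fundamental matrix is $U(x,\lambda)=\begin{bmatrix}c_1(x,\lambda)&s_1(x,\lambda)\\c_2(x,\lambda)&s_2(x,\lambda)\end{bmatrix}$. The system is regular (at $b$) if $R_1(b)+R_2(b)<\infty$, and singular otherwise. Values of functions at $b$ are limits as $x\to b$. **Standing assumptions**, imposed on every integral system considered (in particular on $S[R_1,R_2]$ and on its dual): $R_1$ and $R_2$ have no common points of discontinuity; and there is an interval $[0,b_0)\subseteq[0,b)$ such that the classes of $1$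 and $R_1$ in $L^2(R_2,[0,b_0))$ are linearly independent (for the dual system the roles of the functions are exchanged accordingly). **Maximal relation, limit point/circle.** $\mathcal{L}^2(R_2)$ is the space of complex functions with $\int_{[0,b)}|f|^2dR_2<\infty$, $L^2(R_2)$ is its quotient modulo $dR_2$-a.e. equality, with quotient map $\pi$. $\mathcal{T}$ is the set of triples $(u_1,u_2,f)$ with $f,u_1\in\mathcal{L}^2(R_2)$ and $u_1(x)=u_1(0)+\int_0^xu_2\,dR_1$, $u_2(x)=u_2(0)-\int_0^xf\,dR_2$ for all $x\in[0,b)$. $T_{\max}=\{[\pi u_1\ \pi f]^T:(u_1,u_2,f)\in\mathcal{T}\}$ is a linear relation in $L^2(R_2)$. For $\lambda\in\mathbb{C}\setminus\mathbb{R}$ the system is called limit point at $b$ if $\dim\ker(T_{\max}-\lambda I)=1$ and limit circle at $b$ if $\dim\ker(T_{\max}-\lambda I)=2$ (one of the two holds, independently of $\lambda$). **Neumann $m$-function.** In the limit circle case (which includes the regular case) $u_2(b):=\lim_{x\to b}u_2(x)$ exists for all $(u_1,u_2,f)\in\mathcal{T}$, and the Neumann $m$-function is the function $m_N(\lambda)$ for which $\psi=s-m_N(\lambda)c$ satisfies $\psi_2(b,\lambda)=0$, that is, $m_N(\lambda)=s_2(b,\lambda)/c_2(b,\lambda)$. In the limit point case, $m_N(\lambda)$, $\lambda\in\mathbb{C}\setminus\mathbb{R}$, is the unique coefficient such that $s_1(\cdot,\lambda)-m_N(\lambda)c_1(\cdot,\lambda)\in\mathcal{L}^2(R_2)$.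 **Principal Titchmarsh-Weyl coefficient** of $S[R_1,R_2]$: $q(\lambda):=\lim_{x\to b}\dfrac{s_1(x,\lambda)}{c_1(x,\lambda)}$, $\lambda\in\mathbb{C}\setminus[0,\infty)$. **Dual system.** If $S[R_1,R_2]$ is singular, $\widehat S[R_1,R_2]:=S[R_2,R_1]$ on $[0,b)$, i.e. $\widehat u_1(x)=\widehat u_1(0)+\int_0^x\widehat u_2\,dR_2$, $\widehat u_2(x)=\widehat u_2(0)-\lambda\int_0^x\widehat u_1\,dR_1$. If $S[R_1,R_2]$ is regular, then (with $b<\infty$) its canonical singular continuation is the system $S[\widetilde R_1,\widetilde R_2]$ on $[0,\infty)$, where $\widetilde R_j=R_j$ on $[0,b]$, and $\widetilde R_1(x)=R_1(b)$, $\widetilde R_2(x)=R_2(b)+x-b$ for $x\ge b$; and $\widehat S[R_1,R_2]:=S[\widetilde R_2,\widetilde R_1]$ on $[0,\infty)$. Write the dual system as $S[Q_1,Q_2]$ on $[0,\beta)$, where $(Q_1,Q_2,\beta)=(R_2,R_1,b)$ if $S[R_1,R_2]$ is singular and $(Q_1,Q_2,\beta)=(\widetilde R_2,\widetilde R_1,\infty)$ if $S[R_1,R_2]$ is regular; it reads $$\widehat u_1(x)=\widehat u_1(0)+\int_0^x\widehat u_2\,dQ_1,\qquad \widehat u_2(x)=\widehat u_2(0)-\lambda\int_0^x\widehat u_1\,dQ_2,\qquad x\in[0,\beta).$$ The objects with a hat ($\widehat c,\widehat s,\widehat U,\widehat m_N,\widehat q$) belong to the dual system and are the following. $\widehat c(\cdot,\lambda)=[\widehat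 c_1\ \widehat c_2]^T$ and $\widehat s(\cdot,\lambda)=[\widehat s_1\ \widehat s_2]^T$ are its solutions with $\widehat c_1(0,\lambda)=1$, $\widehat c_2(0,\lambda)=0$, $\widehat s_1(0,\lambda)=0$, $\widehat s_2(0,\lambda)=1$, and $\widehat U(x,\lambda)=\begin{bmatrix}\widehat c_1(x,\lambda)&\widehat s_1(x,\lambda)\\\widehat c_2(x,\lambda)&\widehat s_2(x,\lambda)\end{bmatrix}$. Let $\mathcal{L}^2(Q_2)$ be the space of complex functions on $[0,\beta)$ with $\int_{[0,\beta)}|f|^2dQ_2<\infty$, let $L^2(Q_2)$ be its quotient modulo $dQ_2$-a.e. equality with quotient map $\widehat\pi$, and let $\widehat T_{\max}$ be the linear relation in $L^2(Q_2)$ consisting of all $[\widehat\pi u_1\ \widehat\pi f]^T$ with $u_1,f\in\mathcal{L}^2(Q_2)$ for which there is $u_2$ such that $u_1(x)=u_1(0)+\int_0^xu_2\,dQ_1$ and $u_2(x)=u_2(0)-\int_0^xf\,dQ_2$ for all $x\in[0,\beta)$. For $\lambda\in\mathbb{C}\setminus\mathbb{R}$ the dual system is limit point at $\beta$ if $\dim\ker(\widehat T_{\max}-\lambda I)=1$ and limit circle at $\beta$ if $\dim\ker(\widehat T_{\max}-\lambda I)=2$. In the limit circle case $\widehat m_N(\lambda)$ is the function for which $\widehat\psi=\widehat s-\widehat m_N(\lambda)\widehat c$ satisfies $\lim_{x\to\beta}\widehat\psi_2(x,\lambda)=0$, that is, $\widehat m_N(\lambda)=\lim_{x\to\beta}\widehat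 s_2(x,\lambda)/\lim_{x\to\beta}\widehat c_2(x,\lambda)$; in the limit point case $\widehat m_N(\lambda)$, $\lambda\in\mathbb{C}\setminus\mathbb{R}$, is the unique coefficient such that $\widehat s_1(\cdot,\lambda)-\widehat m_N(\lambda)\widehat c_1(\cdot,\lambda)\in\mathcal{L}^2(Q_2)$. Finally, $\widehat q(\lambda):=\lim_{x\to\beta}\dfrac{\widehat s_1(x,\lambda)}{\widehat c_1(x,\lambda)}$, $\lambda\in\mathbb{C}\setminus[0,\infty)$. *)

theory Defs
  imports "HOL-Analysis.Analysis"
begin

section \<open>Lebesgue-Stieltjes measures on a half-open interval\<close>

text \<open>The right endpoint \<open>b\<close> is an extended real. The interval \<open>[0,b)\<close> is \<open>hintv b\<close>, and
  \<open>at_end b\<close> is the filter of \<open>x \<rightarrow> b\<close>. Functions on \<open>[0,b)\<close> are functions on the real line;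
  their values off \<open>[0,b)\<close> are never used.\<close>

definition hintv :: "ereal \<Rightarrow> real set" where
  "hintv b = {x. 0 \<le> x \<and> ereal x < b}"

definition at_end :: "ereal \<Rightarrow> real filter" where
  "at_end b = (if b = \<infinity> then at_top else at_left (real_of_ereal b))"

text \<open>\<open>R(b)\<close>, a value in \<open>[0,\<infinity>]\<close>.\<close>

definition end_val :: "ereal \<Rightarrow> (real \<Rightarrow> real) \<Rightarrow> ereal" where
  "end_val b R = Lim (at_end b) (\<lambda>x. ereal (R x))"

definition dist_fun :: "ereal \<Rightarrow> (real \<Rightarrow> real) \<Rightarrow> bool" where
  "dist_fun b R \<longleftrightarrow> mono_on (hintv b) R \<and> R 0 = 0 \<and>
     (\<forall>x\<in>hintv b. 0 < x \<longrightarrow> continuous (at_left x) R)"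

text \<open>\<open>dR\<close> for left-continuous \<open>R\<close>: the measure on \<open>[0,b)\<close> with \<open>dR [s,t) = R t - R s\<close>, so that an
  atom at \<open>x\<close> (also at \<open>0\<close>) has mass \<open>R (x+) - R x\<close>. The library's \<open>interval_measure\<close> does not
  apply, since it is for right-continuous functions on the whole line and \<open>R\<close> may be unbounded
  near a finite \<open>b\<close>.\<close>

definition LS :: "ereal \<Rightarrow> (real \<Rightarrow> real) \<Rightarrow> real measure" where
  "LS b R = extend_measure (hintv b) {(s, t). s \<in> hintv b \<and> t \<in> hintv b \<and> s \<le> t}
     (\<lambda>(s, t). {s..<t}) (\<lambda>(s, t). ennreal (R t - R s))"

section \<open>The space of square-integrable functions and its quotient\<close>

definition sq_int :: "real measure \<Rightarrow> (real \<Rightarrow> complex) set" where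
  "sq_int M = {f \<in> borel_measurable M. integrable M (\<lambda>x. (cmod (f x))\<^sup>2)}"

text \<open>The quotient map; an element of the quotient space is the set of its representatives.\<close>

definition L2_class :: "real measure \<Rightarrow> (real \<Rightarrow> complex) \<Rightarrow> (real \<Rightarrow> complex) set" where
  "L2_class M f = {g \<in> sq_int M. AE x in M. g x = f x}"

definition L2_scale :: "real measure \<Rightarrow> complex \<Rightarrow> (real \<Rightarrow> complex) set \<Rightarrow> (real \<Rightarrow> complex) set" where
  "L2_scale M a A = {g \<in> sq_int M. \<exists>f\<in>A. AE x in M. g x = a * f x}"

text \<open>\<open>K\<close>, a linear subspace of the quotient, has a basis with \<open>n\<close> elements; the basis is given by
  representatives \<open>f 0, \<dots>, f (n - 1)\<close>.\<close>

definition L2_has_dim :: "real measure \<Rightarrow> (real \<Rightarrow> complex) set set \<Rightarrow> nat \<Rightarrow> bool" where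
  "L2_has_dim M K n \<longleftrightarrow> (\<exists>f :: nat \<Rightarrow> real \<Rightarrow> complex.
     (\<forall>i<n. f i \<in> sq_int M \<and> L2_class M (f i) \<in> K) \<and>
     (\<forall>a. (AE x in M. (\<Sum>i<n. a i * f i x) = 0) \<longrightarrow> (\<forall>i<n. a i = 0)) \<and>
     (\<forall>A\<in>K. \<exists>a. A = L2_class M (\<lambda>x. \<Sum>i<n. a i * f i x)))"

section \<open>Integral systems\<close>

text \<open>In an integral system \<open>S[R1,R2]\<close> on \<open>[0,b)\<close>, \<open>R1\<close> and \<open>R2\<close> are subject to the standing
  assumptions: no common discontinuity, and linear independence of the classes of \<open>1\<close> and \<open>R1\<close> in
  the \<open>L2\<close> space of \<open>dR2\<close> on some \<open>[0,b0)\<close>.\<close>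

definition integral_system :: "ereal \<Rightarrow> (real \<Rightarrow> real) \<Rightarrow> (real \<Rightarrow> real) \<Rightarrow> bool" where
  "integral_system b R1 R2 \<longleftrightarrow> 0 < b \<and> dist_fun b R1 \<and> dist_fun b R2 \<and>
     (\<forall>x\<in>hintv b. continuous (at x within hintv b) R1 \<or> continuous (at x within hintv b) R2) \<and>
     (\<exists>b0\<le>b. (\<lambda>x. 1) \<in> sq_int (LS b0 R2) \<and> (\<lambda>x. complex_of_real (R1 x)) \<in> sq_int (LS b0 R2) \<and>
        (\<forall>a1 a2 :: complex. (AE x in LS b0 R2. a1 + a2 * complex_of_real (R1 x) = 0)
           \<longrightarrow> a1 = 0 \<and> a2 = 0))"

definition regular_system :: "ereal \<Rightarrow> (real \<Rightarrow> real) \<Rightarrow> (real \<Rightarrow> real) \<Rightarrow> bool" where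
  "regular_system b R1 R2 \<longleftrightarrow> end_val b R1 + end_val b R2 < \<infinity>"

text \<open>Integrals from \<open>0\<close> to \<open>x\<close> are over \<open>[0,x)\<close>. Integrability is required explicitly because the
  Bochner integral of a non-integrable function is \<open>0\<close>.\<close>

definition solves ::
  "ereal \<Rightarrow> (real \<Rightarrow> real) \<Rightarrow> (real \<Rightarrow> real) \<Rightarrow>
   (real \<Rightarrow> complex) \<Rightarrow> (real \<Rightarrow> complex) \<Rightarrow> (real \<Rightarrow> complex) \<Rightarrow> bool" where
  "solves b R1 R2 f u1 u2 \<longleftrightarrow> (\<forall>x\<in>hintv b.
     set_integrable (LS b R1) {0..<x} u2 \<and> set_integrable (LS b R2) {0..<x} f \<and>
     u1 x = u1 0 + (LINT t:{0..<x}|LS b R1. u2 t) \<and>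
     u2 x = u2 0 - (LINT t:{0..<x}|LS b R2. f t))"

text \<open>The solution of the system with spectral parameter \<open>l\<close> and given initial values. It is
  unique on \<open>[0,b)\<close>.\<close>

definition ivp_sol ::
  "ereal \<Rightarrow> (real \<Rightarrow> real) \<Rightarrow> (real \<Rightarrow> real) \<Rightarrow> complex \<Rightarrow> complex \<Rightarrow> complex \<Rightarrow>
   (real \<Rightarrow> complex) \<times> (real \<Rightarrow> complex)" where
  "ivp_sol b R1 R2 l a1 a2 = (SOME (u1, u2).
     solves b R1 R2 (\<lambda>x. l * u1 x) u1 u2 \<and> u1 0 = a1 \<and> u2 0 = a2)"

definition c1 :: "ereal \<Rightarrow> (real \<Rightarrow> real) \<Rightarrow> (real \<Rightarrow> real) \<Rightarrow> real \<Rightarrow> complex \<Rightarrow> complex" where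
  "c1 b R1 R2 x l = fst (ivp_sol b R1 R2 l 1 0) x"

definition c2 :: "ereal \<Rightarrow> (real \<Rightarrow> real) \<Rightarrow> (real \<Rightarrow> real) \<Rightarrow> real \<Rightarrow> complex \<Rightarrow> complex" where
  "c2 b R1 R2 x l = snd (ivp_sol b R1 R2 l 1 0) x"

definition s1 :: "ereal \<Rightarrow> (real \<Rightarrow> real) \<Rightarrow> (real \<Rightarrow> real) \<Rightarrow> real \<Rightarrow> complex \<Rightarrow> complex" where
  "s1 b R1 R2 x l = fst (ivp_sol b R1 R2 l 0 1) x"

definition s2 :: "ereal \<Rightarrow> (real \<Rightarrow> real) \<Rightarrow> (real \<Rightarrow> real) \<Rightarrow> real \<Rightarrow> complex \<Rightarrow> complex" where
  "s2 b R1 R2 x l = snd (ivp_sol b R1 R2 l 0 1) x"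

definition fund_matrix ::
  "ereal \<Rightarrow> (real \<Rightarrow> real) \<Rightarrow> (real \<Rightarrow> real) \<Rightarrow> real \<Rightarrow> complex \<Rightarrow> complex^2^2" where
  "fund_matrix b R1 R2 x l = vector [vector [c1 b R1 R2 x l, s1 b R1 R2 x l],
                                     vector [c2 b R1 R2 x l, s2 b R1 R2 x l]]"

definition D_matrix :: "complex \<Rightarrow> complex^2^2" where
  "D_matrix l = vector [vector [0, - inverse l], vector [1, 0]]"

section \<open>The maximal relation and the Neumann m-function\<close>

definition T_triples :: "ereal \<Rightarrow> (real \<Rightarrow> real) \<Rightarrow> (real \<Rightarrow> real) \<Rightarrow>
  ((real \<Rightarrow> complex) \<times> (real \<Rightarrow> complex) \<times> (real \<Rightarrow> complex)) set" where
  "T_triples b R1 R2 = {(u1, u2, f). u1 \<in> sq_int (LS b R2) \<and> f \<in> sq_int (LS b R2) \<and>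
     solves b R1 R2 f u1 u2}"

definition T_max :: "ereal \<Rightarrow> (real \<Rightarrow> real) \<Rightarrow> (real \<Rightarrow> real) \<Rightarrow>
  ((real \<Rightarrow> complex) set \<times> (real \<Rightarrow> complex) set) set" where
  "T_max b R1 R2 = {(L2_class (LS b R2) u1, L2_class (LS b R2) f) | u1 u2 f.
     (u1, u2, f) \<in> T_triples b R1 R2}"

text \<open>\<open>A\<close> is in the kernel of the linear relation \<open>T_max - l I = {(A, B - l A) | (A, B) \<in> T_max}\<close>
  iff \<open>(A, l A) \<in> T_max\<close>.\<close>

definition ker_T_max ::
  "ereal \<Rightarrow> (real \<Rightarrow> real) \<Rightarrow> (real \<Rightarrow> real) \<Rightarrow> complex \<Rightarrow> (real \<Rightarrow> complex) set set" where
  "ker_T_max b R1 R2 l = {A. (A, L2_scale (LS b R2) l A) \<in> T_max b R1 R2}"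

text \<open>For non-real \<open>l\<close> exactly one of the following two alternatives holds, and which one does not
  depend on \<open>l\<close>.\<close>

definition limit_point :: "ereal \<Rightarrow> (real \<Rightarrow> real) \<Rightarrow> (real \<Rightarrow> real) \<Rightarrow> complex \<Rightarrow> bool" where
  "limit_point b R1 R2 l \<longleftrightarrow> L2_has_dim (LS b R2) (ker_T_max b R1 R2 l) 1"

definition limit_circle :: "ereal \<Rightarrow> (real \<Rightarrow> real) \<Rightarrow> (real \<Rightarrow> real) \<Rightarrow> complex \<Rightarrow> bool" where
  "limit_circle b R1 R2 l \<longleftrightarrow> L2_has_dim (LS b R2) (ker_T_max b R1 R2 l) 2"

definition m_N :: "ereal \<Rightarrow> (real \<Rightarrow> real) \<Rightarrow> (real \<Rightarrow> real) \<Rightarrow> complex \<Rightarrow> complex" where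
  "m_N b R1 R2 l =
     (if limit_circle b R1 R2 l
      then Lim (at_end b) (\<lambda>x. s2 b R1 R2 x l) / Lim (at_end b) (\<lambda>x. c2 b R1 R2 x l)
      else if limit_point b R1 R2 l
      then (THE m. (\<lambda>x. s1 b R1 R2 x l - m * c1 b R1 R2 x l) \<in> sq_int (LS b R2))
      else undefined)"

text \<open>The Neumann m-function of a regular system with boundary condition \<open>u1(b) = 0\<close>.\<close>

definition m_ND :: "ereal \<Rightarrow> (real \<Rightarrow> real) \<Rightarrow> (real \<Rightarrow> real) \<Rightarrow> complex \<Rightarrow> complex" where
  "m_ND b R1 R2 l =
     Lim (at_end b) (\<lambda>x. s1 b R1 R2 x l) / Lim (at_end b) (\<lambda>x. c1 b R1 R2 x l)"

section \<open>The principal Titchmarsh-Weyl coefficient\<close>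

definition q_TW :: "ereal \<Rightarrow> (real \<Rightarrow> real) \<Rightarrow> (real \<Rightarrow> real) \<Rightarrow> complex \<Rightarrow> complex" where
  "q_TW b R1 R2 l = Lim (at_end b) (\<lambda>x. s1 b R1 R2 x l / c1 b R1 R2 x l)"

section \<open>The dual system\<close>

text \<open>Canonical singular continuation, for a regular system with \<open>b < \<infinity>\<close>.\<close>

definition cont_R1 :: "ereal \<Rightarrow> (real \<Rightarrow> real) \<Rightarrow> real \<Rightarrow> real" where
  "cont_R1 b R1 x = (if ereal x < b then R1 x else real_of_ereal (end_val b R1))"

definition cont_R2 :: "ereal \<Rightarrow> (real \<Rightarrow> real) \<Rightarrow> real \<Rightarrow> real" where
  "cont_R2 b R2 x = (if ereal x < b then R2 x
     else real_of_ereal (end_val b R2) + x - real_of_ereal b)"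

text \<open>The dual of \<open>S[R1,R2]\<close> is \<open>S[dual_Q1 b R1 R2, dual_Q2 b R1 R2]\<close> on \<open>[0, dual_end b R1 R2)\<close>.\<close>

definition dual_end :: "ereal \<Rightarrow> (real \<Rightarrow> real) \<Rightarrow> (real \<Rightarrow> real) \<Rightarrow> ereal" where
  "dual_end b R1 R2 = (if regular_system b R1 R2 then \<infinity> else b)"

definition dual_Q1 :: "ereal \<Rightarrow> (real \<Rightarrow> real) \<Rightarrow> (real \<Rightarrow> real) \<Rightarrow> real \<Rightarrow> real" where
  "dual_Q1 b R1 R2 = (if regular_system b R1 R2 then cont_R2 b R2 else R2)"

definition dual_Q2 :: "ereal \<Rightarrow> (real \<Rightarrow> real) \<Rightarrow> (real \<Rightarrow> real) \<Rightarrow> real \<Rightarrow> real" where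
  "dual_Q2 b R1 R2 = (if regular_system b R1 R2 then cont_R1 b R1 else R1)"

end

theory Submission
  imports Defs
begin

text \<open>The theorem rests on two facts. If \<open>(u1, u2)\<close> solves the system with parameter \<open>l\<close>, then \<open>(u2, - l * u1)\<close>
solves the system with \<open>R1\<close> and \<open>R2\<close> exchanged (\<open>solution_swap\<close>), because the exchange only permutes the two integral
equations. By uniqueness this identifies the fundamental matrices: \<open>c1\<close> and \<open>s1\<close> of the exchanged system are \<open>s2\<close>
and \<open>- c2 / l\<close> (\<open>swap_fundamental\<close>). Hence the coefficient \<open>q\<close> of the exchanged system is the limit of
\<open>- c2 / (l * s2)\<close>, and the formula for it says that \<open>s1 / c1\<close> and \<open>s2 / c2\<close> have the same limit. Their difference
is \<open>1 / (c1 * c2)\<close> by the Wronskian identity, so the second fact is: in a singular system \<open>c1 * c2\<close> tends to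
infinity for every \<open>l\<close> outside \<open>[0,\<infinity>)\<close>.

To see this, write \<open>u2 * cnj u1 = const - l * A + B\<close> with the nondecreasing energies \<open>A\<close> (of \<open>u1\<close> for \<open>dR2\<close>) and
\<open>B\<close> (of \<open>u2\<close> for \<open>dR1\<close>) (\<open>green\<close>). Since \<open>1\<close> and \<open>- l\<close> do not point in opposite directions, a rotation
\<open>om\<close> puts both in the right half-plane, and \<open>H = Re (om * u2 * cnj u1)\<close> is nondecreasing along solutions. If
\<open>H\<close> stayed bounded along \<open>c\<close>, then \<open>\<bar>c1 * c2\<bar>\<close> would be bounded below and both energies would be finite; then
\<open>\<bar>dc2\<bar> \<le> const * \<bar>c2\<bar> * \<bar>c1\<bar>\<^sup>2 dR2\<close> and its counterpart for \<open>c1\<close> show that \<open>c1\<close> and \<open>c2\<close> are bounded,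
hence bounded away from \<open>0\<close>, hence that \<open>R1\<close> and \<open>R2\<close> are bounded, contradicting singularity (\<open>HC_unbounded\<close>).
Weyl's nested discs, of diameter at most \<open>\<bar>om\<bar> / H\<close>, then give the limit \<open>q\<close> of \<open>s1 / c1\<close> (\<open>quotient_le\<close>).

In a singular system the Neumann \<open>m\<close>-function is \<open>q\<close> (\<open>m_N_eq_q\<close>). The solution \<open>s - q * c\<close> always has a
square-integrable first component. If \<open>c1\<close> does not, this is the limit point case and \<open>q\<close> is the only possible
coefficient. If \<open>c1\<close> does, this is the limit circle case, \<open>c2\<close> has a limit different from \<open>0\<close> (\<open>C2_limit\<close>), and
the limit of \<open>s2 / c2\<close> is again \<open>q\<close>.

A regular system is reduced to the singular one obtained by continuing it beyond \<open>b\<close>: the dual system is the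
exchange of the continuation, and there \<open>u1\<close> is constant beyond \<open>b\<close>, so that \<open>q\<close> of the continuation is
\<open>s1 / c1\<close> at \<open>b\<close> (\<open>regular_continuation\<close>).\<close>

section \<open>Half-open intervals and their ends\<close>

lemma hintv_mono: "x \<in> hintv b \<Longrightarrow> 0 \<le> y \<Longrightarrow> y \<le> x \<Longrightarrow> y \<in> hintv b"
  unfolding hintv_def by (auto intro: order.strict_trans1[of "ereal y" "ereal x"])

lemma zero_in_hintv: "0 < b \<Longrightarrow> 0 \<in> hintv b"
  unfolding hintv_def by (simp add: zero_ereal_def)

lemma hintv_nonneg: "x \<in> hintv b \<Longrightarrow> 0 \<le> x"
  by (simp add: hintv_def)

lemma hintv_infinity: "hintv \<infinity> = {0..}"
  by (auto simp: hintv_def)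

lemma hintv_ereal: "hintv (ereal r) = {0..<r}"
  by (auto simp: hintv_def)

lemma Ico_subset_hintv: "s \<in> hintv b \<Longrightarrow> t \<in> hintv b \<Longrightarrow> {s..<t} \<subseteq> hintv b"
proof
  fix x assume "s \<in> hintv b" "t \<in> hintv b" "x \<in> {s..<t}"
  then show "x \<in> hintv b" using hintv_nonneg[of s b] hintv_mono[of t b x] by auto
qed

lemma hintv_borel [measurable, simp]: "hintv b \<in> sets borel"
proof -
  have "hintv b = {0..} \<inter> {x. ereal x < b}" by (auto simp: hintv_def)
  then show ?thesis by (simp)
qed

lemma hintv_Ico_subset: "x \<in> hintv b \<Longrightarrow> {0..<x} \<subseteq> hintv b"
  by (auto intro: hintv_mono)

lemma Ico_hintv_borel: "x \<in> hintv b \<Longrightarrow> 0 \<le> s \<Longrightarrow> {s..<x} \<in> sets (restrict_space borel (hintv b))"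
  by (subst sets_restrict_space_iff) (auto intro: hintv_mono)

text \<open>A sequence increasing to the end replaces the filter wherever countability is needed.\<close>

lemma hintv_cofinal:
  assumes "0 < b"
  obtains X :: "nat \<Rightarrow> real" where "incseq X" "\<And>n. X n \<in> hintv b" "\<And>x. x \<in> hintv b \<Longrightarrow> \<exists>n. x < X n"
proof (cases b)
  case PInf
  then show ?thesis
    by (intro that[of "\<lambda>n. real n"]) (auto simp: incseq_def hintv_def reals_Archimedean2)
next
  case MInf then show ?thesis using assms by simp
next
  case (real r)
  then have r: "0 < r" using assms by simp
  define X where "X n = r - r / real (Suc (Suc n))" for n
  show ?thesis
  proof (rule that[of X])
    show "incseq X" using r by (auto simp: incseq_def X_def frac_le)
    show "X n \<in> hintv b" for n
      using r by (auto simp: hintv_def X_def real field_simps)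
    fix x assume "x \<in> hintv b"
    then have x: "x < r" by (auto simp: hintv_def real)
    obtain n where n: "r / (r - x) < real n" using reals_Archimedean2 by blast
    have "r < real n * (r - x)" using n x by (simp add: field_simps)
    also have "\<dots> \<le> real (Suc (Suc n)) * (r - x)" using x by (intro mult_right_mono) auto
    finally have "r / real (Suc (Suc n)) < r - x" by (simp add: field_simps)
    then show "\<exists>n. x < X n" by (auto simp: X_def intro!: exI[of _ n])
  qed
qed

lemma hintv_cofinal_cover:
  assumes "\<And>n. X n \<in> hintv b" "\<And>x. x \<in> hintv b \<Longrightarrow> \<exists>n. x < X n"
  shows "(\<Union>n. {0..<X n}) = hintv b"
proof (intro equalityI subsetI)
  fix x assume "x \<in> (\<Union>n. {0..<X n})"
  then obtain n where "0 \<le> x" "x < X n" by auto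
  then show "x \<in> hintv b" using hintv_mono[OF assms(1)[of n], of x] by simp
next
  fix x assume x: "x \<in> hintv b"
  then obtain n where "x < X n" using assms(2) by blast
  then show "x \<in> (\<Union>n. {0..<X n})" using hintv_nonneg[OF x] by auto
qed

lemma hintv_bigger: "x \<in> hintv b \<Longrightarrow> \<exists>y\<in>hintv b. x < y"
proof -
  assume x: "x \<in> hintv b"
  then have "0 < b" unfolding hintv_def
    by (auto simp: zero_ereal_def intro: order.strict_trans1[of "ereal 0" "ereal x"])
  then show ?thesis using hintv_cofinal x by metis
qed

lemma eventually_at_end:
  assumes "0 < b"
  shows "eventually P (at_end b) \<longleftrightarrow> (\<exists>x0\<in>hintv b. \<forall>x\<in>hintv b. x0 < x \<longrightarrow> P x)"
proof (cases b)
  case PInf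
  have "eventually P at_top \<longleftrightarrow> (\<exists>x0\<in>{0..}. \<forall>x\<in>{0..}. x0 < x \<longrightarrow> P x)"
    unfolding eventually_at_top_dense
  proof
    assume "\<exists>N. \<forall>n>N. P n"
    then obtain N where "\<forall>n>N. P n" ..
    then show "\<exists>x0\<in>{0..}. \<forall>x\<in>{0..}. x0 < x \<longrightarrow> P x"
      by (intro bexI[of _ "max 0 N"]) auto
  next
    assume "\<exists>x0\<in>{0..}. \<forall>x\<in>{0..}. x0 < x \<longrightarrow> P x"
    then obtain x0 where "0 \<le> x0" "\<forall>x\<in>{0..}. x0 < x \<longrightarrow> P x" by auto
    then have "\<forall>n>x0. P n" by auto
    then show "\<exists>N. \<forall>n>N. P n" ..
  qed
  then show ?thesis by (simp add: at_end_def PInf hintv_infinity)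
next
  case MInf then show ?thesis using assms by simp
next
  case (real r)
  then have r: "0 < r" using assms by simp
  have "at_end b = at_left r" by (simp add: at_end_def real)
  moreover have "eventually P (at_left r) \<longleftrightarrow> (\<exists>x0\<in>{0..<r}. \<forall>x\<in>{0..<r}. x0 < x \<longrightarrow> P x)"
    unfolding eventually_at_left[OF r]
  proof safe
    fix x0 assume "x0 < r" "\<forall>y>x0. y < r \<longrightarrow> P y"
    then show "\<exists>x0\<in>{0..<r}. \<forall>x\<in>{0..<r}. x0 < x \<longrightarrow> P x"
      using r by (intro bexI[of _ "max 0 x0"]) auto
  next
    fix x0 assume "x0 \<in> {0..<r}" "\<forall>x\<in>{0..<r}. x0 < x \<longrightarrow> P x"
    then show "\<exists>b<r. \<forall>y>b. y < r \<longrightarrow> P y" by (intro exI[of _ x0]) auto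
  qed
  ultimately show ?thesis by (simp add: real hintv_ereal)
qed

lemma at_end_nonbot: "0 < b \<Longrightarrow> at_end b \<noteq> bot"
  by (cases b) (auto simp: at_end_def trivial_limit_at_left_real)

lemma eventually_at_end_ge:
  "x0 \<in> hintv b \<Longrightarrow> 0 < b \<Longrightarrow> eventually (\<lambda>x. x \<in> hintv b \<and> x0 < x) (at_end b)"
  by (subst eventually_at_end) auto

lemma sets_restrict_borel_hintv:
  assumes "0 < b"
  shows "sets (restrict_space borel (hintv b)) =
    sigma_sets (hintv b) ((\<lambda>(s, t). {s..<t}) ` {(s, t). s \<in> hintv b \<and> t \<in> hintv b \<and> s \<le> t})"
    (is "_ = sigma_sets ?\<Omega> ?G")
proof
  have G: "?G \<subseteq> sets (restrict_space borel (hintv b))"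
    by (auto simp: Ico_hintv_borel hintv_nonneg)
  then show "sigma_sets ?\<Omega> ?G \<subseteq> sets (restrict_space borel (hintv b))"
    using sets.sigma_sets_subset[OF G] by (simp add: space_restrict_space)
  have Gsub: "?G \<subseteq> Pow ?\<Omega>" using Ico_subset_hintv[of _ b] by fast
  interpret S: sigma_algebra ?\<Omega> "sigma_sets ?\<Omega> ?G"
    by (rule sigma_algebra_sigma_sets[OF Gsub])
  have id: "(\<lambda>x. x) \<in> measurable (sigma ?\<Omega> ?G) (borel :: real measure)"
    unfolding borel_Iio
  proof (rule measurable_measure_of)
    show "(\<lambda>x. x) \<in> space (sigma ?\<Omega> ?G) \<rightarrow> UNIV" by simp
    fix A :: "real set" assume "A \<in> range lessThan"
    then obtain a where A: "A = {..<a}" by auto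
    consider "a \<in> ?\<Omega>" | "a \<le> 0" | "a \<notin> ?\<Omega>" "0 < a" by linarith
    then have "A \<inter> ?\<Omega> \<in> sigma_sets ?\<Omega> ?G"
    proof cases
      case 1
      have "A \<inter> ?\<Omega> = {0..<a}" using hintv_nonneg[of _ b] hintv_mono[OF 1] by (auto simp: A)
      moreover have "{0..<a} \<in> ?G" 
        by (rule image_eqI[of _ _ "(0, a)"]) (use 1 zero_in_hintv[OF assms] hintv_nonneg[of a b] in auto)
      ultimately show ?thesis by (simp only: sigma_sets.Basic)
    next
      case 2
      then have "A \<inter> ?\<Omega> = {}" by (auto simp: A hintv_def)
      then show ?thesis by simp
    next
      case 3
      then have "A \<inter> ?\<Omega> = ?\<Omega>"
        proof (intro equalityI subsetI)
        fix x assume x: "x \<in> ?\<Omega>"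
        then have "\<not> a \<le> x" using 3 hintv_mono[OF x, of a] by auto
        then show "x \<in> A \<inter> ?\<Omega>" using x by (simp add: A)
      qed simp
      then show ?thesis by (simp add: sigma_sets_top)
    qed
    then show "(\<lambda>x. x) -` A \<inter> space (sigma ?\<Omega> ?G) \<in> sets (sigma ?\<Omega> ?G)"
      using Gsub by simp
  qed simp
  show "sets (restrict_space borel (hintv b)) \<subseteq> sigma_sets ?\<Omega> ?G"
  proof
    fix B assume "B \<in> sets (restrict_space borel (hintv b))"
    then obtain A where A: "A \<in> sets borel" "B = hintv b \<inter> A" by (auto simp: sets_restrict_space)
    have "(\<lambda>x. x) -` A \<inter> space (sigma ?\<Omega> ?G) \<in> sets (sigma ?\<Omega> ?G)"
      by (rule measurable_sets[OF id A(1)])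
    then show "B \<in> sigma_sets ?\<Omega> ?G" using Gsub A(2) by (simp add: Int_commute)
  qed
qed

section \<open>The Stieltjes measure\<close>

lemma dist_fun_mono: "dist_fun b R \<Longrightarrow> x \<in> hintv b \<Longrightarrow> y \<in> hintv b \<Longrightarrow> x \<le> y \<Longrightarrow> R x \<le> R y"
  by (auto simp: dist_fun_def mono_on_def)

lemma dist_fun_zero: "dist_fun b R \<Longrightarrow> R 0 = 0"
  by (auto simp: dist_fun_def)

lemma dist_fun_nonneg: "dist_fun b R \<Longrightarrow> x \<in> hintv b \<Longrightarrow> 0 \<le> R x"
  using dist_fun_mono[of b R 0 x] dist_fun_zero[of b R] hintv_nonneg[of x b] hintv_mono[of x b 0] by auto

lemma dist_fun_left:
  assumes "dist_fun b R" "x \<in> hintv b" "y < R x" "0 \<le> y"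
  shows "\<exists>t\<in>hintv b. t < x \<and> y < R t"
proof -
  have x0: "0 < x"
    using assms hintv_nonneg[of x b] dist_fun_zero[of b R] by (cases "x = 0") auto
  have "(R \<longlongrightarrow> R x) (at_left x)"
    using assms x0 by (auto simp: dist_fun_def continuous_within)
  then have "eventually (\<lambda>t. y < R t) (at_left x)" using assms(3) by (rule order_tendstoD)
  then obtain z where z: "z < x" "\<And>t. z < t \<Longrightarrow> t < x \<Longrightarrow> y < R t"
    unfolding eventually_at_left[OF x0] by blast
  obtain t where "max 0 z < t" "t < x" using z x0 dense[of "max 0 z" x] by auto
  then show ?thesis using z assms hintv_mono[of x b t] by (intro bexI[of _ t]) auto
qed

text \<open>The Stieltjes measure is realised as the image of Lebesgue measure under the generalised inverse of \<open>R\<close>. Besides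
existence, this turns \<open>\<integral> R^n dR\<close> into an integral of powers. For left-continuous \<open>R\<close> the inverse is characterised by
\<open>quantile_less_iff\<close>, so that the preimage of \<open>[s,t)\<close> is \<open>[R s, R t)\<close>.\<close>

definition quantile :: "ereal \<Rightarrow> (real \<Rightarrow> real) \<Rightarrow> real \<Rightarrow> real" where
  "quantile b R y = Inf {t \<in> hintv b. y < R t}"

definition quantile_dom :: "ereal \<Rightarrow> (real \<Rightarrow> real) \<Rightarrow> real set" where
  "quantile_dom b R = {y. 0 \<le> y \<and> (\<exists>x\<in>hintv b. y < R x)}"

lemma quantile_less_iff:
  assumes "dist_fun b R" "y \<in> quantile_dom b R" "x \<in> hintv b"
  shows "quantile b R y < x \<longleftrightarrow> y < R x"
proof -
  let ?S = "{t \<in> hintv b. y < R t}"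
  have S: "?S \<noteq> {}" "bdd_below ?S"
    using assms(2) by (auto simp: quantile_dom_def intro!: bdd_belowI[of _ 0] hintv_nonneg)
  have "quantile b R y < x \<longleftrightarrow> (\<exists>t\<in>?S. t < x)"
    unfolding quantile_def by (rule cInf_less_iff[OF S])
  also have "\<dots> \<longleftrightarrow> y < R x"
    using dist_fun_left[OF assms(1,3), of y] assms dist_fun_mono[OF assms(1) _ assms(3)]
    by (auto simp: quantile_dom_def) (meson less_imp_le order.strict_trans2)
  finally show ?thesis .
qed

lemma quantile_in_hintv:
  assumes "dist_fun b R" "y \<in> quantile_dom b R"
  shows "quantile b R y \<in> hintv b"
proof -
  obtain x where x: "x \<in> hintv b" "y < R x" using assms(2) by (auto simp: quantile_dom_def)
  have "0 \<le> quantile b R y" unfolding quantile_def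
    by (rule cInf_greatest) (use x in \<open>auto simp: hintv_nonneg\<close>)
  then show ?thesis using quantile_less_iff[OF assms x(1)] x hintv_mono[of x b "quantile b R y"] by auto
qed

lemma R_quantile_le: "dist_fun b R \<Longrightarrow> y \<in> quantile_dom b R \<Longrightarrow> R (quantile b R y) \<le> y"
  using quantile_less_iff[of b R y "quantile b R y"] quantile_in_hintv[of b R y] by auto


definition quantile_measure :: "ereal \<Rightarrow> (real \<Rightarrow> real) \<Rightarrow> real measure" where
  "quantile_measure b R = distr (restrict_space lborel (quantile_dom b R)) (restrict_space borel (hintv b)) (quantile b R)"

lemma quantile_dom_borel: "dist_fun b R \<Longrightarrow> quantile_dom b R \<in> sets borel"
proof -
  have "quantile_dom b R = {0..} \<inter> (\<Union>x\<in>hintv b. {..<R x})"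
    by (auto simp: quantile_dom_def)
  then show ?thesis by (simp only:) (intro sets.Int borel_open open_UN ballI open_lessThan atLeast_borel)
qed

lemma quantile_measurable:
  assumes "0 < b" "dist_fun b R"
  shows "quantile b R \<in> measurable (restrict_space lborel (quantile_dom b R)) (restrict_space borel (hintv b))"
proof -
  have sp: "space (restrict_space lborel (quantile_dom b R)) = quantile_dom b R"
    by (simp add: space_restrict_space)
  have "quantile b R \<in> measurable (restrict_space lborel (quantile_dom b R))
      (sigma (hintv b) ((\<lambda>(s, t). {s..<t}) ` {(s, t). s \<in> hintv b \<and> t \<in> hintv b \<and> s \<le> t}))"
  proof (rule measurable_measure_of)
    fix A assume "A \<in> (\<lambda>(s, t). {s..<t}) ` {(s, t). s \<in> hintv b \<and> t \<in> hintv b \<and> s \<le> t}"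
    then obtain s t where A: "A = {s..<t}" "s \<in> hintv b" "t \<in> hintv b" by auto
    have "quantile b R -` A \<inter> quantile_dom b R = {R s..<R t} \<inter> quantile_dom b R"
      using quantile_less_iff[OF assms(2) _ A(2)] quantile_less_iff[OF assms(2) _ A(3)]
      by (auto simp: A not_less[symmetric])
    then show "quantile b R -` A \<inter> space (restrict_space lborel (quantile_dom b R))
        \<in> sets (restrict_space lborel (quantile_dom b R))"
      unfolding sp using quantile_dom_borel[OF assms(2)] by (subst sets_restrict_space_iff) auto
  next
    show "(\<lambda>(s, t). {s..<t}) ` {(s, t). s \<in> hintv b \<and> t \<in> hintv b \<and> s \<le> t} \<subseteq> Pow (hintv b)"
      using Ico_subset_hintv[of _ b] by fast
  qed (use sp quantile_in_hintv[OF assms(2)] in auto)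
  moreover have "sets (sigma (hintv b) ((\<lambda>(s, t). {s..<t}) ` {(s, t). s \<in> hintv b \<and> t \<in> hintv b \<and> s \<le> t}))
     = sets (restrict_space borel (hintv b))"
    unfolding sets_restrict_borel_hintv[OF assms(1)]
    by (rule sets_measure_of) (use Ico_subset_hintv[of _ b] in fast)
  ultimately show ?thesis
    using measurable_cong_sets[OF refl] by blast
qed

lemma emeasure_quantile_measure:
  assumes "0 < b" "dist_fun b R" "s \<in> hintv b" "t \<in> hintv b" "s \<le> t"
  shows "emeasure (quantile_measure b R) {s..<t} = ennreal (R t - R s)"
proof -
  have "quantile b R -` {s..<t} \<inter> quantile_dom b R = {R s..<R t}"
  proof (intro set_eqI iffI)
    fix y assume "y \<in> quantile b R -` {s..<t} \<inter> quantile_dom b R"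
    then show "y \<in> {R s..<R t}"
      using quantile_less_iff[OF assms(2) _ assms(3), of y] quantile_less_iff[OF assms(2) _ assms(4), of y] by auto
  next
    fix y assume y: "y \<in> {R s..<R t}"
    then have "y \<in> quantile_dom b R"
      using dist_fun_nonneg[OF assms(2,3)] assms(4) by (auto simp: quantile_dom_def)
    with y show "y \<in> quantile b R -` {s..<t} \<inter> quantile_dom b R"
      using quantile_less_iff[OF assms(2) _ assms(3), of y] quantile_less_iff[OF assms(2) _ assms(4), of y] by auto
  qed
  moreover have "{s..<t} \<in> sets (restrict_space borel (hintv b))"
    using assms by (intro Ico_hintv_borel) (auto simp: hintv_nonneg)
  moreover have "R s \<le> R t" using assms dist_fun_mono by blast
  moreover have "{R s..<R t} \<subseteq> quantile_dom b R" using calculation(1) by blast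
  ultimately show ?thesis
    unfolding quantile_measure_def
    by (subst emeasure_distr[OF quantile_measurable[OF assms(1,2)]])
       (auto simp: space_restrict_space emeasure_restrict_space quantile_dom_borel[OF assms(2)])
qed

lemma
  assumes "0 < b" "dist_fun b R"
  shows sets_LS: "sets (LS b R) = sets (restrict_space borel (hintv b))"
    and emeasure_LS: "s \<in> hintv b \<Longrightarrow> t \<in> hintv b \<Longrightarrow> s \<le> t \<Longrightarrow> emeasure (LS b R) {s..<t} = ennreal (R t - R s)"
proof -
  let ?I = "{(s, t). s \<in> hintv b \<and> t \<in> hintv b \<and> s \<le> t}" and ?G = "\<lambda>(s, t). {s..<t} :: real set"
  have sub: "?G ` ?I \<subseteq> Pow (hintv b)" using Ico_subset_hintv[of _ b] by fast
  show S: "sets (LS b R) = sets (restrict_space borel (hintv b))"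
    unfolding LS_def sets_restrict_borel_hintv[OF assms(1)]
    by (rule sets_extend_measure[OF sub])
  have S': "sets (LS b R) = sets (quantile_measure b R)" unfolding S by (simp add: quantile_measure_def)
  show "emeasure (LS b R) {s..<t} = ennreal (R t - R s)" if "s \<in> hintv b" "t \<in> hintv b" "s \<le> t"
  proof -
    have "emeasure (LS b R) (?G (s, t)) = (\<lambda>(s, t). ennreal (R t - R s)) (s, t)"
    proof (rule emeasure_extend_measure[OF LS_def])
      show "positive (sets (LS b R)) (emeasure (quantile_measure b R))"
        "countably_additive (sets (LS b R)) (emeasure (quantile_measure b R))"
        unfolding S' by (simp_all add: positive_def countably_additive_def suminf_emeasure)
    qed (use sub that emeasure_quantile_measure[OF assms] in auto)
    then show ?thesis by simp
  qed
qed

lemma space_LS: "0 < b \<Longrightarrow> dist_fun b R \<Longrightarrow> space (LS b R) = hintv b"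
  using sets_eq_imp_space_eq[OF sets_LS] by (simp add: space_restrict_space)

text \<open>The half-open intervals are closed under intersection and exhaust \<open>[0,b)\<close> by sets of finite measure, so
  they determine the measure.\<close>

lemma LS_eqI:
  assumes "0 < b" "dist_fun b R" "sets N = sets (restrict_space borel (hintv b))"
    "\<And>s t. s \<in> hintv b \<Longrightarrow> t \<in> hintv b \<Longrightarrow> s \<le> t \<Longrightarrow> emeasure N {s..<t} = ennreal (R t - R s)"
  shows "N = LS b R"
proof -
  let ?I = "{(s, t). s \<in> hintv b \<and> t \<in> hintv b \<and> s \<le> t}" and ?G = "\<lambda>(s, t). {s..<t} :: real set"
  obtain X where X: "incseq X" "\<And>n. X n \<in> hintv b" "\<And>x. x \<in> hintv b \<Longrightarrow> \<exists>n. x < X n"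
    by (rule hintv_cofinal[OF assms(1)]) (rule that)
  show ?thesis
  proof (rule measure_eqI_generator_eq[where E = "?G ` ?I" and \<Omega> = "hintv b" and A = "\<lambda>n. {0..<X n}"])
    show "Int_stable (?G ` ?I)"
    proof (rule Int_stableI)
      fix A B assume "A \<in> ?G ` ?I" "B \<in> ?G ` ?I"
      then obtain s t u v where A: "A = {s..<t}" "s \<in> hintv b" "t \<in> hintv b"
        and B: "B = {u..<v}" "u \<in> hintv b" "v \<in> hintv b" by auto
      have "A \<inter> B = ?G (max s u, max (max s u) (min t v))" using A B by auto
      moreover have "(max s u, max (max s u) (min t v)) \<in> ?I"
        using A B by (auto simp: max_def min_def)
      ultimately show "A \<inter> B \<in> ?G ` ?I" by blast
    qed
    show "?G ` ?I \<subseteq> Pow (hintv b)" using Ico_subset_hintv[of _ b] by fast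
    show "emeasure N Y = emeasure (LS b R) Y" if "Y \<in> ?G ` ?I" for Y
      using that assms(4) emeasure_LS[OF assms(1,2)] by auto
    show "sets N = sigma_sets (hintv b) (?G ` ?I)" "sets (LS b R) = sigma_sets (hintv b) (?G ` ?I)"
      using assms(3) sets_LS[OF assms(1,2)] sets_restrict_borel_hintv[OF assms(1)] by simp_all
    show "range (\<lambda>n. {0..<X n}) \<subseteq> ?G ` ?I"
    proof safe
      fix n show "{0..<X n} \<in> ?G ` ?I"
        using X(2)[of n] zero_in_hintv[OF assms(1)] hintv_nonneg[OF X(2)[of n]] by (intro image_eqI[of _ _ "(0, X n)"]) auto
    qed
    show "(\<Union>n. {0..<X n}) = hintv b"
      by (rule hintv_cofinal_cover[OF X(2,3)])
    show "emeasure N {0..<X i} \<noteq> \<infinity>" for i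
      using assms(4)[OF zero_in_hintv[OF assms(1)] X(2)] hintv_nonneg[OF X(2)[of i]] by simp
  qed
qed

lemma LS_eq_quantile_measure: "0 < b \<Longrightarrow> dist_fun b R \<Longrightarrow> LS b R = quantile_measure b R"
  by (rule LS_eqI[symmetric]) (simp_all add: emeasure_quantile_measure, simp add: quantile_measure_def)

lemma sigma_finite_LS:
  assumes "0 < b" "dist_fun b R" shows "sigma_finite_measure (LS b R)"
proof
  obtain X where X: "incseq X" "\<And>n. X n \<in> hintv b" "\<And>x. x \<in> hintv b \<Longrightarrow> \<exists>n. x < X n"
    by (rule hintv_cofinal[OF assms(1)]) (rule that)
  show "\<exists>A. countable A \<and> A \<subseteq> sets (LS b R) \<and> \<Union> A = space (LS b R) \<and> (\<forall>a\<in>A. emeasure (LS b R) a \<noteq> \<infinity>)"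
  proof (intro exI[of _ "range (\<lambda>n. {0..<X n})"] conjI ballI)
    show "range (\<lambda>n. {0..<X n}) \<subseteq> sets (LS b R)"
      unfolding sets_LS[OF assms] using X by (auto intro: Ico_hintv_borel)
    show "\<Union> (range (\<lambda>n. {0..<X n})) = space (LS b R)"
      unfolding space_LS[OF assms] by (rule hintv_cofinal_cover[OF X(2,3)])
    fix a assume "a \<in> range (\<lambda>n. {0..<X n})"
    then obtain n where "a = {0..<X n}" by auto
    then show "emeasure (LS b R) a \<noteq> \<infinity>"
      using emeasure_LS[OF assms zero_in_hintv[OF assms(1)] X(2)] hintv_nonneg[OF X(2)[of n]] by simp
  qed simp
qed

section \<open>Integration against a Stieltjes measure\<close>

locale stieltjes =
  fixes b :: ereal and R :: "real \<Rightarrow> real"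
  assumes b_pos: "0 < b" and dist: "dist_fun b R"
begin

abbreviation "M \<equiv> LS b R"

lemmas sets_M = sets_LS[OF b_pos dist]
lemmas space_M = space_LS[OF b_pos dist]
lemmas R_mono = dist_fun_mono[OF dist]
lemmas R_zero = dist_fun_zero[OF dist]
lemmas R_nonneg = dist_fun_nonneg[OF dist]
lemmas zero_in = zero_in_hintv[OF b_pos]

sublocale sigma_finite_measure M by (rule sigma_finite_LS[OF b_pos dist])

lemma measurable_M: "f \<in> borel_measurable M \<longleftrightarrow> f \<in> borel_measurable (restrict_space borel (hintv b))"
  by (rule measurable_cong_sets[OF sets_M refl, THEN eq_iff[THEN iffD1], THEN conjunct1, THEN subsetD, THEN iffI]) 
    (simp_all add: measurable_cong_sets[OF sets_M refl])

lemma Ico_sets: "x \<in> hintv b \<Longrightarrow> 0 \<le> s \<Longrightarrow> {s..<x} \<in> sets M"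
  unfolding sets_M by (rule Ico_hintv_borel)

lemma singleton_sets: "x \<in> hintv b \<Longrightarrow> {x} \<in> sets M"
  unfolding sets_M by (subst sets_restrict_space_iff) auto

lemma emeasure_Ico: "s \<in> hintv b \<Longrightarrow> t \<in> hintv b \<Longrightarrow> s \<le> t \<Longrightarrow> emeasure M {s..<t} = ennreal (R t - R s)"
  by (rule emeasure_LS[OF b_pos dist])

lemma measure_Ico: "s \<in> hintv b \<Longrightarrow> t \<in> hintv b \<Longrightarrow> s \<le> t \<Longrightarrow> measure M {s..<t} = R t - R s"
  using emeasure_Ico[of s t] R_mono[of s t] by (simp add: measure_def)

lemma emeasure_Ico_finite: "x \<in> hintv b \<Longrightarrow> emeasure M {0..<x} < \<infinity>"
  using emeasure_Ico[OF zero_in, of x] hintv_nonneg[of x b] by simp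

lemma set_integrable_bounded:
  fixes f :: "real \<Rightarrow> 'a::{banach, second_countable_topology}"
  assumes "f \<in> borel_measurable M" "x \<in> hintv b" "\<And>t. 0 \<le> t \<Longrightarrow> t < x \<Longrightarrow> norm (f t) \<le> C"
  shows "set_integrable M {0..<x} f"
  unfolding set_integrable_def
proof (rule integrableI_bounded_set[where A = "{0..<x}" and B = C])
  show "{0..<x} \<in> sets M" using assms by (simp add: Ico_sets)
  then show "(\<lambda>t. indicat_real {0..<x} t *\<^sub>R f t) \<in> borel_measurable M"
    using assms(1) by simp
qed (use assms emeasure_Ico_finite in \<open>auto simp: indicator_def\<close>)

definition locally_integrable :: "(real \<Rightarrow> 'a::{banach, second_countable_topology}) \<Rightarrow> bool" where
  "locally_integrable f \<longleftrightarrow> (\<forall>x\<in>hintv b. set_integrable M {0..<x} f)"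

lemma locally_integrableD: "locally_integrable f \<Longrightarrow> x \<in> hintv b \<Longrightarrow> set_integrable M {0..<x} f"
  by (simp add: locally_integrable_def)

lemma locally_integrable_Ico:
  assumes "locally_integrable f" "x \<in> hintv b" "0 \<le> s" shows "set_integrable M {s..<x} f"
  by (rule set_integrable_subset[OF locally_integrableD[OF assms(1,2)]])
     (use assms in \<open>auto intro!: Ico_sets\<close>)

lemma locally_integrable_measurable:
  assumes "locally_integrable f" shows "f \<in> borel_measurable M"
proof -
  obtain X where X: "incseq X" "\<And>n. X n \<in> hintv b" "\<And>x. x \<in> hintv b \<Longrightarrow> \<exists>n. x < X n"
    by (rule hintv_cofinal[OF b_pos]) (rule that)
  show ?thesis
  proof (rule measurable_piecewise_restrict[where C = "range (\<lambda>n. {0..<X n})"])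
    show "space M \<subseteq> \<Union> (range (\<lambda>n. {0..<X n}))"
      using hintv_cofinal_cover[OF X(2,3)] by (simp add: space_M)
    fix \<Omega> assume "\<Omega> \<in> range (\<lambda>n. {0..<X n})"
    then obtain n where n: "\<Omega> = {0..<X n}" by auto
    show S: "\<Omega> \<inter> space M \<in> sets M" using Ico_sets[OF X(2)[of n], of 0] by (simp add: n)
    have "set_integrable M {0..<X n} f" using assms X(2) by (simp add: locally_integrable_def)
    then have "(\<lambda>t. indicat_real {0..<X n} t *\<^sub>R f t) \<in> borel_measurable M"
      unfolding set_integrable_def by simp
    then show "f \<in> borel_measurable (restrict_space M \<Omega>)"
      using S by (simp add: borel_measurable_restrict_space_iff n)
  qed simp
qed

text \<open>Stated for the Borel sets of \<open>[0,b)\<close> rather than for \<open>M\<close>, since the primitive for one of the two measures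
  of a system is integrated against the other.\<close>

lemma primitive_measurable:
  fixes f :: "real \<Rightarrow> 'a::{banach, second_countable_topology}"
  assumes f: "f \<in> borel_measurable M"
  shows "(\<lambda>x. LINT t:{0..<x}|M. f t) \<in> borel_measurable (restrict_space borel (hintv b))"
proof -
  let ?B = "restrict_space borel (hintv b) :: real measure"
  have id1: "fst \<in> borel_measurable (?B \<Otimes>\<^sub>M M)"
    by (rule measurable_compose[OF measurable_fst]) (simp add: measurable_restrict_space1)
  have id2: "snd \<in> borel_measurable (?B \<Otimes>\<^sub>M M)"
    by (rule measurable_compose[OF measurable_snd])
       (simp add: measurable_M measurable_restrict_space1)
  have set: "{p \<in> space (?B \<Otimes>\<^sub>M M). 0 \<le> snd p \<and> snd p < fst p} \<in> sets (?B \<Otimes>\<^sub>M M)"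
    using id1 id2 by measurable
  have "(\<lambda>p. indicat_real {p \<in> space (?B \<Otimes>\<^sub>M M). 0 \<le> snd p \<and> snd p < fst p} p *\<^sub>R f (snd p))
      \<in> borel_measurable (?B \<Otimes>\<^sub>M M)"
    by (intro borel_measurable_scaleR borel_measurable_indicator set measurable_compose[OF measurable_snd f])
  then have "(\<lambda>(x,t). indicat_real {0..<x} t *\<^sub>R f t) \<in> borel_measurable (?B \<Otimes>\<^sub>M M)"
    by (rule measurable_cong[THEN iffD1, rotated]) (auto simp: indicator_def)
  from borel_measurable_lebesgue_integral[OF this] show ?thesis
    unfolding set_lebesgue_integral_def .
qed

lemma integral_split:
  fixes f :: "real \<Rightarrow> 'a::{banach, second_countable_topology}"
  assumes f: "locally_integrable f" and "s \<in> hintv b" "t \<in> hintv b" "s \<le> t"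
  shows "(LINT x:{0..<t}|M. f x) = (LINT x:{0..<s}|M. f x) + (LINT x:{s..<t}|M. f x)"
proof -
  have "{0..<t} = {0..<s} \<union> {s..<t}" using assms hintv_nonneg[of s b] by auto
  then show ?thesis
    using set_integral_Un[of "{0..<s}" "{s..<t}" M f] locally_integrable_Ico[OF f] assms hintv_nonneg[of s b]
    by (simp add: Int_def)
qed

lemma norm_integral_le:
  fixes f :: "real \<Rightarrow> 'a::{banach, second_countable_topology}"
  assumes f: "locally_integrable f" and g: "locally_integrable g"
    and st: "s \<in> hintv b" "t \<in> hintv b" and le: "\<And>x. s \<le> x \<Longrightarrow> x < t \<Longrightarrow> norm (f x) \<le> g x"
  shows "norm (LINT x:{s..<t}|M. f x) \<le> (LINT x:{s..<t}|M. g x)"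
proof -
  have "norm (LINT x:{s..<t}|M. f x) \<le> (LINT x:{s..<t}|M. norm (f x))"
    using locally_integrable_Ico[OF f st(2)] hintv_nonneg[OF st(1)] by (intro set_integral_norm_bound)
  also have "\<dots> \<le> (LINT x:{s..<t}|M. g x)"
    using locally_integrable_Ico[OF f st(2)] locally_integrable_Ico[OF g st(2)] hintv_nonneg[OF st(1)]
    by (intro set_integral_mono set_integrable_norm) (auto intro: le)
  finally show ?thesis .
qed

lemma integral_mono_Ico:
  fixes f g :: "real \<Rightarrow> real"
  assumes f: "locally_integrable f" and g: "locally_integrable g"
    and st: "s \<in> hintv b" "t \<in> hintv b" and le: "\<And>x. s \<le> x \<Longrightarrow> x < t \<Longrightarrow> f x \<le> g x"
  shows "(LINT x:{s..<t}|M. f x) \<le> (LINT x:{s..<t}|M. g x)"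
    using locally_integrable_Ico[OF f st(2)] locally_integrable_Ico[OF g st(2)] hintv_nonneg[OF st(1)]
    by (intro set_integral_mono) (auto intro: le)

lemma locally_integrable_const: "locally_integrable (\<lambda>_. c)"
  unfolding locally_integrable_def by (auto intro!: set_integrable_bounded[where C = "norm c"])

lemma integral_const_Ico:
  assumes "s \<in> hintv b" "t \<in> hintv b" "s \<le> t"
  shows "(LINT x:{s..<t}|M. c) = (R t - R s) *\<^sub>R (c :: 'a::{banach, second_countable_topology})"
  using emeasure_Ico[OF assms] measure_Ico[OF assms] Ico_sets[OF assms(2), of s] hintv_nonneg[OF assms(1)]
  by (simp add: set_lebesgue_integral_def) 

lemma primitive_left_continuous:
  fixes f :: "real \<Rightarrow> 'a::{banach, second_countable_topology}"
  assumes f: "locally_integrable f" and x: "x \<in> hintv b" "0 < x"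
  shows "((\<lambda>y. LINT t:{0..<y}|M. f t) \<longlongrightarrow> (LINT t:{0..<x}|M. f t)) (at_left x)"
  unfolding set_lebesgue_integral_def
proof (rule tendsto_at_left_sequentially[OF \<open>0 < x\<close>])
  fix S :: "nat \<Rightarrow> real" assume S: "\<And>n. S n < x" "\<And>n. 0 < S n" "incseq S" "S \<longlonglongrightarrow> x"
  show "(\<lambda>n. LINT t|M. indicat_real {0..<S n} t *\<^sub>R f t) \<longlonglongrightarrow> (LINT t|M. indicat_real {0..<x} t *\<^sub>R f t)"
  proof (rule integral_dominated_convergence)
    have m: "f \<in> borel_measurable M" by (rule locally_integrable_measurable[OF f])
    show "(\<lambda>t. indicat_real {0..<x} t *\<^sub>R f t) \<in> borel_measurable M"
      using Ico_sets[OF x(1), of 0] m by simp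
    show "(\<lambda>t. indicat_real {0..<S n} t *\<^sub>R f t) \<in> borel_measurable M" for n
      using Ico_sets[OF hintv_mono[OF x(1)], of "S n" 0] S(1,2)[of n] m by simp
    show "integrable M (\<lambda>t. norm (indicat_real {0..<x} t *\<^sub>R f t))"
      using locally_integrableD[OF f x(1)] unfolding set_integrable_def by (rule integrable_norm)
    show "AE t in M. norm (indicat_real {0..<S n} t *\<^sub>R f t) \<le> norm (indicat_real {0..<x} t *\<^sub>R f t)" for n
      using S(1)[of n] by (auto simp: indicator_def)
    show "AE t in M. (\<lambda>n. indicat_real {0..<S n} t *\<^sub>R f t) \<longlonglongrightarrow> indicat_real {0..<x} t *\<^sub>R f t"
    proof (intro AE_I2 tendsto_scaleR tendsto_const)
      fix t
      show "(\<lambda>n. indicat_real {0..<S n} t) \<longlonglongrightarrow> indicat_real {0..<x} t"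
      proof (cases "t < x")
        case True
        then have "eventually (\<lambda>n. t < S n) sequentially" using S(4) by (rule order_tendstoD(1)[rotated])
        then show ?thesis using True
          by (intro tendsto_eventually) (auto elim!: eventually_mono simp: indicator_def)
      next
        case False
        then show ?thesis using S(1) by (intro tendsto_eventually) (auto simp: indicator_def not_less intro!: always_eventually dest: order.strict_trans2 order_trans less_imp_le)
      qed
    qed
  qed
qed

lemma R_measurable: "R \<in> borel_measurable M"
proof -
  have eq: "(LINT t:{0..<x}|M. 1::real) = R x" if "x \<in> hintv b" for x
    using integral_const_Ico[OF zero_in that, of "1::real"] hintv_nonneg[OF that] R_zero by simp
  have "(\<lambda>x. LINT t:{0..<x}|M. 1::real) \<in> borel_measurable (restrict_space borel (hintv b))"
    by (rule primitive_measurable) simp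
  then have "R \<in> borel_measurable (restrict_space borel (hintv b))"
    by (rule measurable_cong[THEN iffD1, rotated]) (simp add: space_restrict_space eq)
  then show ?thesis by (simp add: measurable_M)
qed

text \<open>On the Lebesgue side \<open>R\<close> becomes \<open>R \<circ> quantile\<close>, which is at most the identity, so the integral is at most that
  of \<open>y^n\<close> over \<open>[0, R x]\<close>.\<close>

lemma integral_power_le:
  assumes x: "x \<in> hintv b"
  shows "(LINT t:{0..<x}|M. R t ^ n) \<le> R x ^ Suc n / Suc n"
proof -
  have x0: "0 \<le> x" by (rule hintv_nonneg[OF x])
  have int: "set_integrable M {0..<x} (\<lambda>t. R t ^ n)"
    using x R_measurable R_mono[of _ x] R_nonneg x0
    by (intro set_integrable_bounded[where C = "R x ^ n"]) (auto simp: power_mono hintv_mono power_abs)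
  have nn: "0 \<le> indicat_real {0..<x} t *\<^sub>R R t ^ n" for t
    using x R_nonneg[of t] hintv_mono[OF x, of t] by (auto simp: indicator_def)
  have "ennreal (LINT t:{0..<x}|M. R t ^ n) = (\<integral>\<^sup>+t. ennreal (indicat_real {0..<x} t *\<^sub>R R t ^ n) \<partial>M)"
    unfolding set_lebesgue_integral_def using int nn
    by (intro nn_integral_eq_integral[symmetric]) (auto simp: set_integrable_def)
  also have "\<dots> = (\<integral>\<^sup>+y. ennreal (indicat_real {0..<x} (quantile b R y) *\<^sub>R R (quantile b R y) ^ n)
      \<partial>restrict_space lborel (quantile_dom b R))"
    unfolding LS_eq_quantile_measure[OF b_pos dist] quantile_measure_def
  proof (rule nn_integral_distr[OF quantile_measurable[OF b_pos dist]], goal_cases)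
    case 1
    have "(\<lambda>t. ennreal (indicat_real {0..<x} t *\<^sub>R R t ^ n)) \<in> borel_measurable M"
      using Ico_sets[OF x, of 0] R_measurable by simp
    then show ?case
      by (simp add: measurable_M measurable_cong_sets[OF sets_M refl])
  qed
  also have "\<dots> = (\<integral>\<^sup>+y. ennreal (indicat_real {0..<x} (quantile b R y) *\<^sub>R R (quantile b R y) ^ n) * indicator (quantile_dom b R) y
      \<partial>lborel)"
    by (rule nn_integral_restrict_space) (simp add: quantile_dom_borel[OF dist])
  also have "\<dots> \<le> (\<integral>\<^sup>+y. ennreal (y ^ n) * indicator {0..R x} y \<partial>lborel)"
  proof (rule nn_integral_mono)
    fix y
    show "ennreal (indicat_real {0..<x} (quantile b R y) *\<^sub>R R (quantile b R y) ^ n) * indicator (quantile_dom b R) y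
        \<le> ennreal (y ^ n) * indicator {0..R x} y"
    proof (cases "y \<in> quantile_dom b R \<and> quantile b R y < x")
      case True
      then have "y < R x" "0 \<le> y" using quantile_less_iff[OF dist _ x] by (auto simp: quantile_dom_def)
      moreover have "R (quantile b R y) ^ n \<le> y ^ n"
        using True R_quantile_le[OF dist, of y] R_nonneg[OF quantile_in_hintv[OF dist, of y]] by (intro power_mono) auto
      ultimately show ?thesis using True by (auto simp: indicator_def intro!: ennreal_leI)
    qed (auto simp: indicator_def)
  qed
  also have "\<dots> = ennreal (R x ^ Suc n / Suc n - 0 ^ Suc n / Suc n)"
  proof (rule nn_integral_FTC_Icc)
    fix y :: real
    show "((\<lambda>y. y ^ Suc n / real (Suc n)) has_real_derivative y ^ n) (at y)"
      using DERIV_cdivide[OF DERIV_pow[of "Suc n" y], of "real (Suc n)"] by (simp del: power_Suc)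
  qed (use R_nonneg[OF x] in auto)
  finally show ?thesis using R_nonneg[OF x] by (subst (asm) ennreal_le_iff) auto
qed

text \<open>The mass of \<open>{x}\<close> is at most \<open>R t - R x\<close> for every \<open>t > x\<close>.\<close>

lemma atom_zero:
  assumes x: "x \<in> hintv b" and cont: "continuous (at x within hintv b) R"
  shows "emeasure M {x} = 0"
proof -
  obtain z where z: "z \<in> hintv b" "x < z" using hintv_bigger[OF x] by auto
  have le: "emeasure M {x} \<le> ennreal (R t - R x)" if "t \<in> hintv b" "x < t" for t
    using emeasure_mono[of "{x}" "{x..<t}" M] emeasure_Ico[OF x that(1)] that Ico_sets[OF that(1), of x] hintv_nonneg[OF x] by simp
  have "emeasure M {x} \<le> 0 + ennreal e" if e: "0 < e" for e
  proof -
    obtain d where d: "0 < d" "\<And>y. y \<in> hintv b \<Longrightarrow> dist y x < d \<Longrightarrow> dist (R y) (R x) < e"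
      using cont e unfolding continuous_within_eps_delta by blast
    obtain t where t: "x < t" "t < min z (x + d)" using z(2) d(1) dense[of x "min z (x+d)"] by auto
    then have th: "t \<in> hintv b" using hintv_mono[OF z(1), of t] hintv_nonneg[OF x] by auto
    then have "R t - R x \<le> e" using d(2)[OF th] t by (auto simp: dist_real_def)
    then show ?thesis using le[OF th t(1)] by (simp add: ennreal_leI order_trans)
  qed
  then show ?thesis using ennreal_le_epsilon[of 0 "emeasure M {x}"] by (simp add: le_zero_eq[symmetric] ennreal_le_epsilon del: le_zero_eq)
qed

text \<open>Monotone convergence along intervals \<open>[0,X n)\<close> exhausting \<open>[0,b)\<close>.\<close>

lemma integrable_of_bounded:
  fixes f :: "real \<Rightarrow> real"
  assumes f: "locally_integrable f" and nn: "\<And>t. t \<in> hintv b \<Longrightarrow> 0 \<le> f t"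
    and bd: "\<And>x. x \<in> hintv b \<Longrightarrow> (LINT t:{0..<x}|M. f t) \<le> C"
  shows "integrable M f"
proof (rule integrableI_nonneg)
  obtain X where X: "incseq X" "\<And>n. X n \<in> hintv b" "\<And>x. x \<in> hintv b \<Longrightarrow> \<exists>n. x < X n"
    by (rule hintv_cofinal[OF b_pos]) (rule that)
  show m: "f \<in> borel_measurable M" by (rule locally_integrable_measurable[OF f])
  show "AE x in M. 0 \<le> f x" by (rule AE_I2) (simp add: space_M nn)
  let ?D = "density M (\<lambda>t. ennreal (f t))"
  have D: "emeasure ?D {0..<X n} \<le> ennreal C" for n
  proof -
    have S: "{0..<X n} \<in> sets M" by (simp add: Ico_sets X)
    have "emeasure ?D {0..<X n} = (\<integral>\<^sup>+t. ennreal (f t) * indicator {0..<X n} t \<partial>M)"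
      using m S by (simp add: emeasure_density)
    also have "\<dots> = (\<integral>\<^sup>+t. ennreal (indicat_real {0..<X n} t *\<^sub>R f t) \<partial>M)"
      by (intro nn_integral_cong) (auto simp: indicator_def)
    also have "\<dots> = ennreal (LINT t:{0..<X n}|M. f t)"
      unfolding set_lebesgue_integral_def using locally_integrableD[OF f X(2)[of n]] nn hintv_mono[OF X(2)[of n]]
      by (intro nn_integral_eq_integral) (auto simp: set_integrable_def indicator_def space_M)
    also have "\<dots> \<le> ennreal C" by (intro ennreal_leI bd X)
    finally show ?thesis .
  qed
  have "(\<integral>\<^sup>+t. ennreal (f t) \<partial>M) = emeasure ?D (space M)"
    using m by (simp add: emeasure_density cong: nn_integral_cong)
  also have "space M = (\<Union>n. {0..<X n})" using hintv_cofinal_cover[OF X(2,3)] by (simp add: space_M)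
  also have "emeasure ?D (\<Union>n. {0..<X n}) = (SUP n. emeasure ?D {0..<X n})"
    by (rule SUP_emeasure_incseq[symmetric])
       (use X Ico_sets in \<open>auto simp: incseq_def intro: order.strict_trans2\<close>)
  also have "\<dots> \<le> ennreal C" by (rule SUP_least) (rule D)
  finally show "(\<integral>\<^sup>+t. ennreal (f t) \<partial>M) < \<infinity>" by (simp add: le_less_trans)
qed

end

section \<open>Dependence on the distribution function, and the product rule\<close>

text \<open>The restriction to \<open>[0,X)\<close> is itself a Stieltjes measure, with end point \<open>X\<close>; this makes it comparable for
  different intervals \<open>[0,b)\<close>.\<close>

lemma LS_restrict:
  assumes "0 < b" "dist_fun b R" "X \<in> hintv b" "0 < X"
    and R': "dist_fun (ereal X) R'" "\<And>t. 0 \<le> t \<Longrightarrow> t < X \<Longrightarrow> R t = R' t"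
  shows "restrict_space (LS b R) {0..<X} = LS (ereal X) R'"
proof -
  interpret stieltjes b R by unfold_locales (fact assms)+
  have S: "{0..<X} \<inter> space M \<in> sets M" using Ico_sets[OF assms(3), of 0] by simp
  have sub: "{0..<X} \<subseteq> hintv b" by (rule hintv_Ico_subset[OF assms(3)])
  show ?thesis
  proof (rule LS_eqI)
    have "sets (restrict_space (LS b R) {0..<X}) = sets (restrict_space (restrict_space borel (hintv b)) {0..<X})"
      by (rule sets_restrict_space_cong[OF sets_M])
    also have "\<dots> = sets (restrict_space borel (hintv (ereal X)))"
      using sub by (simp add: sets_restrict_restrict_space hintv_ereal Int_absorb1)
    finally show "sets (restrict_space (LS b R) {0..<X}) = sets (restrict_space borel (hintv (ereal X)))" .
    fix s t assume st: "s \<in> hintv (ereal X)" "t \<in> hintv (ereal X)" "s \<le> t"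
    then have "s \<in> hintv b" "t \<in> hintv b" "{s..<t} \<subseteq> {0..<X}" using sub by (auto simp: hintv_ereal)
    then show "emeasure (restrict_space (LS b R) {0..<X}) {s..<t} = ennreal (R' t - R' s)"
      using st S by (subst emeasure_restrict_space) (auto simp: emeasure_Ico R'(2) hintv_ereal)
  qed (use assms in auto)
qed

lemma
  fixes f :: "real \<Rightarrow> 'a::{banach, second_countable_topology}"
  assumes b: "0 < b" "dist_fun b R" "X \<in> hintv b" and b': "0 < b'" "dist_fun b' R'" "X \<in> hintv b'"
    and eq: "\<And>t. 0 \<le> t \<Longrightarrow> t < X \<Longrightarrow> R t = R' t"
  shows set_integrable_LS_cong: "set_integrable (LS b R) {0..<X} f \<longleftrightarrow> set_integrable (LS b' R') {0..<X} f"
    and set_integral_LS_cong: "(LINT t:{0..<X}|LS b R. f t) = (LINT t:{0..<X}|LS b' R'. f t)"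
    and AE_LS_cong: "(AE t in LS b R. t \<in> {0..<X} \<longrightarrow> P t) \<longleftrightarrow> (AE t in LS b' R'. t \<in> {0..<X} \<longrightarrow> P t)"
proof -
  interpret A: stieltjes b R by unfold_locales (fact assms)+
  interpret B: stieltjes b' R' by unfold_locales (fact assms)+
  have S: "{0..<X} \<inter> space (LS b R) \<in> sets (LS b R)" "{0..<X} \<inter> space (LS b' R') \<in> sets (LS b' R')"
    using A.Ico_sets[OF b(3), of 0] B.Ico_sets[OF b'(3), of 0] by simp_all
  have *: "restrict_space (LS b R) {0..<X} = restrict_space (LS b' R') {0..<X}" if "0 < X"
  proof -
    have sub: "hintv (ereal X) \<subseteq> hintv b"
      using hintv_Ico_subset[OF b(3)] by (simp add: hintv_ereal)
    have "dist_fun (ereal X) R"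
      using b(2) sub by (auto simp: dist_fun_def intro: mono_on_subset)
    then show ?thesis
      using LS_restrict[OF b that, of R] LS_restrict[OF b' that, of R] eq by simp
  qed
  show "set_integrable (LS b R) {0..<X} f \<longleftrightarrow> set_integrable (LS b' R') {0..<X} f"
    using * integrable_restrict_space[OF S(1), of f] integrable_restrict_space[OF S(2), of f]
    by (cases "0 < X") (auto simp: set_integrable_def)
  show "(LINT t:{0..<X}|LS b R. f t) = (LINT t:{0..<X}|LS b' R'. f t)"
    using * integral_restrict_space[OF S(1), of f] integral_restrict_space[OF S(2), of f]
    by (cases "0 < X") (auto simp: set_lebesgue_integral_def)
  show "(AE t in LS b R. t \<in> {0..<X} \<longrightarrow> P t) \<longleftrightarrow> (AE t in LS b' R'. t \<in> {0..<X} \<longrightarrow> P t)"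
  proof (cases "0 < X")
    case True
    show ?thesis
      unfolding AE_restrict_space_iff[OF S(1), of P, symmetric] AE_restrict_space_iff[OF S(2), of P, symmetric] *[OF True] ..
  qed simp
qed

context stieltjes begin

lemma AE_locally:
  assumes "\<And>x. x \<in> hintv b \<Longrightarrow> AE t in M. t \<in> {0..<x} \<longrightarrow> P t"
  shows "AE t in M. P t"
proof -
  obtain X where X: "incseq X" "\<And>n. X n \<in> hintv b" "\<And>x. x \<in> hintv b \<Longrightarrow> \<exists>n. x < X n"
    by (rule hintv_cofinal[OF b_pos]) (rule that)
  have ae: "AE t in M. \<forall>n. t \<in> {0..<X n} \<longrightarrow> P t"
    unfolding AE_all_countable using assms[OF X(2)] by blast
  have ex: "\<exists>n. t \<in> {0..<X n}" if "t \<in> space M" for t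
    using that hintv_cofinal_cover[OF X(2,3)] by (auto simp: space_M set_eq_iff)
  from ae show ?thesis
  proof (rule AE_mp, intro AE_I2 impI)
    fix t assume "t \<in> space M" "\<forall>n. t \<in> {0..<X n} \<longrightarrow> P t"
    then show "P t" using ex by blast
  qed
qed

definition primitive :: "(real \<Rightarrow> complex) \<Rightarrow> (real \<Rightarrow> complex) \<Rightarrow> bool" where
  "primitive F f \<longleftrightarrow> locally_integrable f \<and> (\<forall>x\<in>hintv b. F x = F 0 + (LINT t:{0..<x}|M. f t))"

lemma primitive_integrable: "primitive F f \<Longrightarrow> locally_integrable f"
  by (simp add: primitive_def)

lemma primitive_eq: "primitive F f \<Longrightarrow> x \<in> hintv b \<Longrightarrow> F x = F 0 + (LINT t:{0..<x}|M. f t)"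
  by (simp add: primitive_def)

lemma primitive_diff:
  "primitive F f \<Longrightarrow> x \<in> hintv b \<Longrightarrow> y \<in> hintv b \<Longrightarrow> x \<le> y \<Longrightarrow> F y - F x = (LINT t:{x..<y}|M. f t)"
  using integral_split[of f x y] primitive_eq[of F f x] primitive_eq[of F f y] by (simp add: primitive_integrable)

lemma borel_measurable_primitive:
  assumes "primitive F f" shows "F \<in> borel_measurable (restrict_space borel (hintv b))"
proof -
  have "(\<lambda>x. F 0 + (LINT t:{0..<x}|M. f t)) \<in> borel_measurable (restrict_space borel (hintv b))"
    using primitive_measurable[OF locally_integrable_measurable[OF primitive_integrable[OF assms]]] by simp
  then show ?thesis
    by (rule measurable_cong[THEN iffD1, rotated]) (rule primitive_eq[OF assms, symmetric], simp add: space_restrict_space)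
qed

definition locally_bounded :: "(real \<Rightarrow> complex) \<Rightarrow> bool" where
  "locally_bounded h \<longleftrightarrow> (\<forall>x\<in>hintv b. \<exists>C. \<forall>t. 0 \<le> t \<and> t \<le> x \<longrightarrow> norm (h t) \<le> C)"

lemma primitive_bounded:
  assumes F: "primitive F f" shows "locally_bounded F"
  unfolding locally_bounded_def
proof (intro ballI exI allI impI)
  fix x t assume x: "x \<in> hintv b" and t: "0 \<le> t \<and> t \<le> x"
  have th: "t \<in> hintv b" using hintv_mono[OF x] t by auto
  have li: "locally_integrable (\<lambda>s. norm (f s))"
    using primitive_integrable[OF F] by (auto simp: locally_integrable_def intro: set_integrable_norm)
  have "norm (LINT s:{0..<t}|M. f s) \<le> (LINT s:{0..<t}|M. norm (f s))"
    by (rule norm_integral_le[OF primitive_integrable[OF F] li zero_in th]) simp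
  also have "\<dots> \<le> (LINT s:{0..<x}|M. norm (f s))"
    using integral_split[OF li th x] t Bochner_Integration.integral_nonneg[of M "\<lambda>s. indicat_real {t..<x} s *\<^sub>R norm (f s)"]
    by (auto simp: set_lebesgue_integral_def)
  finally have "norm (F t - F 0) \<le> (LINT s:{0..<x}|M. norm (f s))"
    using primitive_eq[OF F th] by simp
  then show "norm (F t) \<le> norm (F 0) + (LINT s:{0..<x}|M. norm (f s))"
    using norm_triangle_sub[of "F t" "F 0"] by linarith
qed

lemma locally_integrable_mult:
  assumes f: "locally_integrable f" and h: "h \<in> borel_measurable (restrict_space borel (hintv b))" "locally_bounded h"
  shows "locally_integrable (\<lambda>t. f t * h t)"
  unfolding locally_integrable_def
proof
  fix x assume x: "x \<in> hintv b"
  then obtain C where C: "\<And>t. 0 \<le> t \<Longrightarrow> t \<le> x \<Longrightarrow> norm (h t) \<le> C"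
    using h(2) unfolding locally_bounded_def by blast
  have hm: "h \<in> borel_measurable M" using h(1) by (simp add: measurable_M)
  have "set_integrable M {0..<x} (\<lambda>t. f t * of_real C)"
    using locally_integrableD[OF f x] by (rule set_integrable_mult_left)
  then show "set_integrable M {0..<x} (\<lambda>t. f t * h t)"
    unfolding set_integrable_def
  proof (rule Bochner_Integration.integrable_bound)
    show "(\<lambda>t. indicat_real {0..<x} t *\<^sub>R (f t * h t)) \<in> borel_measurable M"
      using hm locally_integrable_measurable[OF f] Ico_sets[OF x, of 0] by simp
    show "AE t in M. norm (indicat_real {0..<x} t *\<^sub>R (f t * h t)) \<le> norm (indicat_real {0..<x} t *\<^sub>R (f t * complex_of_real C))"
    proof (rule AE_I2)
      fix t
      have "norm (h t) \<le> \<bar>C\<bar>" if "0 \<le> t" "t < x" using C[of t] that by auto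
      then show "norm (indicat_real {0..<x} t *\<^sub>R (f t * h t)) \<le> norm (indicat_real {0..<x} t *\<^sub>R (f t * complex_of_real C))"
        by (auto simp: indicator_def norm_mult intro: mult_left_mono)
    qed
  qed
qed

lemma primitive_tendsto_left:
  assumes F: "primitive F f" and x: "x \<in> hintv b" "0 < x"
  shows "(F \<longlongrightarrow> F x) (at_left x)"
proof -
  have "((\<lambda>y. F 0 + (LINT t:{0..<y}|M. f t)) \<longlongrightarrow> F 0 + (LINT t:{0..<x}|M. f t)) (at_left x)"
    by (intro tendsto_intros primitive_left_continuous primitive_integrable[OF F] x)
  moreover have "eventually (\<lambda>y. F 0 + (LINT t:{0..<y}|M. f t) = F y) (at_left x)"
    unfolding eventually_at_left[OF x(2)]
  proof (intro exI[of _ 0] conjI allI impI)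
    fix y :: real assume "0 < y" "y < x"
    then show "F 0 + (LINT t:{0..<y}|M. f t) = F y"
      by (intro primitive_eq[OF F, symmetric] hintv_mono[OF x(1)]) auto
  qed (rule x)
  ultimately have "(F \<longlongrightarrow> F 0 + (LINT t:{0..<x}|M. f t)) (at_left x)"
    by (rule Lim_transform_eventually)
  then show ?thesis by (simp only: primitive_eq[OF F x(1), symmetric])
qed

lemma primitive_cnj:
  assumes F: "primitive F f" shows "primitive (\<lambda>x. cnj (F x)) (\<lambda>x. cnj (f x))"
  unfolding primitive_def locally_integrable_def
proof (intro conjI ballI)
  fix x assume x: "x \<in> hintv b"
  have "integrable M (\<lambda>t. cnj (indicat_real {0..<x} t *\<^sub>R f t))"
    using locally_integrableD[OF primitive_integrable[OF F] x] unfolding set_integrable_def by (rule integrable_cnj)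
  then show "set_integrable M {0..<x} (\<lambda>x. cnj (f x))"
    by (simp add: set_integrable_def)
  have "(LINT t:{0..<x}|M. cnj (f t)) = (LINT t|M. cnj (indicat_real {0..<x} t *\<^sub>R f t))"
    by (simp add: set_lebesgue_integral_def)
  also have "\<dots> = cnj (LINT t:{0..<x}|M. f t)" unfolding set_lebesgue_integral_def by (rule Bochner_Integration.integral_cnj)
  finally show "cnj (F x) = cnj (F 0) + (LINT t:{0..<x}|M. cnj (f t))"
    using primitive_eq[OF F x] by simp
qed

end

locale stieltjes_pair = A: stieltjes b R + B: stieltjes b R' for b R R'
begin

sublocale pair_sigma_finite A.M B.M ..

lemma singleton_measurable: "(\<lambda>s. measure B.M {s}) \<in> borel_measurable A.M"
proof -
  have id1: "fst \<in> borel_measurable (A.M \<Otimes>\<^sub>M B.M)" 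
    by (rule measurable_compose[OF measurable_fst]) (simp add: A.measurable_M measurable_restrict_space1)
  have id2: "snd \<in> borel_measurable (A.M \<Otimes>\<^sub>M B.M)" 
    by (rule measurable_compose[OF measurable_snd]) (simp add: B.measurable_M measurable_restrict_space1)
  have "{p \<in> space (A.M \<Otimes>\<^sub>M B.M). snd p = fst p} \<in> sets (A.M \<Otimes>\<^sub>M B.M)" using id1 id2 by measurable
  then have "(\<lambda>s. emeasure B.M (Pair s -` {p \<in> space (A.M \<Otimes>\<^sub>M B.M). snd p = fst p})) \<in> borel_measurable A.M"
    by (rule B.measurable_emeasure_Pair)
  then have "(\<lambda>s. emeasure B.M {s}) \<in> borel_measurable A.M"
    by (rule measurable_cong[THEN iffD1, rotated])
       (auto simp: space_pair_measure A.space_M B.space_M intro!: arg_cong[where f = "emeasure _"])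
  then show ?thesis unfolding measure_def by measurable
qed

text \<open>Integration by parts. In the double integral of \<open>f s * g t\<close> over the square \<open>[0,x) \<times> [0,x)\<close>, the parts below and
above the diagonal are \<open>\<integral> f * (G - G 0)\<close> and \<open>\<integral> (F - F 0) * g\<close>; the diagonal itself contributes the common
atoms of the two measures. That term does not always vanish below: it is nonnegative for \<open>G = cnj F\<close>.\<close>

lemma product_rule_diag:
  assumes F: "A.primitive F f" and G: "B.primitive G g" and x: "x \<in> hintv b"
  shows "F x * G x = F 0 * G 0 + (LINT t:{0..<x}|A.M. f t * G t) + (LINT t:{0..<x}|B.M. F t * g t)
     + (LINT t:{0..<x}|A.M. f t * g t * of_real (measure B.M {t}))"
proof -
  define f' where "f' t = indicat_real {0..<x} t *\<^sub>R f t" for t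
  define g' where "g' t = indicat_real {0..<x} t *\<^sub>R g t" for t
  define P where "P s = (LINT t:{0..<s}|A.M. f t)" for s
  define Q where "Q s = (LINT t:{0..<s}|B.M. g t)" for s
  let ?PM = "A.M \<Otimes>\<^sub>M B.M"
  have f'i: "integrable A.M f'" and g'i: "integrable B.M g'"
    using A.locally_integrableD[OF A.primitive_integrable[OF F] x] B.locally_integrableD[OF B.primitive_integrable[OF G] x]
    by (simp_all add: f'_def[abs_def] g'_def[abs_def] set_integrable_def)
  have f'm[measurable]: "f' \<in> borel_measurable A.M" and g'm[measurable]: "g' \<in> borel_measurable B.M"
    using f'i g'i by auto
  have Px: "P x = (LINT t|A.M. f' t)" and Qx: "Q x = (LINT t|B.M. g' t)"
    by (simp_all add: P_def Q_def f'_def g'_def set_lebesgue_integral_def)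
  have K: "integrable ?PM (\<lambda>(s, t). f' s * g' t)"
  proof (rule Fubini_integrable)
    show "(\<lambda>(s, t). f' s * g' t) \<in> borel_measurable ?PM" by measurable
    show "integrable A.M (\<lambda>s. LINT t|B.M. norm (case (s, t) of (s, t) \<Rightarrow> f' s * g' t))"
      using f'i by (simp add: norm_mult)
    show "AE s in A.M. integrable B.M (\<lambda>t. case (s, t) of (s, t) \<Rightarrow> f' s * g' t)"
      using g'i by simp
  qed
  have id1: "fst \<in> borel_measurable ?PM" 
    by (rule measurable_compose[OF measurable_fst]) (simp add: A.measurable_M measurable_restrict_space1)
  have id2: "snd \<in> borel_measurable ?PM" 
    by (rule measurable_compose[OF measurable_snd]) (simp add: B.measurable_M measurable_restrict_space1)
  \<comment> \<open>below, on, and above the diagonal\<close>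
  define L where "L = {p \<in> space ?PM. snd p < fst p}"
  define E where "E = {p \<in> space ?PM. snd p = fst p}"
  define U where "U = {p \<in> space ?PM. fst p < snd p}"
  have sets: "L \<in> sets ?PM" "E \<in> sets ?PM" "U \<in> sets ?PM"
    unfolding L_def E_def U_def using id1 id2 by measurable
  define H where "H S s t = indicat_real S (s, t) *\<^sub>R (f' s * g' t)" for S s t
  have Hi: "integrable ?PM (case_prod (H S))" if "S \<in> sets ?PM" for S
    using integrable_mult_indicator[OF that K] by (simp add: H_def[abs_def] split_def)
  have "P x * Q x = (LINT s|A.M. f' s * (LINT t|B.M. g' t))"
    unfolding Px Qx by simp
  also have "\<dots> = (LINT s|A.M. LINT t|B.M. f' s * g' t)" by simp
  also have "\<dots> = (LINT p|?PM. (case p of (s, t) \<Rightarrow> f' s * g' t))" by (rule integral_fst[OF K])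
  also have "\<dots> = (LINT p|?PM. case_prod (H L) p + case_prod (H E) p + case_prod (H U) p)"
    by (intro Bochner_Integration.integral_cong refl)
       (auto simp: H_def L_def E_def U_def indicator_def split_def)
  also have "\<dots> = (LINT p|?PM. case_prod (H L) p) + (LINT p|?PM. case_prod (H E) p) + (LINT p|?PM. case_prod (H U) p)"
    using Hi[OF sets(1)] Hi[OF sets(2)] Hi[OF sets(3)] by simp
  also have "(LINT p|?PM. case_prod (H L) p) = (LINT t:{0..<x}|A.M. f t * Q t)"
  proof -
    have "(LINT p|?PM. case_prod (H L) p) = (LINT s|A.M. LINT t|B.M. H L s t)"
      using integral_fst[OF Hi[OF sets(1)]] by simp
    also have "\<dots> = (LINT s|A.M. indicat_real {0..<x} s *\<^sub>R (f s * Q s))"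
    proof (rule Bochner_Integration.integral_cong[OF refl])
      fix s assume s: "s \<in> space A.M"
      have "(LINT t|B.M. H L s t) = (LINT t|B.M. f' s * (indicat_real {0..<s} t *\<^sub>R g t))"
        by (rule Bochner_Integration.integral_cong[OF refl])
           (use s in \<open>auto simp: H_def L_def f'_def g'_def indicator_def space_pair_measure B.space_M hintv_nonneg\<close>)
      also have "\<dots> = f' s * Q s" unfolding Q_def set_lebesgue_integral_def by (rule integral_mult_right_zero)
      finally show "(LINT t|B.M. H L s t) = indicat_real {0..<x} s *\<^sub>R (f s * Q s)" by (simp add: f'_def)
    qed
    finally show ?thesis by (simp add: set_lebesgue_integral_def)
  qed
  also have "(LINT p|?PM. case_prod (H U) p) = (LINT t:{0..<x}|B.M. P t * g t)"
  proof -
    have "(LINT p|?PM. case_prod (H U) p) = (LINT t|B.M. LINT s|A.M. H U s t)"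
      using integral_snd[OF Hi[OF sets(3)]] by simp
    also have "\<dots> = (LINT t|B.M. indicat_real {0..<x} t *\<^sub>R (P t * g t))"
    proof (rule Bochner_Integration.integral_cong[OF refl])
      fix t assume t: "t \<in> space B.M"
      have "(LINT s|A.M. H U s t) = (LINT s|A.M. (indicat_real {0..<t} s *\<^sub>R f s) * g' t)"
        by (rule Bochner_Integration.integral_cong[OF refl])
           (use t in \<open>auto simp: H_def U_def f'_def g'_def indicator_def space_pair_measure A.space_M hintv_nonneg\<close>)
      also have "\<dots> = P t * g' t" unfolding P_def set_lebesgue_integral_def by (rule integral_mult_left_zero)
      finally show "(LINT s|A.M. H U s t) = indicat_real {0..<x} t *\<^sub>R (P t * g t)" by (simp add: g'_def)
    qed
    finally show ?thesis by (simp add: set_lebesgue_integral_def)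
  qed
  also have "(LINT p|?PM. case_prod (H E) p) = (LINT t:{0..<x}|A.M. f t * g t * of_real (measure B.M {t}))"
  proof -
    have "(LINT p|?PM. case_prod (H E) p) = (LINT s|A.M. LINT t|B.M. H E s t)"
      using integral_fst[OF Hi[OF sets(2)]] by simp
    also have "\<dots> = (LINT s|A.M. indicat_real {0..<x} s *\<^sub>R (f s * g s * of_real (measure B.M {s})))"
    proof (rule Bochner_Integration.integral_cong[OF refl])
      fix s assume s: "s \<in> space A.M"
      have "(LINT t|B.M. H E s t) = (LINT t|B.M. indicat_real {s} t *\<^sub>R (f' s * g' s))"
        by (rule Bochner_Integration.integral_cong[OF refl])
           (use s in \<open>auto simp: H_def E_def indicator_def space_pair_measure\<close>)
      also have "\<dots> = measure B.M {s} *\<^sub>R (f' s * g' s)"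
      proof -
        have sh: "s \<in> hintv b" using s by (simp add: A.space_M)
        obtain z where z: "z \<in> hintv b" "s < z" using hintv_bigger[OF sh] by auto
        have "emeasure B.M {s} \<le> emeasure B.M {0..<z}"
          using z hintv_nonneg[OF sh] B.Ico_sets[OF z(1), of 0] by (intro emeasure_mono) auto
        then have "emeasure B.M {s} < \<infinity>" using B.emeasure_Ico_finite[OF z(1)] by (rule le_less_trans)
        then show ?thesis using B.singleton_sets[OF sh] sets.Int_space_eq2[OF B.singleton_sets[OF sh]] by simp
      qed
      finally show "(LINT t|B.M. H E s t) = indicat_real {0..<x} s *\<^sub>R (f s * g s * of_real (measure B.M {s}))"
        by (auto simp: f'_def g'_def indicator_def scaleR_conv_of_real)
    qed
    finally show ?thesis by (simp add: set_lebesgue_integral_def)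
  qed
  finally have PQ: "P x * Q x = (LINT t:{0..<x}|A.M. f t * Q t)
      + (LINT t:{0..<x}|A.M. f t * g t * of_real (measure B.M {t})) + (LINT t:{0..<x}|B.M. P t * g t)" .
  have fG: "set_integrable A.M {0..<x} (\<lambda>t. f t * G t)"
    by (intro A.locally_integrableD[OF A.locally_integrable_mult x] A.primitive_integrable[OF F]
        B.borel_measurable_primitive[OF G])
       (use B.primitive_bounded[OF G] in \<open>simp add: A.locally_bounded_def B.locally_bounded_def\<close>)
  have gF: "set_integrable B.M {0..<x} (\<lambda>t. g t * F t)"
    by (intro B.locally_integrableD[OF B.locally_integrable_mult x] B.primitive_integrable[OF G]
        A.borel_measurable_primitive[OF F])
       (use A.primitive_bounded[OF F] in \<open>simp add: A.locally_bounded_def B.locally_bounded_def\<close>)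
  have fi: "set_integrable A.M {0..<x} f" and gi: "set_integrable B.M {0..<x} g"
    using A.locally_integrableD[OF A.primitive_integrable[OF F] x] B.locally_integrableD[OF B.primitive_integrable[OF G] x] .
  have sub: "t \<in> hintv b" if "t \<in> {0..<x}" for t using that hintv_mono[OF x] by auto
  have 1: "(LINT t:{0..<x}|A.M. f t * Q t) = (LINT t:{0..<x}|A.M. f t * G t) - P x * G 0"
  proof -
    have "(LINT t:{0..<x}|A.M. f t * Q t) = (LINT t:{0..<x}|A.M. f t * G t - f t * G 0)"
      unfolding set_lebesgue_integral_def
    proof (intro Bochner_Integration.integral_cong refl)
      fix t show "indicat_real {0..<x} t *\<^sub>R (f t * Q t) = indicat_real {0..<x} t *\<^sub>R (f t * G t - f t * G 0)"
        using B.primitive_eq[OF G sub[of t]] by (simp add: Q_def indicator_def algebra_simps)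
    qed
    also have "\<dots> = (LINT t:{0..<x}|A.M. f t * G t) - (LINT t:{0..<x}|A.M. f t * G 0)"
      using fG fi by (intro set_integral_diff) auto
    finally show ?thesis by (simp add: P_def)
  qed
  have 2: "(LINT t:{0..<x}|B.M. P t * g t) = (LINT t:{0..<x}|B.M. F t * g t) - F 0 * Q x"
  proof -
    have "(LINT t:{0..<x}|B.M. P t * g t) = (LINT t:{0..<x}|B.M. F t * g t - F 0 * g t)"
      unfolding set_lebesgue_integral_def
    proof (intro Bochner_Integration.integral_cong refl)
      fix t show "indicat_real {0..<x} t *\<^sub>R (P t * g t) = indicat_real {0..<x} t *\<^sub>R (F t * g t - F 0 * g t)"
        using A.primitive_eq[OF F sub[of t]] by (simp add: P_def indicator_def algebra_simps)
    qed
    also have "\<dots> = (LINT t:{0..<x}|B.M. F t * g t) - (LINT t:{0..<x}|B.M. F 0 * g t)"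
      using gF gi by (intro set_integral_diff) (auto simp: mult.commute)
    finally show ?thesis by (simp add: Q_def)
  qed
  have "F x = F 0 + P x" "G x = G 0 + Q x"
    using A.primitive_eq[OF F x] B.primitive_eq[OF G x] by (simp_all add: P_def Q_def)
  then show ?thesis using PQ unfolding 1 2 by (simp add: algebra_simps)
qed

text \<open>Without common discontinuities the diagonal term vanishes: the atoms of the second measure lie among the
  countably many discontinuities of \<open>R'\<close>, each of which is a null set for the first measure.\<close>

lemma product_rule:
  assumes F: "A.primitive F f" and G: "B.primitive G g" and x: "x \<in> hintv b"
    and cont: "\<And>x. x \<in> hintv b \<Longrightarrow> continuous (at x within hintv b) R \<or> continuous (at x within hintv b) R'"
  shows "F x * G x = F 0 * G 0 + (LINT t:{0..<x}|A.M. f t * G t) + (LINT t:{0..<x}|B.M. F t * g t)"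
proof -
  define D where "D = {t \<in> hintv b. \<not> continuous (at t within hintv b) R'}"
  have cD: "countable D" unfolding D_def
    by (rule mono_on_ctble_discont) (use B.dist in \<open>simp add: dist_fun_def\<close>)
  have "AE t in A.M. t \<noteq> d" if "d \<in> D" for d
  proof (rule AE_I[of _ _ "{d}"])
    show "emeasure A.M {d} = 0" using that cont by (intro A.atom_zero) (auto simp: D_def)
    show "{d} \<in> sets A.M" using that by (intro A.singleton_sets) (auto simp: D_def)
  qed auto
  then have "AE t in A.M. \<forall>d\<in>D. t \<noteq> d" by (subst AE_ball_countable[OF cD]) auto
  then have ae: "AE t in A.M. measure B.M {t} = 0"
  proof (rule AE_mp, intro AE_I2 impI)
    fix t assume "t \<in> space A.M" "\<forall>d\<in>D. t \<noteq> d"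
    then have "emeasure B.M {t} = 0" by (intro B.atom_zero) (auto simp: D_def A.space_M)
    then show "measure B.M {t} = 0" by (simp add: measure_def)
  qed
  have fm: "f \<in> borel_measurable A.M" using A.primitive_integrable[OF F] by (rule A.locally_integrable_measurable)
  have "g \<in> borel_measurable B.M" using B.primitive_integrable[OF G] by (rule B.locally_integrable_measurable)
  then have gm: "g \<in> borel_measurable A.M" by (simp add: A.measurable_M B.measurable_M)
  have "(LINT t:{0..<x}|A.M. f t * g t * of_real (measure B.M {t})) = (LINT t|A.M. 0)"
    unfolding set_lebesgue_integral_def
  proof (rule integral_cong_AE)
    show "(\<lambda>t. indicat_real {0..<x} t *\<^sub>R (f t * g t * complex_of_real (measure B.M {t}))) \<in> borel_measurable A.M"
      using fm gm singleton_measurable A.Ico_sets[OF x, of 0] by simp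
    show "AE t in A.M. indicat_real {0..<x} t *\<^sub>R (f t * g t * complex_of_real (measure B.M {t})) = 0"
      using ae by (rule eventually_mono) simp
  qed simp
  then show ?thesis using product_rule_diag[OF F G x] by simp
qed

end

section \<open>Existence, uniqueness and duality of solutions\<close>

lemma set_integral_empty: "(LINT x:{}|M. f x) = 0"
  by (simp add: set_lebesgue_integral_def)

context stieltjes begin

lemma primitive_lincomb:
  assumes F: "primitive F f" and G: "primitive G g"
  shows "primitive (\<lambda>x. a * F x + c * G x) (\<lambda>x. a * f x + c * g x)"
  unfolding primitive_def locally_integrable_def
proof (intro conjI ballI)
  fix x assume x: "x \<in> hintv b"
  have f: "set_integrable M {0..<x} (\<lambda>t. a * f t)" and g: "set_integrable M {0..<x} (\<lambda>t. c * g t)"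
    using locally_integrableD[OF primitive_integrable[OF F] x] locally_integrableD[OF primitive_integrable[OF G] x]
    by auto
  then show "set_integrable M {0..<x} (\<lambda>x. a * f x + c * g x)" by (rule set_integral_add)
  have "(LINT t:{0..<x}|M. a * f t + c * g t) = a * (LINT t:{0..<x}|M. f t) + c * (LINT t:{0..<x}|M. g t)"
    using set_integral_add(2)[OF f g] by simp
  then show "a * F x + c * G x = a * F 0 + c * G 0 + (LINT t:{0..<x}|M. a * f t + c * g t)"
    using primitive_eq[OF F x] primitive_eq[OF G x] by (simp add: algebra_simps)
qed

lemma primitive_scale: "primitive F f \<Longrightarrow> primitive (\<lambda>x. a * F x) (\<lambda>x. a * f x)"
  using primitive_lincomb[of F f F f a 0] by simp

lemma locally_integrable_of_bounded:
  assumes h: "h \<in> borel_measurable (restrict_space borel (hintv b))" "locally_bounded h"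
  shows "locally_integrable h"
  using locally_integrable_mult[OF locally_integrable_const h, of 1] by simp

lemma integral_suminf_bounded:
  fixes \<phi> :: "nat \<Rightarrow> real \<Rightarrow> complex"
  assumes m: "\<And>n. \<phi> n \<in> borel_measurable M" and x: "x \<in> hintv b"
    and bd: "\<And>n t. 0 \<le> t \<Longrightarrow> t < x \<Longrightarrow> norm (\<phi> n t) \<le> c n" and c: "summable c" "\<And>n. 0 \<le> c n"
  shows "(\<lambda>n. LINT t:{0..<x}|M. \<phi> n t) sums (LINT t:{0..<x}|M. (\<Sum>n. \<phi> n t))"
proof -
  have int: "integrable M (\<lambda>t. indicat_real {0..<x} t *\<^sub>R \<phi> n t)" for n
    using set_integrable_bounded[OF m x bd] by (simp add: set_integrable_def)
  have ni: "(LINT t|M. norm (indicat_real {0..<x} t *\<^sub>R \<phi> n t)) \<le> c n * R x" for n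
  proof -
    have "(LINT t|M. norm (indicat_real {0..<x} t *\<^sub>R \<phi> n t)) \<le> (LINT t|M. indicat_real {0..<x} t *\<^sub>R c n)"
    proof (rule Bochner_Integration.integral_mono)
      show "integrable M (\<lambda>t. norm (indicat_real {0..<x} t *\<^sub>R \<phi> n t))" by (rule integrable_norm[OF int])
      show "integrable M (\<lambda>t. indicat_real {0..<x} t *\<^sub>R c n)"
        using locally_integrableD[OF locally_integrable_const[of "c n"] x] unfolding set_integrable_def .
      show "norm (indicat_real {0..<x} t *\<^sub>R \<phi> n t) \<le> indicat_real {0..<x} t *\<^sub>R c n" for t
        using bd[of t n] by (auto simp: indicator_def)
    qed
    also have "\<dots> = R x * c n"
      using integral_const_Ico[OF zero_in x hintv_nonneg[OF x], of "c n"] R_zero by (simp add: set_lebesgue_integral_def)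
    finally show ?thesis by (simp add: mult.commute)
  qed
  have "(\<lambda>n. LINT t|M. indicat_real {0..<x} t *\<^sub>R \<phi> n t) sums (LINT t|M. (\<Sum>n. indicat_real {0..<x} t *\<^sub>R \<phi> n t))"
  proof (rule sums_integral[OF int])
    show "AE t in M. summable (\<lambda>n. norm (indicat_real {0..<x} t *\<^sub>R \<phi> n t))"
    proof (rule AE_I2)
      fix t show "summable (\<lambda>n. norm (indicat_real {0..<x} t *\<^sub>R \<phi> n t))"
        by (rule summable_comparison_test'[OF c(1), of 0]) (use bd[of t] c(2) in \<open>auto simp: indicator_def\<close>)
    qed
    show "summable (\<lambda>n. LINT t|M. norm (indicat_real {0..<x} t *\<^sub>R \<phi> n t))"
      by (rule summable_comparison_test'[OF summable_mult2[OF c(1), of "R x"], of 0]) (use ni in simp)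
  qed
  moreover have "(\<Sum>n. indicat_real {0..<x} t *\<^sub>R \<phi> n t) = indicat_real {0..<x} t *\<^sub>R (\<Sum>n. \<phi> n t)" for t
    by (simp add: indicator_def)
  ultimately show ?thesis by (simp add: set_lebesgue_integral_def)
qed

end

context stieltjes_pair begin

definition solution :: "complex \<Rightarrow> (real \<Rightarrow> complex) \<Rightarrow> (real \<Rightarrow> complex) \<Rightarrow> bool" where
  "solution l u1 u2 \<longleftrightarrow> A.primitive u1 u2 \<and> B.primitive u2 (\<lambda>x. - l * u1 x)"

lemma solves_iff_primitive:
  "solves b R R' f u1 u2 \<longleftrightarrow> A.primitive u1 u2 \<and> B.primitive u2 (\<lambda>x. - f x)"
proof -
  have "set_integrable B.M {0..<x} (\<lambda>t. - f t) \<longleftrightarrow> set_integrable B.M {0..<x} f" for x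
    unfolding set_integrable_def by simp
  moreover have "(LINT t:{0..<x}|B.M. - f t) = - (LINT t:{0..<x}|B.M. f t)" for x
    unfolding set_lebesgue_integral_def by simp
  ultimately show ?thesis
    unfolding solves_def A.primitive_def B.primitive_def A.locally_integrable_def B.locally_integrable_def by auto
qed

lemma solves_iff_solution: "solves b R R' (\<lambda>x. l * u1 x) u1 u2 \<longleftrightarrow> solution l u1 u2"
  unfolding solves_iff_primitive solution_def by simp

lemma solution_lincomb: "solution l u1 u2 \<Longrightarrow> solution l v1 v2 \<Longrightarrow> solution l (\<lambda>x. a * u1 x + c * v1 x) (\<lambda>x. a * u2 x + c * v2 x)"
  using A.primitive_lincomb[of u1 u2 v1 v2 a c]
    B.primitive_lincomb[of u2 "\<lambda>x. - l * u1 x" v2 "\<lambda>x. - l * v1 x" a c]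
  by (auto simp: solution_def algebra_simps)

abbreviation "hborel \<equiv> (restrict_space borel (hintv b) :: real measure)"

text \<open>A solution satisfies \<open>u1 = u1 0 + u2 0 * R - l * picard u1\<close>. Iterating \<open>picard\<close> gains a factor \<open>R^n / n!\<close> (\<open>picard_le\<close>
  with \<open>integral_power_le\<close>), whence existence by the Neumann series and uniqueness.\<close>

definition picard :: "(real \<Rightarrow> complex) \<Rightarrow> real \<Rightarrow> complex" where
  "picard h x = (LINT s:{0..<x}|A.M. (LINT t:{0..<s}|B.M. h t))"

lemma inner_bounded:
  assumes h: "h \<in> borel_measurable hborel" "A.locally_bounded h"
  shows "A.locally_bounded (\<lambda>s. LINT t:{0..<s}|B.M. h t)"
    and "(\<lambda>s. LINT t:{0..<s}|B.M. h t) \<in> borel_measurable hborel"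
proof -
  have "B.primitive (\<lambda>s. LINT t:{0..<s}|B.M. h t) h"
    using B.locally_integrable_of_bounded[OF h] by (simp add: B.primitive_def set_integral_empty)
  then show "A.locally_bounded (\<lambda>s. LINT t:{0..<s}|B.M. h t)"
    "(\<lambda>s. LINT t:{0..<s}|B.M. h t) \<in> borel_measurable hborel"
    by (rule B.primitive_bounded, rule B.borel_measurable_primitive)
qed

lemma picard_primitive:
  assumes h: "h \<in> borel_measurable hborel" "A.locally_bounded h"
  shows "A.primitive (picard h) (\<lambda>s. LINT t:{0..<s}|B.M. h t)"
  using A.locally_integrable_of_bounded[OF inner_bounded(2,1)[OF h]] by (simp add: A.primitive_def picard_def set_integral_empty)

lemma inner_le:
  assumes h: "h \<in> borel_measurable hborel" "A.locally_bounded h" and X: "X \<in> hintv b"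
    and le: "\<And>t. 0 \<le> t \<Longrightarrow> t \<le> X \<Longrightarrow> norm (h t) \<le> K * R t ^ n" and K: "0 \<le> K" and s: "0 \<le> s" "s \<le> X"
  shows "norm (LINT t:{0..<s}|B.M. h t) \<le> K * R' X * R s ^ n"
proof -
  have sh: "s \<in> hintv b" by (rule hintv_mono[OF X s])
  have "norm (LINT t:{0..<s}|B.M. h t) \<le> (LINT t:{0..<s}|B.M. K * R s ^ n)"
  proof (rule B.norm_integral_le[OF B.locally_integrable_of_bounded[OF h] B.locally_integrable_const B.zero_in sh])
    fix t assume t: "0 \<le> t" "t < s"
    have th: "t \<in> hintv b" using hintv_mono[OF sh, of t] t by simp
    have "norm (h t) \<le> K * R t ^ n" using le t s by simp
    also have "\<dots> \<le> K * R s ^ n"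
      using K t A.R_mono[OF th sh] A.R_nonneg[OF th] by (intro mult_left_mono power_mono) auto
    finally show "norm (h t) \<le> K * R s ^ n" .
  qed
  also have "\<dots> = R' s * (K * R s ^ n)"
    unfolding B.integral_const_Ico[OF B.zero_in sh s(1)] by (simp add: B.R_zero)
  also have "\<dots> \<le> R' X * (K * R s ^ n)"
    using K A.R_nonneg[OF sh] B.R_mono[OF sh X s(2)] by (intro mult_right_mono) auto
  finally show ?thesis by (simp add: ac_simps)
qed

text \<open>Only \<open>R\<close> is integrated as a power; the inner integral costs the constant \<open>R' X\<close>.\<close>

lemma picard_le:
  assumes h: "h \<in> borel_measurable hborel" "A.locally_bounded h" and X: "X \<in> hintv b"
    and le: "\<And>t. 0 \<le> t \<Longrightarrow> t \<le> X \<Longrightarrow> norm (h t) \<le> K * R t ^ n" and K: "0 \<le> K" and x: "0 \<le> x" "x \<le> X"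
  shows "norm (picard h x) \<le> K * R' X * (R x ^ Suc n / Suc n)"
proof -
  have xh: "x \<in> hintv b" by (rule hintv_mono[OF X x])
  have K': "0 \<le> K * R' X" using K B.R_nonneg[OF X] by simp
  have li: "A.locally_integrable (\<lambda>s. K * R' X * R s ^ n)"
    unfolding A.locally_integrable_def
  proof
    fix y assume y: "y \<in> hintv b"
    have "set_integrable A.M {0..<y} (\<lambda>s. R s ^ n)"
      using A.R_measurable
    proof (intro A.set_integrable_bounded[where C = "R y ^ n"] y)
      fix t assume "0 \<le> t" "t < y"
      then show "norm (R t ^ n) \<le> R y ^ n"
        using hintv_mono[OF y, of t] A.R_nonneg[of t] A.R_mono[OF _ y, of t] by (auto simp: power_abs intro: power_mono)
    qed simp
    then show "set_integrable A.M {0..<y} (\<lambda>s. K * R' X * R s ^ n)" by simp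
  qed
  have "norm (picard h x) \<le> (LINT s:{0..<x}|A.M. K * R' X * R s ^ n)"
    unfolding picard_def
    by (rule A.norm_integral_le[OF A.locally_integrable_of_bounded[OF inner_bounded(2,1)[OF h]] li A.zero_in xh])
       (use inner_le[OF h X le K] x in auto)
  also have "\<dots> = K * R' X * (LINT s:{0..<x}|A.M. R s ^ n)" by simp
  also have "\<dots> \<le> K * R' X * (R x ^ Suc n / Suc n)"
    by (intro mult_left_mono A.integral_power_le xh K')
  finally show ?thesis .
qed

lemma solution_measurable:
  assumes "solution l u1 u2"
  shows "u1 \<in> borel_measurable hborel" "u2 \<in> borel_measurable hborel"
    "A.locally_bounded u1" "A.locally_bounded u2"
  using assms A.borel_measurable_primitive B.borel_measurable_primitive A.primitive_bounded B.primitive_bounded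
  by (auto simp: solution_def)

text \<open>From \<open>w1 = - l * picard w1\<close> one gets \<open>\<bar>w1\<bar> \<le> C * a^n * R^n / n!\<close> on \<open>[0,X]\<close> for all \<open>n\<close>.\<close>

lemma solution_zero:
  assumes w: "solution l w1 w2" "w1 0 = 0" "w2 0 = 0" and X: "X \<in> hintv b"
  shows "w1 X = 0 \<and> w2 X = 0"
proof -
  note m = solution_measurable(1,3)[OF w(1)]
  have w2: "w2 s = - l * (LINT t:{0..<s}|B.M. w1 t)" if "s \<in> hintv b" for s
  proof -
    have "w2 s = w2 0 + (LINT t:{0..<s}|B.M. - l * w1 t)"
      by (rule B.primitive_eq) (use w that in \<open>simp_all add: solution_def\<close>)
    also have "(LINT t:{0..<s}|B.M. - l * w1 t) = - l * (LINT t:{0..<s}|B.M. w1 t)"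
      by (rule set_integral_mult_right)
    finally show ?thesis using w by simp
  qed
  have w1: "w1 x = - l * picard w1 x" if x: "x \<in> hintv b" for x
  proof -
    have "w1 x = (LINT s:{0..<x}|A.M. w2 s)"
      using w A.primitive_eq[of w1 w2 x] x by (simp add: solution_def)
    also have "\<dots> = (LINT s:{0..<x}|A.M. - l * (LINT t:{0..<s}|B.M. w1 t))"
      unfolding set_lebesgue_integral_def[of A.M]
    proof (rule Bochner_Integration.integral_cong[OF refl])
      fix s show "indicat_real {0..<x} s *\<^sub>R w2 s = indicat_real {0..<x} s *\<^sub>R (- l * (LINT t:{0..<s}|B.M. w1 t))"
        using w2[of s] hintv_mono[OF x, of s] by (auto simp: indicator_def)
    qed
    also have "\<dots> = - l * picard w1 x" unfolding picard_def by (rule set_integral_mult_right)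
    finally show ?thesis .
  qed
  obtain C where C: "\<And>t. 0 \<le> t \<Longrightarrow> t \<le> X \<Longrightarrow> norm (w1 t) \<le> C"
    using m(2) X unfolding A.locally_bounded_def by blast
  have C0: "0 \<le> C" using C[of 0] hintv_nonneg[OF X] norm_ge_zero order_trans by blast
  define a where "a = norm l * R' X"
  have a0: "0 \<le> a" using B.R_nonneg[OF X] by (simp add: a_def)
  have bd: "norm (w1 t) \<le> (C * a ^ n / fact n) * R t ^ n" if "0 \<le> t" "t \<le> X" for n t
    using that
  proof (induction n arbitrary: t)
    case 0
    then show ?case using C by simp
  next
    case (Suc n)
    have "norm (w1 t) = norm l * norm (picard w1 t)"
      using w1[OF hintv_mono[OF X Suc.prems]] by (metis norm_minus_cancel norm_mult)
    also have "\<dots> \<le> norm l * ((C * a ^ n / fact n) * R' X * (R t ^ Suc n / Suc n))"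
      using C0 a0 Suc.prems by (intro mult_left_mono picard_le[OF m X Suc.IH]) auto
    also have "\<dots> = (C * a ^ Suc n / fact (Suc n)) * R t ^ Suc n"
      by (simp add: a_def field_simps)
    finally show ?case .
  qed
  have "w1 t = 0" if t: "0 \<le> t" "t \<le> X" for t
  proof -
    have "(\<lambda>n. C * ((a * R t) ^ n / fact n)) \<longlonglongrightarrow> C * 0"
      using summable_LIMSEQ_zero[OF summable_exp[of "a * R t"]]
      by (intro tendsto_mult tendsto_const) (simp add: divide_inverse mult.commute)
    then have "(\<lambda>n. (C * a ^ n / fact n) * R t ^ n) \<longlonglongrightarrow> 0"
      by (simp add: power_mult_distrib ac_simps)
    then have "norm (w1 t) \<le> 0" using bd[OF t] by (intro LIMSEQ_le_const) auto
    then show ?thesis by simp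
  qed note z = this
  have "(LINT t:{0..<X}|B.M. w1 t) = (LINT t:{0..<X}|B.M. 0)"
    unfolding set_lebesgue_integral_def
    by (rule Bochner_Integration.integral_cong[OF refl]) (use z in \<open>auto simp: indicator_def\<close>)
  then show ?thesis using z[of X] hintv_nonneg[OF X] w2[OF X] by simp
qed

lemma solution_unique:
  assumes u: "solution l u1 u2" and v: "solution l v1 v2" and "u1 0 = v1 0" "u2 0 = v2 0" and X: "X \<in> hintv b"
  shows "u1 X = v1 X" "u2 X = v2 X"
  using solution_zero[OF solution_lincomb[OF u v, of 1 "-1"] _ _ X] assms by auto

lemma solution_exists: "\<exists>u1 u2. solution l u1 u2 \<and> u1 0 = a1 \<and> u2 0 = a2"
proof -
  \<comment> \<open>the terms of the Neumann series; on \<open>[0,X]\<close> the \<open>n\<close>-th one is bounded by \<open>c X n\<close>\<close>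
  define \<phi> where "\<phi> = rec_nat (\<lambda>x. a1 + a2 * of_real (R x)) (\<lambda>_ h x. - l * picard h x)"
  have \<phi>0: "\<phi> 0 = (\<lambda>x. a1 + a2 * of_real (R x))" and \<phi>S: "\<phi> (Suc n) = (\<lambda>x. - l * picard (\<phi> n) x)" for n
    by (simp_all add: \<phi>_def)
  define C where "C X = norm a1 + norm a2 * R X" for X
  define a where "a X = norm l * R' X" for X
  define c where "c X n = C X * (a X ^ n / fact n) * R X ^ n" for X n
  have C0: "0 \<le> C X" and a0: "0 \<le> a X" if "X \<in> hintv b" for X
    using A.R_nonneg[OF that] B.R_nonneg[OF that] by (simp_all add: C_def a_def)
  have c0: "0 \<le> c X n" if "X \<in> hintv b" for X n
    using C0[OF that] a0[OF that] A.R_nonneg[OF that] by (simp add: c_def)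
  have csum: "summable (c X)" for X
  proof -
    have "summable (\<lambda>n. C X * (inverse (fact n) * (a X * R X) ^ n))"
      by (intro summable_mult summable_exp)
    then show ?thesis by (simp add: c_def[abs_def] power_mult_distrib field_simps)
  qed
  have R0: "A.primitive (\<phi> 0) (\<lambda>_. a2)"
    unfolding A.primitive_def
  proof (intro conjI ballI)
    fix x assume x: "x \<in> hintv b"
    show "\<phi> 0 x = \<phi> 0 0 + (LINT t:{0..<x}|A.M. a2)"
      using A.integral_const_Ico[OF A.zero_in x hintv_nonneg[OF x], of a2] A.R_zero
      by (simp add: \<phi>0 scaleR_conv_of_real)
  qed (rule A.locally_integrable_const)
  have mb: "\<phi> n \<in> borel_measurable hborel \<and> A.locally_bounded (\<phi> n)" for n
  proof (induction n)
    case 0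
    show ?case using A.borel_measurable_primitive[OF R0] A.primitive_bounded[OF R0] by simp
  next
    case (Suc n)
    have "A.primitive (\<phi> (Suc n)) (\<lambda>s. - l * (LINT t:{0..<s}|B.M. \<phi> n t))"
      unfolding \<phi>S by (rule A.primitive_scale[OF picard_primitive]) (use Suc in auto)
    then show ?case using A.borel_measurable_primitive A.primitive_bounded by blast
  qed
  have bd: "norm (\<phi> n t) \<le> (C X * a X ^ n / fact n) * R t ^ n" if X: "X \<in> hintv b" and "0 \<le> t" "t \<le> X" for X n t
    using that(2,3)
  proof (induction n arbitrary: t)
    case 0
    have th: "t \<in> hintv b" by (rule hintv_mono[OF X 0])
    have "norm (\<phi> 0 t) \<le> norm a1 + norm a2 * R t"
      unfolding \<phi>0 using norm_triangle_ineq[of a1 "a2 * of_real (R t)"] A.R_nonneg[OF th] by (simp add: norm_mult)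
    also have "\<dots> \<le> C X" unfolding C_def using A.R_mono[OF th X 0(2)] by (intro add_left_mono mult_left_mono) auto
    finally show ?case by simp
  next
    case (Suc n)
    have "norm (\<phi> (Suc n) t) = norm l * norm (picard (\<phi> n) t)"
      unfolding \<phi>S by (simp add: norm_mult)
    also have "\<dots> \<le> norm l * ((C X * a X ^ n / fact n) * R' X * (R t ^ Suc n / Suc n))"
      using C0[OF X] a0[OF X] mb[of n] Suc.prems by (intro mult_left_mono picard_le[OF _ _ X Suc.IH]) auto
    also have "\<dots> = (C X * a X ^ Suc n / fact (Suc n)) * R t ^ Suc n"
      by (simp add: a_def field_simps)
    finally show ?case .
  qed
  have bdc: "norm (\<phi> n t) \<le> c X n" if X: "X \<in> hintv b" and t: "0 \<le> t" "t \<le> X" for X n t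
  proof -
    have "(C X * a X ^ n / fact n) * R t ^ n \<le> (C X * a X ^ n / fact n) * R X ^ n"
      using C0[OF X] a0[OF X] A.R_nonneg[OF hintv_mono[OF X t]] A.R_mono[OF hintv_mono[OF X t] X t(2)]
      by (intro mult_left_mono power_mono) auto
    then show ?thesis using bd[OF X t, of n] by (simp add: c_def)
  qed
  define u1 where "u1 x = (\<Sum>n. \<phi> n x)" for x
  define u2 where "u2 x = a2 - l * (LINT t:{0..<x}|B.M. u1 t)" for x
  have summ: "summable (\<lambda>n. \<phi> n t)" if "t \<in> hintv b" for t
    by (rule summable_comparison_test'[OF csum[of t], of 0]) (use bdc[OF that] hintv_nonneg[OF that] in auto)
  have u1m: "u1 \<in> borel_measurable hborel" unfolding u1_def[abs_def] using mb by (intro borel_measurable_suminf) auto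
  have u1b: "A.locally_bounded u1"
    unfolding A.locally_bounded_def
  proof (intro ballI exI allI impI)
    fix X t assume X: "X \<in> hintv b" and t: "0 \<le> t \<and> t \<le> X"
    have "norm (u1 t) \<le> (\<Sum>n. norm (\<phi> n t))" unfolding u1_def
      by (intro summable_norm summable_comparison_test'[OF csum[of X], of 0]) (use bdc[OF X] t in auto)
    also have "\<dots> \<le> (\<Sum>n. c X n)"
      by (intro suminf_le csum summable_comparison_test'[OF csum[of X], of 0]) (use bdc[OF X] t in auto)
    finally show "norm (u1 t) \<le> (\<Sum>n. c X n)" .
  qed
  have J: "(\<lambda>n. LINT t:{0..<s}|B.M. \<phi> n t) sums (LINT t:{0..<s}|B.M. u1 t)" if s: "s \<in> hintv b" for s
    unfolding u1_def
    by (rule B.integral_suminf_bounded[where c = "c s"])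
       (use mb s bdc[OF s] c0[OF s] csum in \<open>auto simp: B.measurable_M\<close>)
  have VV: "(\<lambda>n. picard (\<phi> n) x) sums picard u1 x" if x: "x \<in> hintv b" for x
  proof -
    have "(\<lambda>n. picard (\<phi> n) x) sums (LINT s:{0..<x}|A.M. (\<Sum>n. LINT t:{0..<s}|B.M. \<phi> n t))"
      unfolding picard_def
    proof (rule A.integral_suminf_bounded[where c = "\<lambda>n. c x n * R' x"])
      show "(\<lambda>s. LINT t:{0..<s}|B.M. \<phi> n t) \<in> borel_measurable A.M" for n
        using inner_bounded(2)[of "\<phi> n"] mb[of n] by (simp add: A.measurable_M)
      fix n s assume s: "0 \<le> s" "s < x"
      show "norm (LINT t:{0..<s}|B.M. \<phi> n t) \<le> c x n * R' x"
        using inner_le[of "\<phi> n" x "c x n" 0 s] mb[of n] x bdc[OF x] c0[OF x, of n] s by simp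
    qed (use x c0[OF x] B.R_nonneg[OF x] csum[of x] in \<open>auto intro: summable_mult2\<close>)
    also have "(LINT s:{0..<x}|A.M. (\<Sum>n. LINT t:{0..<s}|B.M. \<phi> n t)) = picard u1 x"
      unfolding picard_def set_lebesgue_integral_def[of A.M]
    proof (rule Bochner_Integration.integral_cong[OF refl])
      fix s show "indicat_real {0..<x} s *\<^sub>R (\<Sum>n. LINT t:{0..<s}|B.M. \<phi> n t) = indicat_real {0..<x} s *\<^sub>R (LINT t:{0..<s}|B.M. u1 t)"
        using sums_unique[OF J[of s]] hintv_mono[OF x, of s] by (auto simp: indicator_def)
    qed
    finally show ?thesis .
  qed
  have u1_eq: "u1 x = a1 + a2 * of_real (R x) - l * picard u1 x" if x: "x \<in> hintv b" for x
  proof -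
    have "u1 x = \<phi> 0 x + (\<Sum>n. \<phi> (Suc n) x)"
      unfolding u1_def using suminf_split_head[OF summ[OF x]] by simp
    also have "(\<Sum>n. \<phi> (Suc n) x) = - l * picard u1 x"
      unfolding \<phi>S using sums_unique[OF sums_mult[OF VV[OF x], of "- l"]] by simp
    finally show ?thesis by (simp add: \<phi>0)
  qed
  have "B.primitive u2 (\<lambda>x. - l * u1 x)"
    unfolding B.primitive_def
  proof (intro conjI ballI)
    have "B.locally_integrable u1" by (rule B.locally_integrable_of_bounded[OF u1m u1b])
    then show "B.locally_integrable (\<lambda>x. - l * u1 x)"
      unfolding B.locally_integrable_def by (blast intro: set_integrable_mult_right)
    fix x
    show "u2 x = u2 0 + (LINT t:{0..<x}|B.M. - l * u1 t)"
      unfolding set_integral_mult_right by (simp add: u2_def set_integral_empty)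
  qed
  moreover have "A.primitive u1 u2"
  proof -
    have "A.primitive (\<lambda>x. 1 * \<phi> 0 x + (- l) * picard u1 x) (\<lambda>x. 1 * a2 + (- l) * (LINT t:{0..<x}|B.M. u1 t))"
      by (rule A.primitive_lincomb[OF R0 picard_primitive[OF u1m u1b]])
    then have *: "A.primitive (\<lambda>x. a1 + a2 * of_real (R x) - l * picard u1 x) u2" by (simp add: \<phi>0 u2_def[abs_def])
    show ?thesis
      unfolding A.primitive_def
    proof (intro conjI ballI)
      fix x assume x: "x \<in> hintv b"
      show "u1 x = u1 0 + (LINT t:{0..<x}|A.M. u2 t)"
        using A.primitive_eq[OF * x] u1_eq[OF x] u1_eq[OF A.zero_in] by simp
    qed (rule A.primitive_integrable[OF *])
  qed
  moreover have "u1 0 = a1" using u1_eq[OF A.zero_in] A.R_zero by (simp add: picard_def set_integral_empty)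
  moreover have "u2 0 = a2" by (simp add: u2_def set_integral_empty)
  ultimately show ?thesis unfolding solution_def by blast
qed

lemma ivp_sol:
  "solution l (fst (ivp_sol b R R' l a1 a2)) (snd (ivp_sol b R R' l a1 a2)) \<and>
   fst (ivp_sol b R R' l a1 a2) 0 = a1 \<and> snd (ivp_sol b R R' l a1 a2) 0 = a2"
proof -
  have "\<exists>p. case p of (u1, u2) \<Rightarrow> solves b R R' (\<lambda>x. l * u1 x) u1 u2 \<and> u1 0 = a1 \<and> u2 0 = a2"
    using solution_exists[of l a1 a2] by (auto simp: solves_iff_solution)
  from someI_ex[OF this] show ?thesis
    unfolding ivp_sol_def by (simp add: split_def solves_iff_solution)
qed

abbreviation "C1 l x \<equiv> c1 b R R' x l"
abbreviation "C2 l x \<equiv> c2 b R R' x l"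
abbreviation "S1 l x \<equiv> s1 b R R' x l"
abbreviation "S2 l x \<equiv> s2 b R R' x l"

lemma solution_c: "solution l (C1 l) (C2 l)" and c_init: "C1 l 0 = 1" "C2 l 0 = 0"
  and solution_s: "solution l (S1 l) (S2 l)" and s_init: "S1 l 0 = 0" "S2 l 0 = 1"
  using ivp_sol[of l 1 0] ivp_sol[of l 0 1]
  by (simp_all add: c1_def[abs_def] c2_def[abs_def] s1_def[abs_def] s2_def[abs_def])

lemma solution_eq:
  assumes u: "solution l u1 u2" and x: "x \<in> hintv b"
  shows "u1 x = u1 0 * C1 l x + u2 0 * S1 l x" "u2 x = u1 0 * C2 l x + u2 0 * S2 l x"
  using solution_unique[OF u solution_lincomb[OF solution_c solution_s, of l "u1 0" "u2 0"] _ _ x] by (auto simp: c_init s_init)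

lemma pair_swap: "stieltjes_pair b R' R"
  by unfold_locales

text \<open>The equation for \<open>u2\<close> says that \<open>u2\<close> is a primitive of \<open>- l * u1\<close>, and the one for \<open>u1\<close>, multiplied by
  \<open>- l\<close>, that \<open>- l * u1\<close> is a primitive of \<open>- l * u2\<close>.\<close>

lemma solution_swap:
  assumes "solution l u1 u2"
  shows "stieltjes_pair.solution b R' R l u2 (\<lambda>x. - l * u1 x)"
proof -
  interpret W: stieltjes_pair b R' R by (rule pair_swap)
  show ?thesis using assms A.primitive_scale[of u1 u2 "- l"] by (simp add: solution_def W.solution_def)
qed

text \<open>Both sides solve the exchanged system with the same initial values.\<close>

lemma swap_fundamental:
  assumes l: "l \<noteq> 0" and x: "x \<in> hintv b"
  shows "c1 b R' R x l = S2 l x" "c2 b R' R x l = - l * S1 l x"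
    "s1 b R' R x l = - C2 l x / l" "s2 b R' R x l = C1 l x"
proof -
  interpret W: stieltjes_pair b R' R by (rule pair_swap)
  show "c1 b R' R x l = S2 l x" "c2 b R' R x l = - l * S1 l x"
    using W.solution_eq[OF solution_swap[OF solution_s[of l]] x] by (simp_all add: s_init)
  show "s1 b R' R x l = - C2 l x / l" "s2 b R' R x l = C1 l x"
    using W.solution_eq[OF solution_swap[OF solution_c[of l]] x] l by (simp_all add: c_init field_simps)
qed

end

section \<open>Weyl discs and the principal coefficient of a singular system\<close>

lemma tendsto_at_endI:
  fixes f :: "real \<Rightarrow> 'a::metric_space"
  assumes "0 < b" "\<And>e. 0 < e \<Longrightarrow> \<exists>x0\<in>hintv b. \<forall>x\<in>hintv b. x0 \<le> x \<longrightarrow> dist (f x) L \<le> e"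
  shows "(f \<longlongrightarrow> L) (at_end b)"
proof (rule tendstoI)
  fix e :: real assume "0 < e"
  then obtain x0 where "x0 \<in> hintv b" "\<And>x. x \<in> hintv b \<Longrightarrow> x0 \<le> x \<Longrightarrow> dist (f x) L \<le> e / 2"
    using assms(2)[of "e / 2"] by auto
  then show "eventually (\<lambda>x. dist (f x) L < e) (at_end b)"
    using \<open>0 < e\<close> unfolding eventually_at_end[OF assms(1)]
  proof (intro bexI[of _ x0] ballI impI)
    fix x assume "x \<in> hintv b" "x0 < x"
    then have "dist (f x) L \<le> e / 2" using \<open>\<And>x. x \<in> hintv b \<Longrightarrow> x0 \<le> x \<Longrightarrow> dist (f x) L \<le> e / 2\<close> by simp
    then show "dist (f x) L < e" using \<open>0 < e\<close> by simp
  qed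
qed

lemma Cauchy_at_end:
  fixes f :: "real \<Rightarrow> 'a::complete_space"
  assumes b: "0 < b" and C: "\<And>e. 0 < e \<Longrightarrow> \<exists>x0\<in>hintv b. \<forall>x\<in>hintv b. \<forall>y\<in>hintv b. x0 \<le> x \<longrightarrow> x \<le> y \<longrightarrow> dist (f x) (f y) \<le> e"
  shows "\<exists>L. (f \<longlongrightarrow> L) (at_end b)"
proof -
  obtain X where X: "incseq X" "\<And>n. X n \<in> hintv b" "\<And>x. x \<in> hintv b \<Longrightarrow> \<exists>n. x < X n"
    by (rule hintv_cofinal[OF b]) (rule that)
  have "Cauchy (\<lambda>n. f (X n))"
  proof (rule CauchyI', goal_cases)
    case (1 e)
    obtain x0 where x0: "x0 \<in> hintv b" "\<And>x y. x \<in> hintv b \<Longrightarrow> y \<in> hintv b \<Longrightarrow> x0 \<le> x \<Longrightarrow> x \<le> y \<Longrightarrow> dist (f x) (f y) \<le> e / 2"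
      using C[OF half_gt_zero[OF 1]] by blast
    obtain N where N: "x0 < X N" using X(3)[OF x0(1)] by auto
    have "dist (f (X m)) (f (X n)) < e" if "N \<le> m" "m < n" for m n
    proof -
      have "X N \<le> X m" "X m \<le> X n" using X(1) that by (auto simp: incseq_def)
      then have "dist (f (X m)) (f (X n)) \<le> e / 2" using N by (intro x0(2) X(2)) auto
      then show ?thesis using 1 by simp
    qed
    then show ?case by blast
  qed
  then obtain L where L: "(\<lambda>n. f (X n)) \<longlonglongrightarrow> L" using Cauchy_convergent convergent_def by blast
  have "(f \<longlongrightarrow> L) (at_end b)"
  proof (rule tendsto_at_endI[OF b])
    fix e :: real assume "0 < e"
    obtain x0 where x0: "x0 \<in> hintv b" "\<And>x y. x \<in> hintv b \<Longrightarrow> y \<in> hintv b \<Longrightarrow> x0 \<le> x \<Longrightarrow> x \<le> y \<Longrightarrow> dist (f x) (f y) \<le> e"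
      using C[OF \<open>0 < e\<close>] by blast
    have "dist (f x) L \<le> e" if x: "x \<in> hintv b" "x0 \<le> x" for x
    proof -
      obtain N where N: "x < X N" using X(3)[OF x(1)] by auto
      have "dist (f x) (f (X n)) \<le> e" if "N \<le> n" for n
      proof -
        have "X N \<le> X n" using X(1) that by (auto simp: incseq_def)
        then show ?thesis using N x by (intro x0(2) X(2)) auto
      qed
      moreover have "(\<lambda>n. dist (f x) (f (X n))) \<longlonglongrightarrow> dist (f x) L" by (intro tendsto_intros L)
      ultimately show ?thesis by (intro LIMSEQ_le_const2) auto
    qed
    then show "\<exists>x0\<in>hintv b. \<forall>x\<in>hintv b. x0 \<le> x \<longrightarrow> dist (f x) L \<le> e" using x0(1) by blast
  qed
  then show ?thesis ..
qed

context stieltjes begin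

lemma locally_integrable_norm_square:
  assumes h: "h \<in> borel_measurable (restrict_space borel (hintv b))" "locally_bounded h"
  shows "locally_integrable (\<lambda>t. (cmod (h t))\<^sup>2)"
  unfolding locally_integrable_def
proof
  fix x assume x: "x \<in> hintv b"
  then obtain C where C: "\<And>t. 0 \<le> t \<Longrightarrow> t \<le> x \<Longrightarrow> cmod (h t) \<le> C"
    using h(2) unfolding locally_bounded_def by blast
  have m: "h \<in> borel_measurable M" using h(1) by (simp add: measurable_M)
  show "set_integrable M {0..<x} (\<lambda>t. (cmod (h t))\<^sup>2)"
    by (rule set_integrable_bounded[where C = "C\<^sup>2"]) (use m x C in \<open>auto intro: power_mono\<close>)
qed

lemma locally_integrable_scale:
  fixes f :: "real \<Rightarrow> real"
  shows "locally_integrable f \<Longrightarrow> locally_integrable (\<lambda>t. c * f t)"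
  unfolding locally_integrable_def by (auto intro!: set_integrable_mult_right)

definition energy :: "(real \<Rightarrow> complex) \<Rightarrow> real \<Rightarrow> real" where
  "energy h x = (LINT t:{0..<x}|M. (cmod (h t))\<^sup>2)"

lemma integral_nonneg_Ico: "(\<And>t. s \<le> t \<Longrightarrow> t < x \<Longrightarrow> 0 \<le> f t) \<Longrightarrow> 0 \<le> (LINT t:{s..<x}|M. (f t :: real))"
  unfolding set_lebesgue_integral_def
  by (rule Bochner_Integration.integral_nonneg) (auto simp: indicator_def)

lemma energy_nonneg: "0 \<le> energy h x"
  unfolding energy_def by (rule integral_nonneg_Ico) simp

lemma energy_diff:
  assumes "h \<in> borel_measurable (restrict_space borel (hintv b))" "locally_bounded h" "x \<in> hintv b" "y \<in> hintv b" "x \<le> y"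
  shows "energy h y - energy h x = (LINT t:{x..<y}|M. (cmod (h t))\<^sup>2)"
  using integral_split[OF locally_integrable_norm_square[OF assms(1,2)] assms(3-5)] by (simp add: energy_def)

lemma energy_mono:
  assumes "h \<in> borel_measurable (restrict_space borel (hintv b))" "locally_bounded h" "x \<in> hintv b" "y \<in> hintv b" "x \<le> y"
  shows "energy h x \<le> energy h y"
  using energy_diff[OF assms] integral_nonneg_Ico[of x y "\<lambda>t. (cmod (h t))\<^sup>2"] by simp

lemma integral_zero_of_energy:
  assumes h: "h \<in> borel_measurable (restrict_space borel (hintv b))" "locally_bounded h" and x: "x \<in> hintv b"
    and e: "energy h x = 0"
  shows "(LINT t:{0..<x}|M. h t) = 0"
proof -
  have "integrable M (\<lambda>t. indicat_real {0..<x} t *\<^sub>R (cmod (h t))\<^sup>2)"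
    using locally_integrableD[OF locally_integrable_norm_square[OF h] x] by (simp add: set_integrable_def)
  then have "AE t in M. indicat_real {0..<x} t *\<^sub>R (cmod (h t))\<^sup>2 = 0"
    using e by (subst integral_nonneg_eq_0_iff_AE[symmetric]) (auto simp: energy_def set_lebesgue_integral_def)
  then have "AE t in M. indicat_real {0..<x} t *\<^sub>R h t = 0"
    by (rule eventually_mono) (auto simp: indicator_def split: if_splits)
  then show ?thesis
    unfolding set_lebesgue_integral_def by (rule integral_eq_zero_AE)
qed

text \<open>A substitute for Gronwall's inequality in which jumps do no harm. Beyond a point \<open>x1\<close> where the remaining mass of
\<open>h\<close> is at most \<open>1/2\<close>, the function \<open>F\<close> never exceeds \<open>2 * \<bar>F x1\<bar>\<close>: a bound \<open>2 * \<bar>F x1\<bar> + C\<close> improves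
itself to \<open>2 * \<bar>F x1\<bar> + C / 2\<close>.\<close>

lemma primitive_bounded_of_relative_bound:
  assumes F: "primitive F f" and x0: "x0 \<in> hintv b"
    and h: "locally_integrable h" "\<And>t. 0 \<le> h t"
    and le: "\<And>t. t \<in> hintv b \<Longrightarrow> x0 \<le> t \<Longrightarrow> cmod (f t) \<le> h t * cmod (F t)"
    and bd: "\<And>x. x \<in> hintv b \<Longrightarrow> (LINT t:{0..<x}|M. h t) \<le> K"
  shows "\<exists>S. \<forall>x\<in>hintv b. cmod (F x) \<le> S"
proof -
  define P where "P x = (LINT t:{0..<x}|M. h t)" for x
  have Pmono: "P x \<le> P y" if "x \<in> hintv b" "y \<in> hintv b" "x \<le> y" for x y
    using integral_split[OF h(1) that] integral_nonneg_Ico[of x y h] h(2) by (simp add: P_def)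
  have bddP: "bdd_above (P ` hintv b)" using bd by (intro bdd_aboveI2[of _ _ K]) (simp add: P_def)
  have "(SUP x\<in>hintv b. P x) - 1/2 < (SUP x\<in>hintv b. P x)" by simp
  moreover have "hintv b \<noteq> {}" using zero_in by blast
  ultimately have "\<exists>z\<in>hintv b. (SUP x\<in>hintv b. P x) - 1/2 < P z"
    using less_cSUP_iff[OF _ bddP, THEN iffD1] by blast
  then obtain z where z: "z \<in> hintv b" "(SUP x\<in>hintv b. P x) - 1/2 < P z" ..
  define x1 where "x1 = max x0 z"
  have x1: "x1 \<in> hintv b" "x0 \<le> x1" using x0 z(1) by (auto simp: x1_def max_def)
  have tail: "P x - P x1 \<le> 1/2" if x: "x \<in> hintv b" for x
  proof -
    have "P x \<le> (SUP x\<in>hintv b. P x)" by (rule cSUP_upper[OF x bddP])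
    moreover have "P z \<le> P x1" by (rule Pmono[OF z(1) x1(1)]) (simp add: x1_def)
    ultimately show ?thesis using z(2) by linarith
  qed
  have bound: "cmod (F X) \<le> 2 * cmod (F x1)" if X: "X \<in> hintv b" "x1 \<le> X" for X
  proof -
    obtain C where C: "\<And>t. 0 \<le> t \<Longrightarrow> t \<le> X \<Longrightarrow> cmod (F t) \<le> C"
      using primitive_bounded[OF F] X(1) unfolding locally_bounded_def by blast
    have C0: "0 \<le> C" using order_trans[OF norm_ge_zero C[of 0]] hintv_nonneg[OF X(1)] by simp
    have step: "cmod (F y) \<le> 2 * cmod (F x1) + C / 2 ^ n" if "x1 \<le> y" "y \<le> X" for y n
      using that
    proof (induction n arbitrary: y)
      case 0
      then have "cmod (F y) \<le> C" using C[of y] hintv_nonneg[OF x1(1)] by simp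
      moreover have "0 \<le> 2 * cmod (F x1)" by simp
      ultimately show ?case unfolding power_0 div_by_1 by linarith
    next
      case (Suc n)
      define D where "D = 2 * cmod (F x1) + C / 2 ^ n"
      have D0: "0 \<le> D" using C0 by (simp add: D_def)
      have y: "y \<in> hintv b" using hintv_mono[OF X(1), of y] hintv_nonneg[OF x1(1)] Suc.prems by simp
      have "cmod (LINT t:{x1..<y}|M. f t) \<le> (LINT t:{x1..<y}|M. h t * D)"
      proof (rule norm_integral_le[OF primitive_integrable[OF F] _ x1(1) y])
        show "locally_integrable (\<lambda>t. h t * D)"
          using locally_integrable_scale[OF h(1), of D] by (simp add: mult.commute)
        fix t assume t: "x1 \<le> t" "t < y"
        have th: "t \<in> hintv b" using hintv_mono[OF y, of t] hintv_nonneg[OF x1(1)] t by simp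
        have "cmod (f t) \<le> h t * cmod (F t)" using le[OF th] x1(2) t by simp
        also have "\<dots> \<le> h t * D"
          using Suc.IH[of t] t Suc.prems h(2) unfolding D_def by (intro mult_left_mono) auto
        finally show "cmod (f t) \<le> h t * D" .
      qed
      also have "\<dots> = (P y - P x1) * D"
        using integral_split[OF h(1) x1(1) y Suc.prems(1)] by (simp add: P_def)
      also have "\<dots> \<le> (1/2) * D" using tail[OF y] D0 by (intro mult_right_mono) auto
      finally have "cmod (F y - F x1) \<le> D / 2" using primitive_diff[OF F x1(1) y Suc.prems(1)] by simp
      then have "cmod (F y) \<le> cmod (F x1) + D / 2" using norm_triangle_sub[of "F y" "F x1"] by linarith
      then show ?case by (simp add: D_def field_simps)
    qed
    have "(\<lambda>n. 2 * cmod (F x1) + C * (1 / 2) ^ n) \<longlonglongrightarrow> 2 * cmod (F x1) + C * 0"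
      by (intro tendsto_intros LIMSEQ_power_zero) simp
    moreover have "cmod (F X) \<le> 2 * cmod (F x1) + C * (1 / 2) ^ n" for n
      using step[OF X(2) order.refl, of n] by (simp add: power_divide)
    ultimately have "cmod (F X) \<le> 2 * cmod (F x1) + C * 0" by (intro LIMSEQ_le_const) blast+
    then show ?thesis by simp
  qed
  obtain C where C: "\<And>t. 0 \<le> t \<Longrightarrow> t \<le> x1 \<Longrightarrow> cmod (F t) \<le> C"
    using primitive_bounded[OF F] x1(1) unfolding locally_bounded_def by blast
  have "cmod (F x) \<le> max C (2 * cmod (F x1))" if "x \<in> hintv b" for x
    using C[of x] bound[OF that] hintv_nonneg[OF that] by linarith
  then show ?thesis by blast
qed

end

text \<open>The conjugate of the principal square root of \<open>- l\<close>: its real part is positive off the branch cut, and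
  \<open>- l * cnj w = \<bar>w\<bar>\<^sup>2 * w\<close>.\<close>

lemma rotation_exists:
  fixes l :: complex
  assumes "l \<notin> complex_of_real ` {0..}"
  obtains om where "0 < Re om" "0 < Re (- l * om)"
proof -
  define w where "w = csqrt (- l)"
  have w2: "w ^ 2 = - l" by (simp add: w_def)
  have "Re w \<noteq> 0"
  proof
    assume "Re w = 0"
    then have "- l = of_real (- ((Im w)\<^sup>2))"
      unfolding w2[symmetric] by (simp add: complex_eq_iff power2_eq_square)
    then have "l = - complex_of_real (- ((Im w)\<^sup>2))" by (metis minus_minus)
    then have "l = complex_of_real ((Im w)\<^sup>2)" by simp
    moreover have "complex_of_real ((Im w)\<^sup>2) \<in> complex_of_real ` {0..}" by (intro imageI) simp
    ultimately show False using assms by simp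
  qed
  then have w: "0 < Re w" using csqrt_principal[of "- l"] by (simp add: w_def)
  show ?thesis
  proof (rule that[of "cnj w"])
    show "0 < Re (cnj w)" using w by simp
    have "- l * cnj w = (w * cnj w) * w" by (simp add: w2[symmetric] power2_eq_square)
    also have "\<dots> = of_real ((cmod w)\<^sup>2) * w" by (simp add: complex_norm_square del: of_real_power)
    finally have "Re (- l * cnj w) = (cmod w)\<^sup>2 * Re w" by simp
    then show "0 < Re (- l * cnj w)" using w by (auto simp: zero_less_mult_iff)
  qed
qed

text \<open>Weaker than \<open>integral_system\<close>, and symmetric in \<open>R\<close> and \<open>R'\<close>. The continuation of a regular system is
treated as the exchange of its dual; only what is symmetric carries over to it.\<close>

locale admissible_system = stieltjes_pair b R R' for b R R' +
  assumes cont: "x \<in> hintv b \<Longrightarrow> continuous (at x within hintv b) R \<or> continuous (at x within hintv b) R'"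
    and R_nontrivial: "\<exists>x\<in>hintv b. 0 < R x" and R'_nontrivial: "\<exists>x\<in>hintv b. 0 < R' x"
begin

lemma wronskian_const:
  assumes u: "solution l u1 u2" and v: "solution l v1 v2" and x: "x \<in> hintv b"
  shows "u1 x * v2 x - v1 x * u2 x = u1 0 * v2 0 - v1 0 * u2 0"
proof -
  have "u1 x * v2 x = u1 0 * v2 0 + (LINT t:{0..<x}|A.M. u2 t * v2 t) + (LINT t:{0..<x}|B.M. u1 t * (- l * v1 t))"
    by (rule product_rule[OF _ _ x cont]) (use u v in \<open>auto simp: solution_def\<close>)
  moreover have "v1 x * u2 x = v1 0 * u2 0 + (LINT t:{0..<x}|A.M. v2 t * u2 t) + (LINT t:{0..<x}|B.M. v1 t * (- l * u1 t))"
    by (rule product_rule[OF _ _ x cont]) (use u v in \<open>auto simp: solution_def\<close>)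
  moreover have "(LINT t:{0..<x}|A.M. v2 t * u2 t) = (LINT t:{0..<x}|A.M. u2 t * v2 t)"
    "(LINT t:{0..<x}|B.M. v1 t * (- l * u1 t)) = (LINT t:{0..<x}|B.M. u1 t * (- l * v1 t))"
    by (simp_all add: ac_simps)
  ultimately show ?thesis by simp
qed

lemma wronskian: "x \<in> hintv b \<Longrightarrow> C1 l x * S2 l x - S1 l x * C2 l x = 1"
  using wronskian_const[OF solution_c solution_s] by (simp add: c_init s_init)

text \<open>Green's identity, for a solution and its conjugate.\<close>

lemma green:
  assumes u: "solution l u1 u2" and x: "x \<in> hintv b"
  shows "u2 x * cnj (u1 x) = u2 0 * cnj (u1 0) - l * of_real (B.energy u1 x) + of_real (A.energy u2 x)"
proof -
  have "cnj (u1 x) * u2 x = cnj (u1 0) * u2 0 + (LINT t:{0..<x}|A.M. cnj (u2 t) * u2 t) + (LINT t:{0..<x}|B.M. cnj (u1 t) * (- l * u1 t))"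
    by (rule product_rule[OF A.primitive_cnj _ x cont]) (use u in \<open>auto simp: solution_def\<close>)
  also have "(LINT t:{0..<x}|A.M. cnj (u2 t) * u2 t) = (LINT t|A.M. of_real (indicat_real {0..<x} t *\<^sub>R (cmod (u2 t))\<^sup>2))"
    unfolding set_lebesgue_integral_def
    by (rule Bochner_Integration.integral_cong[OF refl]) (simp add: complex_norm_square indicator_def del: of_real_power)
  also have "\<dots> = of_real (A.energy u2 x)"
    by (simp only: integral_complex_of_real A.energy_def set_lebesgue_integral_def)
  also have "(LINT t:{0..<x}|B.M. cnj (u1 t) * (- l * u1 t)) = (LINT t|B.M. - l * of_real (indicat_real {0..<x} t *\<^sub>R (cmod (u1 t))\<^sup>2))"
    unfolding set_lebesgue_integral_def
    by (rule Bochner_Integration.integral_cong[OF refl]) (simp add: complex_norm_square indicator_def mult_ac del: of_real_power)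
  also have "\<dots> = - l * of_real (B.energy u1 x)"
    by (simp only: integral_mult_right_zero integral_complex_of_real B.energy_def set_lebesgue_integral_def)
  finally show ?thesis by (simp add: mult.commute)
qed

end

text \<open>With these signs the form \<open>H\<close> defined below has a nonnegative combination of the two energies as its
  increment along a solution (\<open>H_eq\<close>); it replaces the imaginary part in Weyl's classical argument, which would not
  cover negative \<open>l\<close>.\<close>

locale rotated_system = admissible_system b R R' for b R R' +
  fixes l om :: complex
  assumes om1: "0 < Re om" and om2: "0 < Re (- l * om)"
begin

definition H :: "(real \<Rightarrow> complex) \<Rightarrow> (real \<Rightarrow> complex) \<Rightarrow> real \<Rightarrow> real" where
  "H u1 u2 x = Re (om * (u2 x * cnj (u1 x)))"

lemma H_eq:
  assumes u: "solution l u1 u2" and x: "x \<in> hintv b"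
  shows "H u1 u2 x = H u1 u2 0 + Re (- l * om) * B.energy u1 x + Re om * A.energy u2 x"
  unfolding H_def green[OF u x] by (simp add: algebra_simps)

lemma H_mono:
  assumes u: "solution l u1 u2" and "x \<in> hintv b" "y \<in> hintv b" "x \<le> y"
  shows "H u1 u2 x \<le> H u1 u2 y"
  using H_eq[OF u assms(2)] H_eq[OF u assms(3)] om1 om2
    mult_left_mono[OF B.energy_mono[OF solution_measurable(1,3)[OF u] assms(2-4)], of "Re (- l * om)"]
    mult_left_mono[OF A.energy_mono[OF solution_measurable(2,4)[OF u] assms(2-4)], of "Re om"]
  by linarith

abbreviation "HC \<equiv> H (C1 l) (C2 l)"

lemma HC_zero: "HC 0 = 0" by (simp add: H_def c_init)

lemma HC_nonneg: "x \<in> hintv b \<Longrightarrow> 0 \<le> HC x"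
  using H_mono[OF solution_c A.zero_in, of x] hintv_nonneg[of x b] HC_zero by simp

text \<open>If both energies of \<open>c\<close> vanish up to \<open>x\<close>, then \<open>c2\<close> does not contribute to \<open>c1\<close>, so \<open>c1 = 1\<close> and the
  energy of \<open>c1\<close> is \<open>R' x\<close>.\<close>

lemma HC_pos: "\<exists>x\<in>hintv b. 0 < HC x"
proof -
  obtain x where x: "x \<in> hintv b" "0 < R' x" using R'_nontrivial by blast
  note m = solution_measurable[OF solution_c[of l]]
  have "HC x \<noteq> 0"
  proof
    assume "HC x = 0"
    then have "Re (- l * om) * B.energy (C1 l) x + Re om * A.energy (C2 l) x = 0"
      using H_eq[OF solution_c x(1)] HC_zero by simp
    moreover have "0 \<le> Re (- l * om) * B.energy (C1 l) x" "0 \<le> Re om * A.energy (C2 l) x"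
      using om1 om2 A.energy_nonneg B.energy_nonneg by (intro mult_nonneg_nonneg; simp)+
    ultimately have e0: "Re (- l * om) * B.energy (C1 l) x = 0" "Re om * A.energy (C2 l) x = 0" by linarith+
    have e: "B.energy (C1 l) x = 0" "A.energy (C2 l) x = 0"
      using e0 om1 om2 by (metis less_irrefl mult_eq_0_iff)+
    have c1: "C1 l t = 1" if "0 \<le> t" "t < x" for t
    proof -
      have th: "t \<in> hintv b" using hintv_mono[OF x(1)] that by simp
      have "A.energy (C2 l) t = 0"
        using A.energy_mono[OF m(2,4) th x(1)] that A.energy_nonneg[of "C2 l" t] e by simp
      then have "(LINT s:{0..<t}|A.M. C2 l s) = 0" by (rule A.integral_zero_of_energy[OF m(2,4) th])
      then show ?thesis using A.primitive_eq[of "C1 l" "C2 l" t] th solution_c[of l] by (simp add: solution_def c_init)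
    qed
    have "B.energy (C1 l) x = (LINT t:{0..<x}|B.M. 1)"
      unfolding B.energy_def set_lebesgue_integral_def
      by (rule Bochner_Integration.integral_cong[OF refl]) (use c1 in \<open>auto simp: indicator_def\<close>)
    also have "\<dots> = R' x" using B.integral_const_Ico[OF B.zero_in x(1) hintv_nonneg[OF x(1)], of "1::real"] B.R_zero by simp
    finally show False using e x by simp
  qed
  then show ?thesis using HC_nonneg[OF x(1)] x(1) by force
qed

lemma HC_le: "HC x \<le> cmod om * (cmod (C1 l x) * cmod (C2 l x))"
  unfolding H_def using complex_Re_le_cmod[of "om * (C2 l x * cnj (C1 l x))"] by (simp add: norm_mult ac_simps)

lemma om_pos: "0 < cmod om" using om1 by auto

lemma C_nonzero: "0 < HC x \<Longrightarrow> C1 l x \<noteq> 0 \<and> C2 l x \<noteq> 0"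
  by (auto simp: H_def)

text \<open>Otherwise the energies \<open>A\<close>, \<open>B\<close> of \<open>c1\<close>, \<open>c2\<close> are bounded, while \<open>\<bar>c1 * c2\<bar> \<ge> K0 > 0\<close> from some point on.
Then \<open>\<bar>c2\<bar> \<le> \<bar>c2\<bar>\<^sup>2 * \<bar>c1\<bar> / K0\<close> bounds the density of \<open>dc1\<close> by an integrable multiple of \<open>\<bar>c1\<bar>\<close>, so
\<open>c1\<close> is bounded; likewise \<open>c2\<close>. Each is then bounded away from \<open>0\<close>, so finite energy means finite total mass.\<close>

lemma HC_unbounded:
  assumes unbdd: "\<not> (\<exists>K. \<forall>x\<in>hintv b. R x \<le> K \<and> R' x \<le> K)"
  shows "\<exists>x0\<in>hintv b. \<forall>x\<in>hintv b. x0 \<le> x \<longrightarrow> K \<le> HC x"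
proof (rule ccontr)
  assume neg: "\<not> ?thesis"
  note m = solution_measurable[OF solution_c[of l]]
  have lt: "HC x < K" if x: "x \<in> hintv b" for x
  proof (rule ccontr)
    assume "\<not> HC x < K"
    then have "\<forall>y\<in>hintv b. x \<le> y \<longrightarrow> K \<le> HC y"
      using H_mono[OF solution_c[of l] x] by (meson not_le_imp_less order_trans)
    then show False using neg x by blast
  qed
  obtain z where z: "z \<in> hintv b" "0 < HC z" using HC_pos by blast
  define K0 where "K0 = HC z / cmod om"
  have K0: "0 < K0" using z om_pos by (simp add: K0_def)
  have low: "K0 \<le> cmod (C1 l x) * cmod (C2 l x)" if "x \<in> hintv b" "z \<le> x" for x
    using H_mono[OF solution_c z(1) that] HC_le[of x] om_pos by (simp add: K0_def divide_le_eq mult.commute)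
  have eB: "B.energy (C1 l) x \<le> K / Re (- l * om)" and eA: "A.energy (C2 l) x \<le> K / Re om" if x: "x \<in> hintv b" for x
  proof -
    have "0 \<le> Re (- l * om) * B.energy (C1 l) x" "0 \<le> Re om * A.energy (C2 l) x"
      using om1 om2 A.energy_nonneg B.energy_nonneg by (intro mult_nonneg_nonneg; simp)+
    then have "Re (- l * om) * B.energy (C1 l) x \<le> K" "Re om * A.energy (C2 l) x \<le> K"
      using H_eq[OF solution_c x] HC_zero lt[OF x] by linarith+
    then show "B.energy (C1 l) x \<le> K / Re (- l * om)" "A.energy (C2 l) x \<le> K / Re om"
      using om1 om2 by (simp_all only: pos_le_divide_eq mult.commute)
  qed
  have "\<exists>S. \<forall>x\<in>hintv b. cmod (C1 l x) \<le> S"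
  proof (rule A.primitive_bounded_of_relative_bound[OF _ z(1), where h = "\<lambda>t. (1 / K0) * (cmod (C2 l t))\<^sup>2"])
    show "A.primitive (C1 l) (C2 l)" using solution_c[of l] by (simp add: solution_def)
    show "A.locally_integrable (\<lambda>t. (1 / K0) * (cmod (C2 l t))\<^sup>2)"
      by (intro A.locally_integrable_scale A.locally_integrable_norm_square m(2,4))
    show "0 \<le> (1 / K0) * (cmod (C2 l t))\<^sup>2" for t using K0 by simp
    show "cmod (C2 l t) \<le> (1 / K0) * (cmod (C2 l t))\<^sup>2 * cmod (C1 l t)" if "t \<in> hintv b" "z \<le> t" for t
    proof -
      have "cmod (C2 l t) * K0 \<le> cmod (C2 l t) * (cmod (C1 l t) * cmod (C2 l t))"
        by (rule mult_left_mono[OF low[OF that]]) simp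
      then show ?thesis using K0 by (simp add: field_simps power2_eq_square)
    qed
    show "(LINT t:{0..<x}|A.M. (1 / K0) * (cmod (C2 l t))\<^sup>2) \<le> (1 / K0) * (K / Re om)" if "x \<in> hintv b" for x
      unfolding set_integral_mult_right using eA[OF that] K0 unfolding A.energy_def by (intro mult_left_mono) auto
  qed
  then obtain m1 where m1: "\<And>x. x \<in> hintv b \<Longrightarrow> cmod (C1 l x) \<le> m1" by blast
  have "\<exists>S. \<forall>x\<in>hintv b. cmod (C2 l x) \<le> S"
  proof (rule B.primitive_bounded_of_relative_bound[OF _ z(1), where h = "\<lambda>t. (cmod l / K0) * (cmod (C1 l t))\<^sup>2"])
    show "B.primitive (C2 l) (\<lambda>t. - l * C1 l t)" using solution_c[of l] by (simp add: solution_def)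
    show "B.locally_integrable (\<lambda>t. (cmod l / K0) * (cmod (C1 l t))\<^sup>2)"
      by (intro B.locally_integrable_scale B.locally_integrable_norm_square m(1,3))
    show "0 \<le> (cmod l / K0) * (cmod (C1 l t))\<^sup>2" for t using K0 by simp
    show "cmod (- l * C1 l t) \<le> (cmod l / K0) * (cmod (C1 l t))\<^sup>2 * cmod (C2 l t)" if "t \<in> hintv b" "z \<le> t" for t
    proof -
      have "(cmod l * cmod (C1 l t)) * K0 \<le> (cmod l * cmod (C1 l t)) * (cmod (C1 l t) * cmod (C2 l t))"
        by (rule mult_left_mono[OF low[OF that]]) simp
      then show ?thesis using K0 by (simp add: field_simps power2_eq_square norm_mult)
    qed
    show "(LINT t:{0..<x}|B.M. (cmod l / K0) * (cmod (C1 l t))\<^sup>2) \<le> (cmod l / K0) * (K / Re (- l * om))" if "x \<in> hintv b" for x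
      unfolding set_integral_mult_right using eB[OF that] K0 unfolding B.energy_def by (intro mult_left_mono) auto
  qed
  then obtain m2 where m2: "\<And>x. x \<in> hintv b \<Longrightarrow> cmod (C2 l x) \<le> m2" by blast
  have "0 < cmod (C1 l z)" "0 < cmod (C2 l z)" using C_nonzero[OF z(2)] by simp_all
  then have S0: "0 < m1" "0 < m2" using m1[OF z(1)] m2[OF z(1)] by linarith+
  have low1: "K0 / m2 \<le> cmod (C1 l x)" and low2: "K0 / m1 \<le> cmod (C2 l x)" if x: "x \<in> hintv b" "z \<le> x" for x
  proof -
    have "K0 \<le> cmod (C1 l x) * m2" "K0 \<le> cmod (C2 l x) * m1"
      using low[OF x] mult_left_mono[OF m2[OF x(1)], of "cmod (C1 l x)"] mult_left_mono[OF m1[OF x(1)], of "cmod (C2 l x)"]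
      by (simp_all add: mult.commute)
    then show "K0 / m2 \<le> cmod (C1 l x)" "K0 / m1 \<le> cmod (C2 l x)" using S0 by (simp_all add: divide_le_eq)
  qed
  have Rb: "R x \<le> R z + (K / Re om) / (K0 / m1)\<^sup>2" and R'b: "R' x \<le> R' z + (K / Re (- l * om)) / (K0 / m2)\<^sup>2"
    if x: "x \<in> hintv b" for x
  proof -
    define y where "y = max x z"
    have y: "y \<in> hintv b" "z \<le> y" "x \<le> y" using x z by (auto simp: y_def max_def)
    have "(R y - R z) * (K0 / m1)\<^sup>2 = (LINT t:{z..<y}|A.M. (K0 / m1)\<^sup>2)"
      using A.integral_const_Ico[OF z(1) y(1,2), of "(K0 / m1)\<^sup>2"] by simp
    also have "\<dots> \<le> (LINT t:{z..<y}|A.M. (cmod (C2 l t))\<^sup>2)"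
      using low2 K0 S0 hintv_mono[OF y(1)] hintv_nonneg[OF z(1)]
      by (intro A.integral_mono_Ico A.locally_integrable_const A.locally_integrable_norm_square m z(1) y(1) power_mono) auto
    also have "\<dots> \<le> K / Re om"
      using A.energy_diff[OF m(2,4) z(1) y(1,2)] eA[OF y(1)] A.energy_nonneg[of "C2 l" z] by linarith
    finally have "R y - R z \<le> (K / Re om) / (K0 / m1)\<^sup>2" using K0 S0 by (subst pos_le_divide_eq) auto
    then show "R x \<le> R z + (K / Re om) / (K0 / m1)\<^sup>2" using A.R_mono[OF x y(1,3)] by linarith
    have "(R' y - R' z) * (K0 / m2)\<^sup>2 = (LINT t:{z..<y}|B.M. (K0 / m2)\<^sup>2)"
      using B.integral_const_Ico[OF z(1) y(1,2), of "(K0 / m2)\<^sup>2"] by simp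
    also have "\<dots> \<le> (LINT t:{z..<y}|B.M. (cmod (C1 l t))\<^sup>2)"
      using low1 K0 S0 hintv_mono[OF y(1)] hintv_nonneg[OF z(1)]
      by (intro B.integral_mono_Ico B.locally_integrable_const B.locally_integrable_norm_square m z(1) y(1) power_mono) auto
    also have "\<dots> \<le> K / Re (- l * om)"
      using B.energy_diff[OF m(1,3) z(1) y(1,2)] eB[OF y(1)] B.energy_nonneg[of "C1 l" z] by linarith
    finally have "R' y - R' z \<le> (K / Re (- l * om)) / (K0 / m2)\<^sup>2" using K0 S0 by (subst pos_le_divide_eq) auto
    then show "R' x \<le> R' z + (K / Re (- l * om)) / (K0 / m2)\<^sup>2" using B.R_mono[OF x y(1,3)] by linarith
  qed
  have "\<forall>x\<in>hintv b. R x \<le> max (R z + (K / Re om) / (K0 / m1)\<^sup>2) (R' z + (K / Re (- l * om)) / (K0 / m2)\<^sup>2) \<and>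
     R' x \<le> max (R z + (K / Re om) / (K0 / m1)\<^sup>2) (R' z + (K / Re (- l * om)) / (K0 / m2)\<^sup>2)"
    using Rb R'b by (auto simp: le_max_iff_disj)
  then show False using unbdd by blast
qed

text \<open>The coefficients \<open>m\<close> with \<open>H (s - m * c) \<le> 0\<close> at \<open>x\<close> form a disc with \<open>s1 / c1\<close> at \<open>x\<close> on its boundary and
diameter at most \<open>\<bar>om\<bar> / H c\<close>. As \<open>H\<close> is nondecreasing, the discs decrease with \<open>x\<close>, and the disc at \<open>x\<close>
contains the later quotients.\<close>

lemma quotient_le:
  assumes x: "x \<in> hintv b" "0 < HC x" and y: "y \<in> hintv b" "x \<le> y"
  shows "cmod (S1 l x / C1 l x - S1 l y / C1 l y) \<le> cmod om / HC x"
    and "H (\<lambda>t. S1 l t - S1 l y / C1 l y * C1 l t) (\<lambda>t. S2 l t - S1 l y / C1 l y * C2 l t) x \<le> 0"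
proof -
  define m where "m = S1 l y / C1 l y"
  define d where "d = m - S1 l x / C1 l x"
  let ?v1 = "\<lambda>t. S1 l t - m * C1 l t" and ?v2 = "\<lambda>t. S2 l t - m * C2 l t"
  have v: "solution l ?v1 ?v2" using solution_lincomb[OF solution_s solution_c, of l 1 "- m"] by simp
  have c: "C1 l x \<noteq> 0" "C1 l y \<noteq> 0"
    using C_nonzero[OF x(2)] C_nonzero[of y] H_mono[OF solution_c x(1) y] x(2) by auto
  have "H ?v1 ?v2 y = 0" using c by (simp add: H_def m_def)
  then have Hx: "H ?v1 ?v2 x \<le> 0" using H_mono[OF v x(1) y] by simp
  then show "H (\<lambda>t. S1 l t - S1 l y / C1 l y * C1 l t) (\<lambda>t. S2 l t - S1 l y / C1 l y * C2 l t) x \<le> 0"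
    by (simp add: m_def)
  \<comment> \<open>at \<open>x\<close>, express the solution by its distance \<open>d\<close> from the one that vanishes there\<close>
  have v1: "?v1 x = - d * C1 l x" using c by (simp add: d_def algebra_simps)
  have v2: "?v2 x = 1 / C1 l x - d * C2 l x"
    using wronskian[OF x(1), of l] c by (simp add: d_def field_simps)
  have dd: "d * cnj d = of_real ((cmod d)\<^sup>2)" by (rule complex_norm_square[symmetric])
  have "om * (?v2 x * cnj (?v1 x)) = (d * cnj d) * (om * (C2 l x * cnj (C1 l x))) - om * cnj d * (cnj (C1 l x) / C1 l x)"
    unfolding v1 v2 by (simp add: algebra_simps)
  then have "H ?v1 ?v2 x = (cmod d)\<^sup>2 * HC x - Re (om * cnj d * (cnj (C1 l x) / C1 l x))"
    unfolding H_def dd by simp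
  moreover have "Re (om * cnj d * (cnj (C1 l x) / C1 l x)) \<le> cmod om * cmod d"
    using complex_Re_le_cmod[of "om * cnj d * (cnj (C1 l x) / C1 l x)"] c by (simp add: norm_mult norm_divide)
  ultimately have "cmod d * (cmod d * HC x) \<le> cmod d * cmod om"
    using Hx by (simp add: power2_eq_square mult_ac)
  then have "cmod d * HC x \<le> cmod om"
    using x(2) by (cases "d = 0") (auto simp: mult_le_cancel_left)
  then show "cmod (S1 l x / C1 l x - S1 l y / C1 l y) \<le> cmod om / HC x"
    using x(2) by (simp add: d_def m_def pos_le_divide_eq norm_minus_commute)
qed

end

locale singular_system = rotated_system b R R' l om for b R R' l om +
  assumes unbdd: "\<not> (\<exists>K. \<forall>x\<in>hintv b. R x \<le> K \<and> R' x \<le> K)"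
begin

lemma HC_eventually_ge: "eventually (\<lambda>x. x \<in> hintv b \<and> K \<le> HC x) (at_end b)"
  using HC_unbounded[OF unbdd, of K] unfolding eventually_at_end[OF A.b_pos] by (blast intro: less_imp_le)

lemma quotient_tendsto_ex: "\<exists>q. ((\<lambda>x. S1 l x / C1 l x) \<longlongrightarrow> q) (at_end b)"
proof (rule Cauchy_at_end[OF A.b_pos])
  fix e :: real assume e: "0 < e"
  obtain x0 where x0: "x0 \<in> hintv b" "\<And>x. x \<in> hintv b \<Longrightarrow> x0 \<le> x \<Longrightarrow> cmod om / e \<le> HC x"
    using HC_unbounded[OF unbdd, of "cmod om / e"] by blast
  show "\<exists>x0\<in>hintv b. \<forall>x\<in>hintv b. \<forall>y\<in>hintv b. x0 \<le> x \<longrightarrow> x \<le> y \<longrightarrow> dist (S1 l x / C1 l x) (S1 l y / C1 l y) \<le> e"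
  proof (intro bexI[OF _ x0(1)] ballI impI)
    fix x y assume xy: "x \<in> hintv b" "y \<in> hintv b" "x0 \<le> x" "x \<le> y"
    have ge: "cmod om / e \<le> HC x" by (rule x0(2)[OF xy(1,3)])
    have pos: "0 < cmod om / e" using om_pos e by simp
    then have Hx: "0 < HC x" using ge by linarith
    have "cmod om / HC x \<le> e" using ge Hx e by (simp add: divide_le_eq mult.commute)
    then show "dist (S1 l x / C1 l x) (S1 l y / C1 l y) \<le> e"
      using quotient_le(1)[OF xy(1) Hx xy(2,4)] by (simp add: dist_norm)
  qed
qed

definition "q = q_TW b R R' l"

lemma quotient_tendsto: "((\<lambda>x. S1 l x / C1 l x) \<longlongrightarrow> q) (at_end b)"
proof -
  obtain L where L: "((\<lambda>x. S1 l x / C1 l x) \<longlongrightarrow> L) (at_end b)" using quotient_tendsto_ex by blast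
  then have "q = L" unfolding q_def q_TW_def by (rule tendsto_Lim[OF at_end_nonbot[OF A.b_pos]])
  then show ?thesis using L by simp
qed

lemma product_filterlim: "filterlim (\<lambda>x. C1 l x * C2 l x) at_infinity (at_end b)"
  unfolding filterlim_at_infinity[OF order.refl]
proof (intro allI impI)
  fix r :: real
  show "eventually (\<lambda>x. r \<le> cmod (C1 l x * C2 l x)) (at_end b)"
    using HC_eventually_ge[of "cmod om * r"]
  proof (rule eventually_mono)
    fix x assume "x \<in> hintv b \<and> cmod om * r \<le> HC x"
    then have "cmod om * r \<le> cmod om * (cmod (C1 l x) * cmod (C2 l x))" using HC_le[of x] by linarith
    then show "r \<le> cmod (C1 l x * C2 l x)" using om_pos by (simp add: norm_mult mult_le_cancel_left)
  qed
qed

lemma quotient2_tendsto: "((\<lambda>x. S2 l x / C2 l x) \<longlongrightarrow> q) (at_end b)"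
proof -
  have "((\<lambda>x. S1 l x / C1 l x + inverse (C1 l x * C2 l x)) \<longlongrightarrow> q + 0) (at_end b)"
    by (intro tendsto_add quotient_tendsto filterlim_compose[OF tendsto_inverse_0 product_filterlim])
  moreover have "eventually (\<lambda>x. S1 l x / C1 l x + inverse (C1 l x * C2 l x) = S2 l x / C2 l x) (at_end b)"
    using HC_eventually_ge[of 1]
  proof (rule eventually_mono)
    fix x assume x: "x \<in> hintv b \<and> 1 \<le> HC x"
    then have nz: "C1 l x \<noteq> 0" "C2 l x \<noteq> 0" using C_nonzero[of x] by auto
    have w: "C1 l x * S2 l x = 1 + S1 l x * C2 l x"
      using wronskian[of x l] x by (simp add: diff_eq_eq)
    have "S1 l x / C1 l x + inverse (C1 l x * C2 l x) = (1 + S1 l x * C2 l x) / (C1 l x * C2 l x)"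
      using nz by (simp add: field_simps)
    also have "\<dots> = S2 l x / C2 l x" unfolding w[symmetric] using nz by simp
    finally show "S1 l x / C1 l x + inverse (C1 l x * C2 l x) = S2 l x / C2 l x" .
  qed
  ultimately have "((\<lambda>x. S2 l x / C2 l x) \<longlongrightarrow> q + 0) (at_end b)"
    by (rule Lim_transform_eventually)
  then show ?thesis by simp
qed

text \<open>\<open>q\<close> lies in all the discs, being a limit of their points.\<close>

lemma H_psi:
  assumes x: "x \<in> hintv b"
  shows "H (\<lambda>t. S1 l t - q * C1 l t) (\<lambda>t. S2 l t - q * C2 l t) x \<le> 0"
proof -
  have main: "H (\<lambda>t. S1 l t - q * C1 l t) (\<lambda>t. S2 l t - q * C2 l t) y \<le> 0" if y: "y \<in> hintv b" "0 < HC y" for y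
  proof (rule tendsto_upperbound)
    show "((\<lambda>z. H (\<lambda>t. S1 l t - S1 l z / C1 l z * C1 l t) (\<lambda>t. S2 l t - S1 l z / C1 l z * C2 l t) y)
       \<longlongrightarrow> H (\<lambda>t. S1 l t - q * C1 l t) (\<lambda>t. S2 l t - q * C2 l t) y) (at_end b)"
      unfolding H_def by (intro tendsto_intros quotient_tendsto)
    show "eventually (\<lambda>z. H (\<lambda>t. S1 l t - S1 l z / C1 l z * C1 l t) (\<lambda>t. S2 l t - S1 l z / C1 l z * C2 l t) y \<le> 0) (at_end b)"
      using eventually_at_end_ge[OF y(1) A.b_pos] by (rule eventually_mono) (intro quotient_le(2)[OF y], auto)
  qed (rule at_end_nonbot[OF A.b_pos])
  obtain z where z: "z \<in> hintv b" "0 < HC z" using HC_pos by blast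
  define y where "y = max x z"
  have y: "y \<in> hintv b" "x \<le> y" "z \<le> y" using x z by (auto simp: y_def max_def)
  have "solution l (\<lambda>t. S1 l t - q * C1 l t) (\<lambda>t. S2 l t - q * C2 l t)"
    using solution_lincomb[OF solution_s solution_c, of l 1 "- q"] by simp
  from H_mono[OF this x y(1,2)] show ?thesis
    using main[OF y(1)] H_mono[OF solution_c z(1) y(1,3)] z(2) by linarith
qed

lemma psi_energy: "\<exists>K. \<forall>x\<in>hintv b. B.energy (\<lambda>t. S1 l t - q * C1 l t) x \<le> K"
proof -
  let ?v1 = "\<lambda>t. S1 l t - q * C1 l t" and ?v2 = "\<lambda>t. S2 l t - q * C2 l t"
  have v: "solution l ?v1 ?v2" using solution_lincomb[OF solution_s solution_c, of l 1 "- q"] by simp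
  have "B.energy ?v1 x \<le> - H ?v1 ?v2 0 / Re (- l * om)" if x: "x \<in> hintv b" for x
  proof -
    have "0 \<le> Re om * A.energy ?v2 x" using om1 A.energy_nonneg by simp
    then have "Re (- l * om) * B.energy ?v1 x \<le> - H ?v1 ?v2 0" using H_eq[OF v x] H_psi[OF x] by linarith
    then show ?thesis using om2 by (simp only: pos_le_divide_eq mult.commute)
  qed
  then show ?thesis by blast
qed

end

section \<open>The Neumann m-function of a singular system\<close>

lemma sq_int_cong_AE:
  assumes "f \<in> sq_int M" "g \<in> borel_measurable M" "AE x in M. g x = f x"
  shows "g \<in> sq_int M"
proof -
  have "integrable M (\<lambda>x. (cmod (g x))\<^sup>2) \<longleftrightarrow> integrable M (\<lambda>x. (cmod (f x))\<^sup>2)"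
    by (rule integrable_cong_AE) (use assms in \<open>auto simp: sq_int_def elim: eventually_mono\<close>)
  then show ?thesis using assms by (simp add: sq_int_def)
qed

lemma sq_int_scale: "f \<in> sq_int M \<Longrightarrow> (\<lambda>x. a * f x) \<in> sq_int M"
  by (auto simp: sq_int_def norm_mult power_mult_distrib)

lemma sq_int_add:
  assumes "f \<in> sq_int M" "g \<in> sq_int M" shows "(\<lambda>x. f x + g x) \<in> sq_int M"
proof -
  have m[measurable]: "f \<in> borel_measurable M" "g \<in> borel_measurable M" using assms by (auto simp: sq_int_def)
  have "integrable M (\<lambda>x. 2 * (cmod (f x))\<^sup>2 + 2 * (cmod (g x))\<^sup>2)"
    using assms by (auto simp: sq_int_def)
  then have "integrable M (\<lambda>x. (cmod (f x + g x))\<^sup>2)"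
  proof (rule Bochner_Integration.integrable_bound)
    have "(cmod (f x + g x))\<^sup>2 \<le> 2 * (cmod (f x))\<^sup>2 + 2 * (cmod (g x))\<^sup>2" for x
    proof -
      have "(cmod (f x + g x))\<^sup>2 \<le> (cmod (f x) + cmod (g x))\<^sup>2"
        by (intro power_mono norm_triangle_ineq) simp
      also have "\<dots> \<le> 2 * (cmod (f x))\<^sup>2 + 2 * (cmod (g x))\<^sup>2"
        using zero_le_power2[of "cmod (f x) - cmod (g x)"] by (simp add: power2_sum power2_diff)
      finally show ?thesis .
    qed
    then show "AE x in M. norm ((cmod (f x + g x))\<^sup>2) \<le> norm (2 * (cmod (f x))\<^sup>2 + 2 * (cmod (g x))\<^sup>2)"
      by (intro AE_I2) (smt (verit) real_norm_def zero_le_power2)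
  qed simp
  then show ?thesis by (simp add: sq_int_def)
qed

lemma L2_class_eqI: "(AE x in M. f x = g x) \<Longrightarrow> L2_class M f = L2_class M g"
  unfolding L2_class_def by (auto elim!: eventually_elim2)

lemma L2_class_self: "f \<in> sq_int M \<Longrightarrow> f \<in> L2_class M f"
  by (simp add: L2_class_def)

context stieltjes begin

lemma sq_int_of_energy:
  assumes h: "h \<in> borel_measurable (restrict_space borel (hintv b))" "locally_bounded h"
    and bd: "\<And>x. x \<in> hintv b \<Longrightarrow> energy h x \<le> K"
  shows "h \<in> sq_int M"
  unfolding sq_int_def using h(1) integrable_of_bounded[OF locally_integrable_norm_square[OF h], of K] bd
  by (simp add: measurable_M energy_def)

lemma energy_le_of_sq_int:
  assumes h: "h \<in> sq_int M" and x: "x \<in> hintv b"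
  shows "energy h x \<le> (LINT t|M. (cmod (h t))\<^sup>2)"
  unfolding energy_def set_lebesgue_integral_def
proof (rule Bochner_Integration.integral_mono)
  have i: "integrable M (\<lambda>t. (cmod (h t))\<^sup>2)" using h by (simp add: sq_int_def)
  then show "integrable M (\<lambda>t. (cmod (h t))\<^sup>2)" .
  show "integrable M (\<lambda>t. indicat_real {0..<x} t *\<^sub>R (cmod (h t))\<^sup>2)"
    using integrable_mult_indicator[OF Ico_sets[OF x, of 0] i] by simp
qed (auto simp: indicator_def)

lemma primitive_cong_AE:
  assumes F: "primitive F f" and g: "g \<in> borel_measurable M" and ae: "AE t in M. f t = g t"
  shows "primitive F g"
proof -
  have fm: "f \<in> borel_measurable M" by (rule locally_integrable_measurable[OF primitive_integrable[OF F]])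
  have *: "AE t in M. indicat_real {0..<x} t *\<^sub>R f t = indicat_real {0..<x} t *\<^sub>R g t" for x
    using ae by (rule eventually_mono) simp
  have 1: "set_integrable M {0..<x} f \<longleftrightarrow> set_integrable M {0..<x} g" if "x \<in> hintv b" for x
    unfolding set_integrable_def by (rule integrable_cong_AE) (use fm g * Ico_sets[OF that, of 0] in auto)
  have 2: "(LINT t:{0..<x}|M. f t) = (LINT t:{0..<x}|M. g t)" if "x \<in> hintv b" for x
    unfolding set_lebesgue_integral_def by (rule integral_cong_AE) (use fm g * Ico_sets[OF that, of 0] in auto)
  show ?thesis using F 1 2 unfolding primitive_def locally_integrable_def by simp
qed

end

context admissible_system begin

lemma solution_sq_int_iff:
  assumes u: "solution l u1 u2"
  shows "u1 \<in> sq_int B.M \<longleftrightarrow> (\<exists>K. \<forall>x\<in>hintv b. B.energy u1 x \<le> K)"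
  using B.sq_int_of_energy[OF solution_measurable(1,3)[OF u]] B.energy_le_of_sq_int[of u1] by blast

text \<open>The second entry of a pair in the relation determines \<open>f\<close> only almost everywhere, but the equation for \<open>u2\<close>
  sees \<open>f\<close> only up to null sets.\<close>

lemma ker_T_max_eq:
  "ker_T_max b R R' l = {L2_class B.M u1 | u1. u1 \<in> sq_int B.M \<and> (\<exists>u2. solution l u1 u2)}"
proof (intro equalityI subsetI)
  fix A assume "A \<in> ker_T_max b R R' l"
  then obtain u1 u2 f where A: "A = L2_class B.M u1" "L2_scale B.M l A = L2_class B.M f"
    and u: "u1 \<in> sq_int B.M" "f \<in> sq_int B.M" "solves b R R' f u1 u2"
    by (auto simp: ker_T_max_def T_max_def T_triples_def)
  have "f \<in> L2_scale B.M l A" using A(2) L2_class_self[OF u(2)] by simp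
  then obtain g where g: "g \<in> A" "AE x in B.M. f x = l * g x" by (auto simp: L2_scale_def)
  have "AE x in B.M. g x = u1 x" using g(1) A(1) by (simp add: L2_class_def)
  with g(2) have ae: "AE x in B.M. - f x = - l * u1 x" by (rule eventually_elim2) simp
  have p: "A.primitive u1 u2" "B.primitive u2 (\<lambda>x. - f x)" using u(3) by (auto simp: solves_iff_primitive)
  have "B.primitive u2 (\<lambda>x. - l * u1 x)"
  proof (rule B.primitive_cong_AE[OF p(2) _ ae])
    have "u1 \<in> borel_measurable B.M" using u(1) by (simp add: sq_int_def)
    then show "(\<lambda>x. - l * u1 x) \<in> borel_measurable B.M" by (intro borel_measurable_times borel_measurable_const)
  qed
  then have "solution l u1 u2" using p(1) by (simp add: solution_def)
  then show "A \<in> {L2_class B.M u1 | u1. u1 \<in> sq_int B.M \<and> (\<exists>u2. solution l u1 u2)}" using A(1) u(1) by blast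
next
  fix A assume "A \<in> {L2_class B.M u1 | u1. u1 \<in> sq_int B.M \<and> (\<exists>u2. solution l u1 u2)}"
  then obtain u1 u2 where A: "A = L2_class B.M u1" and u: "u1 \<in> sq_int B.M" "solution l u1 u2" by auto
  have lu: "(\<lambda>x. l * u1 x) \<in> sq_int B.M" by (rule sq_int_scale[OF u(1)])
  have "L2_scale B.M l A = L2_class B.M (\<lambda>x. l * u1 x)"
  proof (intro equalityI subsetI)
    fix g assume "g \<in> L2_scale B.M l A"
    then obtain h where g: "g \<in> sq_int B.M" "AE x in B.M. g x = l * h x" and "AE x in B.M. h x = u1 x"
      by (auto simp: L2_scale_def A L2_class_def)
    then have "AE x in B.M. g x = l * u1 x" by (auto elim: eventually_elim2)
    then show "g \<in> L2_class B.M (\<lambda>x. l * u1 x)" using g(1) by (simp add: L2_class_def)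
  next
    fix g assume "g \<in> L2_class B.M (\<lambda>x. l * u1 x)"
    then show "g \<in> L2_scale B.M l A" using L2_class_self[OF u(1)] by (auto simp: L2_scale_def A L2_class_def)
  qed
  moreover have "(u1, u2, \<lambda>x. l * u1 x) \<in> T_triples b R R'"
    using u lu by (simp add: T_triples_def solves_iff_solution)
  ultimately show "A \<in> ker_T_max b R R' l" unfolding ker_T_max_def T_max_def A by auto
qed

text \<open>If \<open>u1\<close> vanishes almost everywhere, then \<open>u2\<close> is constant and \<open>u1 = u1 0 + u2 0 * R\<close>.\<close>

lemma solution_AE_zero:
  assumes indep: "\<And>a1 a2 :: complex. (AE x in B.M. a1 + a2 * of_real (R x) = 0) \<Longrightarrow> a1 = 0 \<and> a2 = 0"
    and u: "solution l u1 u2" and ae: "AE x in B.M. u1 x = 0"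
  shows "u1 0 = 0 \<and> u2 0 = 0"
proof -
  have pB: "B.primitive u2 (\<lambda>x. - l * u1 x)" and pA: "A.primitive u1 u2" using u by (auto simp: solution_def)
  have "B.primitive u2 (\<lambda>x. 0)"
    by (rule B.primitive_cong_AE[OF pB]) (use ae in \<open>auto elim: eventually_mono\<close>)
  then have u2: "u2 x = u2 0" if "x \<in> hintv b" for x
    using B.primitive_eq[of u2 "\<lambda>x. 0" x] that by simp
  have u1: "u1 x = u1 0 + u2 0 * of_real (R x)" if x: "x \<in> hintv b" for x
  proof -
    have "(LINT t:{0..<x}|A.M. u2 t) = (LINT t:{0..<x}|A.M. u2 0)"
      unfolding set_lebesgue_integral_def
    proof (rule Bochner_Integration.integral_cong[OF refl])
      fix t assume "t \<in> space A.M"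
      then show "indicat_real {0..<x} t *\<^sub>R u2 t = indicat_real {0..<x} t *\<^sub>R u2 0"
        using u2[of t] by (simp add: A.space_M)
    qed
    then show ?thesis
      using A.primitive_eq[OF pA x] A.integral_const_Ico[OF A.zero_in x hintv_nonneg[OF x], of "u2 0"] A.R_zero
      by (simp add: scaleR_conv_of_real mult.commute)
  qed
  have "AE x in B.M. u1 0 + u2 0 * of_real (R x) = 0"
    using ae
  proof (rule AE_mp, intro AE_I2 impI)
    fix x assume "x \<in> space B.M" "u1 x = 0"
    then show "u1 0 + u2 0 * of_real (R x) = 0" using u1[of x] by (simp add: B.space_M)
  qed
  then show ?thesis by (rule indep)
qed

end

context singular_system begin

text \<open>In the basis \<open>s - q * c\<close>, \<open>c\<close>, whose first member is always square integrable.\<close>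

lemma solution_combination:
  assumes u: "solution l u1 u2"
  shows "AE x in B.M. u1 x = u2 0 * (S1 l x - q * C1 l x) + (u1 0 + q * u2 0) * C1 l x"
  by (rule AE_I2) (use solution_eq(1)[OF u] in \<open>simp add: B.space_M algebra_simps\<close>)

lemma solution_psi: "solution l (\<lambda>t. S1 l t - q * C1 l t) (\<lambda>t. S2 l t - q * C2 l t)"
  using solution_lincomb[OF solution_s solution_c, of l 1 "- q"] by simp

lemma psi_sq_int: "(\<lambda>t. S1 l t - q * C1 l t) \<in> sq_int B.M"
  using psi_energy by (simp add: solution_sq_int_iff[OF solution_psi])

lemma energy_A_unbounded:
  assumes C1: "C1 l \<in> sq_int B.M"
  shows "\<exists>x0\<in>hintv b. \<forall>x\<in>hintv b. x0 \<le> x \<longrightarrow> K \<le> A.energy (C2 l) x"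
proof -
  obtain E where E: "\<And>x. x \<in> hintv b \<Longrightarrow> B.energy (C1 l) x \<le> E" using C1 unfolding solution_sq_int_iff[OF solution_c] by blast
  obtain x0 where x0: "x0 \<in> hintv b" "\<And>x. x \<in> hintv b \<Longrightarrow> x0 \<le> x \<Longrightarrow> Re (- l * om) * E + Re om * K \<le> HC x"
    using HC_unbounded[OF unbdd, of "Re (- l * om) * E + Re om * K"] by blast
  have "K \<le> A.energy (C2 l) x" if x: "x \<in> hintv b" "x0 \<le> x" for x
  proof -
    have "Re (- l * om) * B.energy (C1 l) x \<le> Re (- l * om) * E"
      using E[OF x(1)] om2 by (intro mult_left_mono) auto
    then have "Re om * K \<le> Re om * A.energy (C2 l) x"
      using x0(2)[OF x] H_eq[OF solution_c x(1)] HC_zero by linarith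
    then show ?thesis using om1 by (simp add: mult_le_cancel_left)
  qed
  then show ?thesis using x0(1) by blast
qed

text \<open>As \<open>H c\<close> tends to infinity and the energy of \<open>c1\<close> is finite, the energy of \<open>c2\<close> dominates in Green's identity, so
that \<open>Re (c2 * cnj c1)\<close> is eventually nonnegative. Up to the contribution of the jumps, which is nonnegative,
twice this is the density of \<open>d \<bar>c1\<bar>\<^sup>2\<close>.\<close>

lemma C1_eventually_mono:
  assumes C1: "C1 l \<in> sq_int B.M"
  shows "\<exists>x0\<in>hintv b. C1 l x0 \<noteq> 0 \<and> (\<forall>x\<in>hintv b. \<forall>y\<in>hintv b. x0 \<le> x \<longrightarrow> x \<le> y \<longrightarrow> cmod (C1 l x) \<le> cmod (C1 l y))"
proof -
  interpret AA: stieltjes_pair b R R by unfold_locales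
  obtain E where E: "\<And>x. x \<in> hintv b \<Longrightarrow> B.energy (C1 l) x \<le> E" using C1 unfolding solution_sq_int_iff[OF solution_c] by blast
  obtain z where z: "z \<in> hintv b" "\<And>x. x \<in> hintv b \<Longrightarrow> z \<le> x \<Longrightarrow> \<bar>Re l\<bar> * E \<le> A.energy (C2 l) x"
    using energy_A_unbounded[OF C1] by blast
  obtain z' where z': "z' \<in> hintv b" "0 < HC z'" using HC_pos by blast
  define x0 where "x0 = max z z'"
  have x0: "x0 \<in> hintv b" "z \<le> x0" "z' \<le> x0" using z z' by (auto simp: x0_def max_def)
  have re: "0 \<le> Re (C2 l t * cnj (C1 l t))" if t: "t \<in> hintv b" "x0 \<le> t" for t
  proof -
    have "Re l * B.energy (C1 l) t \<le> \<bar>Re l\<bar> * E"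
      using E[OF t(1)] B.energy_nonneg[of "C1 l" t] by (intro mult_mono) auto
    then have "Re l * B.energy (C1 l) t \<le> A.energy (C2 l) t" using z(2)[OF t(1)] t(2) x0 by linarith
    then show ?thesis unfolding green[OF solution_c t(1)] by (simp add: c_init)
  qed
  have pC: "A.primitive (C1 l) (C2 l)" using solution_c[of l] by (simp add: solution_def)
  have pC': "A.primitive (\<lambda>x. cnj (C1 l x)) (\<lambda>x. cnj (C2 l x))" by (rule A.primitive_cnj[OF pC])
  note m = solution_measurable[OF solution_c[of l]]
  have li: "A.locally_integrable (\<lambda>t. C2 l t * cnj (C1 l t))"
    by (rule A.locally_integrable_mult[OF A.primitive_integrable[OF pC] A.borel_measurable_primitive[OF pC'] A.primitive_bounded[OF pC']])
  define r where "r t = Re (C2 l t * cnj (C1 l t))" for t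
  have lir: "A.locally_integrable r"
    unfolding A.locally_integrable_def
  proof
    fix x assume "x \<in> hintv b"
    then have "integrable A.M (\<lambda>t. Re (indicat_real {0..<x} t *\<^sub>R (C2 l t * cnj (C1 l t))))"
      using A.locally_integrableD[OF li] unfolding set_integrable_def by (intro integrable_Re) auto
    then show "set_integrable A.M {0..<x} r" by (simp add: set_integrable_def r_def[abs_def])
  qed
  \<comment> \<open>the density of the jump contribution\<close>
  define w where "w t = (cmod (C2 l t))\<^sup>2 * measure A.M {t}" for t
  have intr: "(LINT t:{0..<x}|A.M. r t) = Re (LINT t:{0..<x}|A.M. C2 l t * cnj (C1 l t))" if x: "x \<in> hintv b" for x
  proof -
    have "(LINT t:{0..<x}|A.M. r t) = (LINT t|A.M. Re (indicat_real {0..<x} t *\<^sub>R (C2 l t * cnj (C1 l t))))"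
      by (simp add: set_lebesgue_integral_def r_def)
    also have "\<dots> = Re (LINT t:{0..<x}|A.M. C2 l t * cnj (C1 l t))"
      unfolding set_lebesgue_integral_def
      by (rule integral_Re) (use A.locally_integrableD[OF li x] in \<open>simp add: set_integrable_def\<close>)
    finally show ?thesis .
  qed
  have sq: "(cmod (C1 l x))\<^sup>2 = 1 + 2 * (LINT t:{0..<x}|A.M. r t) + (LINT t:{0..<x}|A.M. w t)" if x: "x \<in> hintv b" for x
  proof -
    have "C1 l x * cnj (C1 l x) = C1 l 0 * cnj (C1 l 0) + (LINT t:{0..<x}|A.M. C2 l t * cnj (C1 l t))
       + (LINT t:{0..<x}|A.M. C1 l t * cnj (C2 l t)) + (LINT t:{0..<x}|A.M. C2 l t * cnj (C2 l t) * of_real (measure A.M {t}))"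
      by (rule AA.product_rule_diag[OF pC pC' x])
    moreover have "(LINT t:{0..<x}|A.M. C1 l t * cnj (C2 l t)) = cnj (LINT t:{0..<x}|A.M. C2 l t * cnj (C1 l t))"
      unfolding set_lebesgue_integral_def Bochner_Integration.integral_cnj[symmetric]
      by (rule Bochner_Integration.integral_cong[OF refl]) (simp add: mult.commute)
    moreover have "(LINT t:{0..<x}|A.M. C2 l t * cnj (C2 l t) * of_real (measure A.M {t})) = of_real (LINT t:{0..<x}|A.M. w t)"
      unfolding set_lebesgue_integral_def integral_complex_of_real[symmetric]
      by (rule Bochner_Integration.integral_cong[OF refl])
         (simp add: w_def complex_norm_square[symmetric] indicator_def del: of_real_power)
    ultimately have "C1 l x * cnj (C1 l x) = 1 + (LINT t:{0..<x}|A.M. C2 l t * cnj (C1 l t))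
       + cnj (LINT t:{0..<x}|A.M. C2 l t * cnj (C1 l t)) + of_real (LINT t:{0..<x}|A.M. w t)"
      by (simp add: c_init)
    then have "Re (C1 l x * cnj (C1 l x)) = 1 + 2 * Re (LINT t:{0..<x}|A.M. C2 l t * cnj (C1 l t)) + (LINT t:{0..<x}|A.M. w t)"
      by simp
    moreover have "Re (C1 l x * cnj (C1 l x)) = (cmod (C1 l x))\<^sup>2"
      unfolding complex_norm_square[symmetric] by simp
    ultimately show ?thesis using intr[OF x] by simp
  qed
  have wi: "A.locally_integrable w"
    unfolding A.locally_integrable_def
  proof
    fix x assume x: "x \<in> hintv b"
    obtain C where C: "\<And>t. 0 \<le> t \<Longrightarrow> t \<le> x \<Longrightarrow> cmod (C2 l t) \<le> C"
      using m(4) x unfolding A.locally_bounded_def by blast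
    show "set_integrable A.M {0..<x} w"
    proof (rule A.set_integrable_bounded[where C = "C\<^sup>2 * R x"])
      have "C2 l \<in> borel_measurable A.M" using m(2) by (simp add: A.measurable_M)
      then show "w \<in> borel_measurable A.M" unfolding w_def[abs_def] using AA.singleton_measurable by simp
      fix t assume t: "0 \<le> t" "t < x"
      have th: "t \<in> hintv b" using hintv_mono[OF x] t by simp
      have "measure A.M {t} \<le> measure A.M {0..<x}"
        using t A.Ico_sets[OF x, of 0] A.emeasure_Ico_finite[OF x]
        by (intro measure_mono_fmeasurable) (auto simp: fmeasurable_def A.singleton_sets[OF th])
      also have "\<dots> = R x" using A.measure_Ico[OF A.zero_in x hintv_nonneg[OF x]] A.R_zero by simp
      finally have "w t \<le> C\<^sup>2 * R x"
        unfolding w_def using C[of t] t by (intro mult_mono power_mono) auto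
      then show "norm (w t) \<le> C\<^sup>2 * R x" by (simp add: w_def)
    qed (rule x)
  qed
  have mono: "cmod (C1 l x) \<le> cmod (C1 l y)" if xy: "x \<in> hintv b" "y \<in> hintv b" "x0 \<le> x" "x \<le> y" for x y
  proof -
    have "(LINT t:{0..<x}|A.M. r t) \<le> (LINT t:{0..<y}|A.M. r t)"
      using A.integral_split[OF lir xy(1,2,4)] A.integral_nonneg_Ico[of x y r] re xy hintv_mono[OF xy(2)] hintv_nonneg[OF xy(1)]
      by (simp add: r_def)
    moreover have "(LINT t:{0..<x}|A.M. w t) \<le> (LINT t:{0..<y}|A.M. w t)"
      using A.integral_split[OF wi xy(1,2,4)] A.integral_nonneg_Ico[of x y w] by (simp add: w_def)
    ultimately have "(cmod (C1 l x))\<^sup>2 \<le> (cmod (C1 l y))\<^sup>2" using sq[OF xy(1)] sq[OF xy(2)] by linarith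
    then show ?thesis by (rule power2_le_imp_le) simp
  qed
  have "C1 l x0 \<noteq> 0" using C_nonzero[of x0] H_mono[OF solution_c z'(1) x0(1,3)] z'(2) by auto
  then show ?thesis using x0(1) mono by blast
qed

text \<open>Eventually \<open>\<bar>c1\<bar>\<close> is nondecreasing. Beyond such a point \<open>x\<close>, therefore, \<open>\<bar>c1 t\<bar> \<le> \<bar>c1 t\<bar>\<^sup>2 / \<bar>c1 x\<bar>\<close>, and
the increment of \<open>c2\<close> after \<open>x\<close> is at most \<open>\<bar>l\<bar>\<close> times the remaining energy of \<open>c1\<close> divided by \<open>\<bar>c1 x\<bar>\<close>. So \<open>c2\<close> converges, and a limit
\<open>0\<close> would keep \<open>c1 * c2\<close> bounded.\<close>

lemma C2_limit:
  assumes C1: "C1 l \<in> sq_int B.M"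
  shows "\<exists>L. (C2 l \<longlongrightarrow> L) (at_end b) \<and> L \<noteq> 0"
proof -
  note m = solution_measurable[OF solution_c[of l]]
  obtain E where E: "\<And>x. x \<in> hintv b \<Longrightarrow> B.energy (C1 l) x \<le> E" using C1 unfolding solution_sq_int_iff[OF solution_c] by blast
  obtain x0 where x0: "x0 \<in> hintv b" "C1 l x0 \<noteq> 0"
    and mono: "\<And>x y. x \<in> hintv b \<Longrightarrow> y \<in> hintv b \<Longrightarrow> x0 \<le> x \<Longrightarrow> x \<le> y \<Longrightarrow> cmod (C1 l x) \<le> cmod (C1 l y)"
    using C1_eventually_mono[OF C1] by blast
  have pos: "0 < cmod (C1 l x)" if "x \<in> hintv b" "x0 \<le> x" for x
    using mono[OF x0(1) that(1) order.refl that(2)] x0(2) by (metis norm_le_zero_iff not_le order_trans)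
  have pB: "B.primitive (C2 l) (\<lambda>t. - l * C1 l t)" using solution_c[of l] by (simp add: solution_def)
  have est: "cmod (C2 l y - C2 l x) \<le> cmod l * (B.energy (C1 l) y - B.energy (C1 l) x) / cmod (C1 l x)"
    if xy: "x \<in> hintv b" "y \<in> hintv b" "x0 \<le> x" "x \<le> y" for x y
  proof -
    have "cmod (C2 l y - C2 l x) = cmod (LINT t:{x..<y}|B.M. - l * C1 l t)"
      using B.primitive_diff[OF pB xy(1,2,4)] by simp
    also have "\<dots> \<le> (LINT t:{x..<y}|B.M. (cmod l / cmod (C1 l x)) * (cmod (C1 l t))\<^sup>2)"
    proof (rule B.norm_integral_le[OF B.primitive_integrable[OF pB] _ xy(1,2)])
      show "B.locally_integrable (\<lambda>t. (cmod l / cmod (C1 l x)) * (cmod (C1 l t))\<^sup>2)"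
        by (intro B.locally_integrable_scale B.locally_integrable_norm_square m(1,3))
      fix t assume t: "x \<le> t" "t < y"
      have th: "t \<in> hintv b" using hintv_mono[OF xy(2)] hintv_nonneg[OF xy(1)] t by simp
      have "cmod (C1 l x) * (cmod l * cmod (C1 l t)) \<le> cmod (C1 l t) * (cmod l * cmod (C1 l t))"
        by (rule mult_right_mono[OF mono[OF xy(1) th xy(3) t(1)]]) simp
      then show "cmod (- l * C1 l t) \<le> (cmod l / cmod (C1 l x)) * (cmod (C1 l t))\<^sup>2"
        using pos[OF xy(1,3)] by (simp add: norm_mult field_simps power2_eq_square)
    qed
    also have "\<dots> = cmod l * (B.energy (C1 l) y - B.energy (C1 l) x) / cmod (C1 l x)"
      unfolding B.energy_diff[OF m(1,3) xy(1,2,4)] by simp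
    finally show ?thesis .
  qed
  have bdd: "bdd_above (B.energy (C1 l) ` hintv b)" using E by (intro bdd_aboveI2[of _ _ E])
  define W where "W = (SUP x\<in>hintv b. B.energy (C1 l) x)"
  have W: "B.energy (C1 l) x \<le> W" if "x \<in> hintv b" for x unfolding W_def by (rule cSUP_upper[OF that bdd])
  obtain L where L: "(C2 l \<longlongrightarrow> L) (at_end b)"
  proof -
    have "\<exists>L. (C2 l \<longlongrightarrow> L) (at_end b)"
    proof (rule Cauchy_at_end[OF A.b_pos])
      fix e :: real assume e: "0 < e"
      \<comment> \<open>an energy increment of \<open>d\<close> moves \<open>c2\<close> by at most \<open>e\<close>; the \<open>+ 1\<close> keeps the divisor positive\<close>
      define d where "d = e * cmod (C1 l x0) / (cmod l + 1)"
      have d: "0 < d" using e x0(2) by (simp add: d_def add_nonneg_pos)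
      have "W - d < W" using d by simp
      moreover have "hintv b \<noteq> {}" using A.zero_in by blast
      ultimately have "\<exists>z\<in>hintv b. W - d < B.energy (C1 l) z"
        unfolding W_def using less_cSUP_iff[OF _ bdd, THEN iffD1] by blast
      then obtain z where z: "z \<in> hintv b" "W - d < B.energy (C1 l) z" ..
      define x1 where "x1 = max x0 z"
      have x1: "x1 \<in> hintv b" "x0 \<le> x1" "z \<le> x1" using x0 z by (auto simp: x1_def max_def)
      show "\<exists>x0\<in>hintv b. \<forall>x\<in>hintv b. \<forall>y\<in>hintv b. x0 \<le> x \<longrightarrow> x \<le> y \<longrightarrow> dist (C2 l x) (C2 l y) \<le> e"
      proof (intro bexI[OF _ x1(1)] ballI impI)
        fix x y assume xy: "x \<in> hintv b" "y \<in> hintv b" "x1 \<le> x" "x \<le> y"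
        have x0x: "x0 \<le> x" "z \<le> x" using x1 xy by auto
        have inc: "B.energy (C1 l) y - B.energy (C1 l) x \<le> d"
          using W[OF xy(2)] z(2) B.energy_mono[OF m(1,3) z(1) xy(1) x0x(2)] by linarith
        have inc0: "0 \<le> B.energy (C1 l) y - B.energy (C1 l) x"
          using B.energy_mono[OF m(1,3) xy(1,2,4)] by simp
        have "cmod (C2 l y - C2 l x) \<le> cmod l * (B.energy (C1 l) y - B.energy (C1 l) x) / cmod (C1 l x)"
          by (rule est[OF xy(1,2) x0x(1) xy(4)])
        also have "\<dots> \<le> (cmod l + 1) * d / cmod (C1 l x0)"
          using inc inc0 mono[OF x0(1) xy(1) order.refl x0x(1)] x0(2) d
          by (intro frac_le mult_mono) auto
        also have "\<dots> = e" using x0(2) norm_ge_zero[of l] unfolding d_def by (simp add: add_nonneg_eq_0_iff field_simps)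
        finally show "dist (C2 l x) (C2 l y) \<le> e" by (simp add: dist_norm norm_minus_commute)
      qed
    qed
    then show thesis using that by blast
  qed
  have "L \<noteq> 0"
  proof
    assume L0: "L = 0"
    have up: "cmod (C1 l x * C2 l x) \<le> cmod l * W" if x: "x \<in> hintv b" "x0 \<le> x" for x
    proof -
      have "((\<lambda>y. cmod (C2 l y - C2 l x)) \<longlongrightarrow> cmod (L - C2 l x)) (at_end b)"
        by (intro tendsto_intros L)
      moreover have "eventually (\<lambda>y. cmod (C2 l y - C2 l x) \<le> cmod l * W / cmod (C1 l x)) (at_end b)"
        using eventually_at_end_ge[OF x(1) A.b_pos]
      proof (rule eventually_mono)
        fix y assume y: "y \<in> hintv b \<and> x < y"
        have "cmod (C2 l y - C2 l x) \<le> cmod l * (B.energy (C1 l) y - B.energy (C1 l) x) / cmod (C1 l x)"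
          using est[OF x(1) _ x(2), of y] y by simp
        also have "\<dots> \<le> cmod l * W / cmod (C1 l x)"
          using W[of y] y B.energy_nonneg[of "C1 l" x] by (intro divide_right_mono mult_left_mono) auto
        finally show "cmod (C2 l y - C2 l x) \<le> cmod l * W / cmod (C1 l x)" .
      qed
      ultimately have "cmod (L - C2 l x) \<le> cmod l * W / cmod (C1 l x)"
        by (rule tendsto_upperbound) (rule at_end_nonbot[OF A.b_pos])
      then have "cmod (C2 l x) \<le> cmod l * W / cmod (C1 l x)" by (simp add: L0)
      then show ?thesis using pos[OF x] by (simp add: norm_mult pos_le_divide_eq mult.commute)
    qed
    have "eventually (\<lambda>x. cmod l * W + 1 \<le> cmod (C1 l x * C2 l x)) (at_end b)"
    proof -
      have "0 \<le> W" using W[OF A.zero_in] B.energy_nonneg[of "C1 l" 0] by linarith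
      then have "0 < cmod l * W + 1" using mult_nonneg_nonneg[OF norm_ge_zero[of l], of W] by linarith
      with product_filterlim show ?thesis unfolding filterlim_at_infinity[OF order.refl] by blast
    qed
    moreover have "eventually (\<lambda>x. cmod (C1 l x * C2 l x) \<le> cmod l * W) (at_end b)"
      using eventually_at_end_ge[OF x0(1) A.b_pos] by (rule eventually_mono) (use up in auto)
    ultimately have "eventually (\<lambda>x. False) (at_end b)"
      by (rule eventually_elim2) simp
    then show False using at_end_nonbot[OF A.b_pos] by (simp add: eventually_False)
  qed
  then show ?thesis using L by blast
qed

text \<open>If \<open>c1\<close> is square integrable, so is every solution, and the kernel is two-dimensional. If not, the square
integrable solutions are the multiples of \<open>s - q * c\<close>. Independence of \<open>1\<close> and \<open>R\<close> in \<open>L2\<close> enters only in that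
independent solutions have independent classes.\<close>

lemma m_N_eq_q:
  assumes indep: "\<And>a1 a2 :: complex. (AE x in B.M. a1 + a2 * of_real (R x) = 0) \<Longrightarrow> a1 = 0 \<and> a2 = 0"
  shows "m_N b R R' l = q"
proof (cases "C1 l \<in> sq_int B.M")
  case True
  have S1: "S1 l \<in> sq_int B.M"
    using sq_int_add[OF psi_sq_int sq_int_scale[OF True, of q]] by simp
  let ?f = "\<lambda>i::nat. if i = 0 then C1 l else S1 l"
  have sum: "(\<Sum>i<2. a i * ?f i x) = a 0 * C1 l x + a 1 * S1 l x" for a x
    by (simp add: numeral_2_eq_2)
  have "limit_circle b R R' l"
    unfolding limit_circle_def L2_has_dim_def
  proof (intro exI[of _ ?f] conjI allI impI ballI)
    fix i :: nat
    show "?f i \<in> sq_int B.M" using True S1 by simp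
    show "L2_class B.M (?f i) \<in> ker_T_max b R R' l"
      unfolding ker_T_max_eq using True S1 solution_c[of l] solution_s[of l] by (cases "i = 0") auto
  next
    fix a :: "nat \<Rightarrow> complex" and i :: nat
    assume ae: "AE x in B.M. (\<Sum>i<2. a i * ?f i x) = 0" and i: "i < 2"
    have "a 0 * C1 l 0 + a 1 * S1 l 0 = 0 \<and> a 0 * C2 l 0 + a 1 * S2 l 0 = 0"
      by (rule solution_AE_zero[OF indep solution_lincomb[OF solution_c solution_s]]) (use ae in \<open>unfold sum\<close>)
    then have "a 0 = 0" "a 1 = 0" by (simp_all add: c_init s_init)
    then show "a i = 0" using i by (cases i) (auto simp: less_Suc_eq numeral_2_eq_2)
  next
    fix A assume "A \<in> ker_T_max b R R' l"
    then obtain u1 u2 where A: "A = L2_class B.M u1" and u: "solution l u1 u2" unfolding ker_T_max_eq by blast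
    have "AE x in B.M. u1 x = u1 0 * C1 l x + u2 0 * S1 l x"
      by (rule AE_I2) (use solution_eq(1)[OF u] in \<open>simp add: B.space_M\<close>)
    then have "A = L2_class B.M (\<lambda>x. \<Sum>i<2. (if i = 0 then u1 0 else u2 0) * ?f i x)"
      unfolding A by (intro L2_class_eqI) (simp add: numeral_2_eq_2)
    then show "\<exists>a. A = L2_class B.M (\<lambda>x. \<Sum>i<2. a i * ?f i x)" 
      by (intro exI[of _ "\<lambda>i. if i = 0 then u1 0 else u2 0"])
  qed
  moreover obtain L where L: "(C2 l \<longlongrightarrow> L) (at_end b)" "L \<noteq> 0" using C2_limit[OF True] by blast
  moreover have "(S2 l \<longlongrightarrow> q * L) (at_end b)"
  proof -
    have "((\<lambda>x. S2 l x / C2 l x * C2 l x) \<longlongrightarrow> q * L) (at_end b)" by (intro tendsto_mult quotient2_tendsto L)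
    moreover have "eventually (\<lambda>x. S2 l x / C2 l x * C2 l x = S2 l x) (at_end b)"
      using HC_eventually_ge[of 1]
    proof (rule eventually_mono)
      fix x assume "x \<in> hintv b \<and> 1 \<le> HC x"
      then have "C2 l x \<noteq> 0" using C_nonzero[of x] by auto
      then show "S2 l x / C2 l x * C2 l x = S2 l x" by simp
    qed
    ultimately show ?thesis by (rule Lim_transform_eventually)
  qed
  ultimately show ?thesis
    using tendsto_Lim[OF at_end_nonbot[OF A.b_pos], of "C2 l" L] tendsto_Lim[OF at_end_nonbot[OF A.b_pos], of "S2 l" "q * L"]
    by (simp add: m_N_def)
next
  case False
  let ?p = "\<lambda>t. S1 l t - q * C1 l t"
  have c_zero: "c = 0" if "(\<lambda>x. c * C1 l x) \<in> sq_int B.M" for c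
  proof (rule ccontr)
    assume "c \<noteq> 0"
    have "(\<lambda>x. inverse c * (c * C1 l x)) \<in> sq_int B.M" by (rule sq_int_scale[OF that])
    moreover have "(\<lambda>x. inverse c * (c * C1 l x)) = C1 l"
      by (rule ext) (use \<open>c \<noteq> 0\<close> in \<open>simp add: field_simps\<close>)
    ultimately have "C1 l \<in> sq_int B.M" by simp
    then show False using False by simp
  qed
  have multiple: "AE x in B.M. u1 x = u2 0 * ?p x" if u: "solution l u1 u2" "u1 \<in> sq_int B.M" for u1 u2
  proof -
    have "(\<lambda>x. u1 x + (- u2 0) * ?p x) \<in> sq_int B.M" by (intro sq_int_add sq_int_scale u psi_sq_int)
    moreover have cm: "(\<lambda>x. (u1 0 + q * u2 0) * C1 l x) \<in> borel_measurable B.M"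
      using solution_measurable(1)[OF solution_c[of l]] by (simp add: B.measurable_M)
    moreover have "AE x in B.M. (u1 0 + q * u2 0) * C1 l x = u1 x + (- u2 0) * ?p x"
      using solution_combination[OF u(1)] by (rule eventually_mono) simp
    ultimately have "(\<lambda>x. (u1 0 + q * u2 0) * C1 l x) \<in> sq_int B.M" by (rule sq_int_cong_AE)
    then have "u1 0 + q * u2 0 = 0" by (rule c_zero)
    then show ?thesis using solution_combination[OF u(1)] by simp
  qed
  have lp: "limit_point b R R' l"
    unfolding limit_point_def L2_has_dim_def
  proof (intro exI[of _ "\<lambda>_. ?p"] conjI allI impI ballI)
    show "?p \<in> sq_int B.M" by (rule psi_sq_int)
    show "L2_class B.M ?p \<in> ker_T_max b R R' l" unfolding ker_T_max_eq using psi_sq_int solution_psi by blast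
  next
    fix a :: "nat \<Rightarrow> complex" and i :: nat
    assume ae: "AE x in B.M. (\<Sum>i<1. a i * ?p x) = 0" and i: "i < 1"
    have sa: "solution l (\<lambda>x. a 0 * ?p x + 0 * ?p x) (\<lambda>x. a 0 * (S2 l x - q * C2 l x) + 0 * (S2 l x - q * C2 l x))"
      by (rule solution_lincomb[OF solution_psi solution_psi])
    have "AE x in B.M. a 0 * ?p x + 0 * ?p x = 0"
      using ae by (rule eventually_mono) simp
    from solution_AE_zero[OF indep sa this]
    have "a 0 * (S2 l 0 - q * C2 l 0) + 0 * (S2 l 0 - q * C2 l 0) = 0" by (rule conjunct2)
    then show "a i = 0" using i by (simp add: c_init s_init)
  next
    fix A assume "A \<in> ker_T_max b R R' l"
    then obtain u1 u2 where A: "A = L2_class B.M u1" and u: "u1 \<in> sq_int B.M" "solution l u1 u2" unfolding ker_T_max_eq by blast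
    have "A = L2_class B.M (\<lambda>x. \<Sum>i<(1::nat). u2 0 * ?p x)"
      unfolding A using multiple[OF u(2,1)] by (intro L2_class_eqI) simp
    then show "\<exists>a :: nat \<Rightarrow> complex. A = L2_class B.M (\<lambda>x. \<Sum>i<1. a i * ?p x)" by (intro exI[of _ "\<lambda>_. u2 0"])
  qed
  have nlc: "\<not> limit_circle b R R' l"
  proof
    assume "limit_circle b R R' l"
    then obtain f :: "nat \<Rightarrow> real \<Rightarrow> complex" where F: "\<forall>i<2. f i \<in> sq_int B.M \<and> L2_class B.M (f i) \<in> ker_T_max b R R' l"
      and G: "\<forall>a. (AE x in B.M. (\<Sum>i<2. a i * f i x) = 0) \<longrightarrow> (\<forall>i<2. a i = (0 :: complex))"
      unfolding limit_circle_def L2_has_dim_def by (elim exE conjE) (rule that)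
    note f = F[rule_format] and ind = G[rule_format]
    have mult: "\<exists>c. AE x in B.M. f i x = c * ?p x" if i: "i < 2" for i :: nat
    proof -
      obtain u1 u2 where A: "L2_class B.M (f i) = L2_class B.M u1" and u: "u1 \<in> sq_int B.M" "solution l u1 u2"
        using f[OF i] unfolding ker_T_max_eq by blast
      have "f i \<in> L2_class B.M u1" using L2_class_self f[OF i] A by blast
      then have "AE x in B.M. f i x = u1 x" by (simp add: L2_class_def)
      with multiple[OF u(2,1)] have "AE x in B.M. f i x = u2 0 * ?p x" by (auto elim: eventually_elim2)
      then show ?thesis by blast
    qed
    obtain c0 c1 where c: "AE x in B.M. f 0 x = c0 * ?p x" "AE x in B.M. f 1 x = c1 * ?p x"
      using mult[of 0] mult[of 1] by auto
    have sum: "(\<Sum>i<2. a i * f i x) = a 0 * f 0 x + a 1 * f 1 x" for a x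
      by (simp add: numeral_2_eq_2)
    have "AE x in B.M. (\<Sum>i<2. (if i = 0 then c1 else - c0) * f i x) = 0"
      unfolding sum using c
    proof (rule eventually_elim2)
      fix x assume e: "f 0 x = c0 * ?p x" "f 1 x = c1 * ?p x"
      show "(if (0::nat) = 0 then c1 else - c0) * f 0 x + (if (1::nat) = 0 then c1 else - c0) * f 1 x = 0"
        unfolding e by simp
    qed
    then have "c1 = 0" "c0 = 0"
      using ind[of "\<lambda>i. if i = 0 then c1 else - c0" 0] ind[of "\<lambda>i. if i = 0 then c1 else - c0" 1] by simp_all
    then have "AE x in B.M. (\<Sum>i<2. 1 * f i x) = 0"
      unfolding sum using c by (auto elim: eventually_elim2)
    then show False using ind[of "\<lambda>_. 1" 0] by simp
  qed
  have "(THE m. (\<lambda>x. S1 l x - m * C1 l x) \<in> sq_int B.M) = q"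
  proof (rule the_equality)
    show "?p \<in> sq_int B.M" by (rule psi_sq_int)
    fix m assume "(\<lambda>x. S1 l x - m * C1 l x) \<in> sq_int B.M"
    then have "(\<lambda>x. (S1 l x - m * C1 l x) + (-1) * ?p x) \<in> sq_int B.M"
      by (intro sq_int_add sq_int_scale psi_sq_int)
    then have "(\<lambda>x. (q - m) * C1 l x) \<in> sq_int B.M" by (simp add: algebra_simps)
    then have "q - m = 0" by (rule c_zero)
    then show "m = q" by simp
  qed
  then show ?thesis using lp nlc by (simp add: m_N_def)
qed

end

section \<open>Regularity, continuation and the duality theorem\<close>

lemma end_val_eq_SUP:
  assumes "0 < b" "dist_fun b R"
  shows "end_val b R = (SUP x\<in>hintv b. ereal (R x))"
proof -
  have "((\<lambda>x. ereal (R x)) \<longlongrightarrow> (SUP x\<in>hintv b. ereal (R x))) (at_end b)"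
  proof (rule increasing_tendsto)
    show "eventually (\<lambda>x. ereal (R x) \<le> (SUP x\<in>hintv b. ereal (R x))) (at_end b)"
      using eventually_at_end_ge[OF zero_in_hintv[OF assms(1)] assms(1)]
      by (rule eventually_mono) (auto intro: SUP_upper)
    fix y assume "y < (SUP x\<in>hintv b. ereal (R x))"
    then obtain z where z: "z \<in> hintv b" "y < ereal (R z)" by (auto simp: less_SUP_iff)
    show "eventually (\<lambda>x. y < ereal (R x)) (at_end b)"
      using eventually_at_end_ge[OF z(1) assms(1)]
    proof (rule eventually_mono)
      fix x assume "x \<in> hintv b \<and> z < x"
      then have "R z \<le> R x" using dist_fun_mono[OF assms(2) z(1)] by simp
      then show "y < ereal (R x)" using z(2) by (metis ereal_less_eq(3) order.strict_trans2)
    qed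
  qed
  then show ?thesis
    unfolding end_val_def by (rule tendsto_Lim[OF at_end_nonbot[OF assms(1)]])
qed

lemma end_val_nonneg: "0 < b \<Longrightarrow> dist_fun b R \<Longrightarrow> 0 \<le> end_val b R"
  unfolding end_val_eq_SUP by (rule SUP_upper2[OF zero_in_hintv]) (simp_all add: dist_fun_zero zero_ereal_def)

lemma regular_system_iff_bounded:
  assumes b: "0 < b" and R: "dist_fun b R" and R': "dist_fun b R'"
  shows "regular_system b R R' \<longleftrightarrow> (\<exists>K. \<forall>x\<in>hintv b. R x \<le> K \<and> R' x \<le> K)"
proof
  assume reg: "regular_system b R R'"
  have "end_val b R < \<infinity>" "end_val b R' < \<infinity>"
    using reg end_val_nonneg[OF b R] end_val_nonneg[OF b R'] unfolding regular_system_def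
    by (cases "end_val b R"; cases "end_val b R'"; simp)+
  then obtain r r' where r: "end_val b R = ereal r" "end_val b R' = ereal r'"
    using end_val_nonneg[OF b R] end_val_nonneg[OF b R'] by (cases "end_val b R"; cases "end_val b R'"; simp)
  have "R x \<le> max r r' \<and> R' x \<le> max r r'" if "x \<in> hintv b" for x
  proof -
    have "ereal (R x) \<le> ereal r" "ereal (R' x) \<le> ereal r'"
      unfolding r[symmetric] end_val_eq_SUP[OF b R] end_val_eq_SUP[OF b R'] using that by (auto intro: SUP_upper)
    then show ?thesis by auto
  qed
  then show "\<exists>K. \<forall>x\<in>hintv b. R x \<le> K \<and> R' x \<le> K" by blast
next
  assume "\<exists>K. \<forall>x\<in>hintv b. R x \<le> K \<and> R' x \<le> K"
  then obtain K where K: "\<And>x. x \<in> hintv b \<Longrightarrow> R x \<le> K" "\<And>x. x \<in> hintv b \<Longrightarrow> R' x \<le> K" by blast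
  have "end_val b R \<le> ereal K" "end_val b R' \<le> ereal K"
    unfolding end_val_eq_SUP[OF b R] end_val_eq_SUP[OF b R'] using K by (auto intro: SUP_least)
  then have "end_val b R + end_val b R' \<le> ereal K + ereal K" by (rule add_mono)
  then show "regular_system b R R'" unfolding regular_system_def
    by (metis plus_ereal.simps(1) ereal_infty_less(1) less_PInf_Ex_of_nat order.strict_trans1 PInfty_neq_ereal(1))
qed

text \<open>Independence on some \<open>[0,b0)\<close> is inherited by \<open>[0,b)\<close>. It excludes \<open>R = 0\<close>, where \<open>R\<close> itself is a vanishing
combination, and \<open>R' = 0\<close>, where every function vanishes almost everywhere.\<close>

lemma integral_system_admissible:
  assumes sys: "integral_system b R R'"
  shows "admissible_system b R R'"
    and "(AE x in LS b R'. a1 + a2 * complex_of_real (R x) = 0) \<Longrightarrow> a1 = 0 \<and> a2 = 0"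
proof -
  have b: "0 < b" and R: "dist_fun b R" and R': "dist_fun b R'" using sys by (auto simp: integral_system_def)
  interpret stieltjes_pair b R R' using b R R' by unfold_locales
  obtain b0 where b0: "b0 \<le> b" and ind0: "\<And>a1 a2 :: complex.
      (AE x in LS b0 R'. a1 + a2 * complex_of_real (R x) = 0) \<Longrightarrow> a1 = 0 \<and> a2 = 0"
    using sys unfolding integral_system_def by blast
  have b0pos: "0 < b0"
  proof (rule ccontr)
    assume "\<not> 0 < b0"
    have "hintv b0 = {}"
    proof (rule ccontr)
      assume "hintv b0 \<noteq> {}"
      then obtain x where "0 \<le> x" "ereal x < b0" by (auto simp: hintv_def)
      then have "0 < b0" by (metis ereal_less_eq(5) order.strict_trans1)
      then show False using \<open>\<not> 0 < b0\<close> by simp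
    qed
    then have "space (LS b0 R') = {}" by (simp add: LS_def extend_measure_def space_measure_of_conv)
    then have "AE x in LS b0 R'. 1 + 0 * complex_of_real (R x) = 0" by (intro AE_I2) simp
    then show False using ind0[of 1 0] by simp
  qed
  have sub: "hintv b0 \<subseteq> hintv b" using b0 by (auto simp: hintv_def intro: order.strict_trans2)
  have R'0: "dist_fun b0 R'" using R' sub by (auto simp: dist_fun_def intro: mono_on_subset)
  interpret B0: stieltjes b0 R' using b0pos R'0 by unfold_locales
  have down: "AE x in LS b0 R'. P x" if "AE x in LS b R'. P x" for P
  proof (rule B0.AE_locally)
    fix x assume x: "x \<in> hintv b0"
    have "AE t in LS b R'. t \<in> {0..<x} \<longrightarrow> P t" using that by (rule eventually_mono) simp
    then show "AE t in LS b0 R'. t \<in> {0..<x} \<longrightarrow> P t"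
      by (subst AE_LS_cong[OF b0pos R'0 x b R']) (use x sub in auto)
  qed
  show ind: "a1 = 0 \<and> a2 = 0" if "AE x in LS b R'. a1 + a2 * complex_of_real (R x) = 0" for a1 a2
    by (rule ind0) (rule down[OF that])
  show "admissible_system b R R'"
  proof
    show "continuous (at x within hintv b) R \<or> continuous (at x within hintv b) R'" if "x \<in> hintv b" for x
      using sys that by (auto simp: integral_system_def)
    show "\<exists>x\<in>hintv b. 0 < R x"
    proof (rule ccontr)
      assume "\<not> ?thesis"
      then have "R x = 0" if "x \<in> hintv b" for x using A.R_nonneg[OF that] that by force
      then have "AE x in LS b R'. 0 + 1 * complex_of_real (R x) = 0" by (intro AE_I2) (simp add: B.space_M)
      then show False using ind[of 0 1] by simp
    qed
    show "\<exists>x\<in>hintv b. 0 < R' x"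
    proof (rule ccontr)
      assume "\<not> ?thesis"
      then have z: "R' x = 0" if "x \<in> hintv b" for x using B.R_nonneg[OF that] that by force
      have "AE x in LS b R'. False"
      proof (rule B.AE_locally)
        fix x assume x: "x \<in> hintv b"
        show "AE t in LS b R'. t \<in> {0..<x} \<longrightarrow> False"
        proof (rule AE_I[of _ _ "{0..<x}"])
          show "emeasure (LS b R') {0..<x} = 0"
            using B.emeasure_Ico[OF B.zero_in x hintv_nonneg[OF x]] z[OF x] z[OF B.zero_in] by simp
          show "{0..<x} \<in> sets (LS b R')" by (rule B.Ico_sets[OF x]) simp
        qed auto
      qed
      then have "AE x in LS b R'. 1 + 0 * complex_of_real (R x) = 0" by (rule eventually_mono) simp
      then show False using ind[of 1 0] by simp
    qed
  qed
qed

lemma admissible_system_swap: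
  assumes "admissible_system b R R'" shows "admissible_system b R' R"
proof -
  interpret admissible_system b R R' by (rule assms)
  show ?thesis by unfold_locales (use cont R_nontrivial R'_nontrivial in auto)
qed

text \<open>The quotient \<open>s1 / c1\<close> of the exchanged system is \<open>- c2 / (l * s2)\<close>, so its product with \<open>s2 / c2\<close> is
  constantly \<open>- 1 / l\<close>. Both factors converge, hence neither limit is \<open>0\<close>.\<close>

lemma singular_duality:
  assumes sys: "admissible_system b R R'" and unbdd: "\<not> (\<exists>K. \<forall>x\<in>hintv b. R x \<le> K \<and> R' x \<le> K)"
    and l: "l \<notin> complex_of_real ` {0..}"
  shows "((\<lambda>x. s1 b R R' x l / c1 b R R' x l) \<longlongrightarrow> q_TW b R R' l) (at_end b)"
    and "q_TW b R R' l \<noteq> 0" and "q_TW b R' R l = - 1 / (l * q_TW b R R' l)"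
proof -
  obtain om where om: "0 < Re om" "0 < Re (- l * om)" by (rule rotation_exists[OF l])
  interpret X: admissible_system b R R' by (rule sys)
  interpret Y: admissible_system b R' R by (rule admissible_system_swap[OF sys])
  interpret X: singular_system b R R' l om using om unbdd by unfold_locales
  interpret Y: singular_system b R' R l om using om unbdd by unfold_locales (auto simp: conj_commute)
  have l0: "l \<noteq> 0" using l by (force simp: image_iff)
  show "((\<lambda>x. s1 b R R' x l / c1 b R R' x l) \<longlongrightarrow> q_TW b R R' l) (at_end b)"
    using X.quotient_tendsto by (simp add: X.q_def)
  have "((\<lambda>x. (X.S2 l x / X.C2 l x) * (Y.S1 l x / Y.C1 l x)) \<longlongrightarrow> X.q * Y.q) (at_end b)"
    by (intro tendsto_mult X.quotient2_tendsto Y.quotient_tendsto)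
  moreover have "eventually (\<lambda>x. (X.S2 l x / X.C2 l x) * (Y.S1 l x / Y.C1 l x) = - 1 / l) (at_end b)"
    using X.HC_eventually_ge[of 1] Y.HC_eventually_ge[of 1]
  proof (rule eventually_elim2)
    fix x assume x: "x \<in> hintv b \<and> 1 \<le> X.HC x" "x \<in> hintv b \<and> 1 \<le> Y.HC x"
    have "X.C2 l x \<noteq> 0" "Y.C1 l x \<noteq> 0" using X.C_nonzero[of x] Y.C_nonzero[of x] x by auto
    then show "(X.S2 l x / X.C2 l x) * (Y.S1 l x / Y.C1 l x) = - 1 / l"
      using X.swap_fundamental[OF l0, of x] x l0 by simp
  qed
  ultimately have "((\<lambda>x. - 1 / l) \<longlongrightarrow> X.q * Y.q) (at_end b)" by (rule Lim_transform_eventually)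
  then have qq: "X.q * Y.q = - 1 / l"
    using tendsto_unique[OF at_end_nonbot[OF X.A.b_pos] _ tendsto_const] by blast
  then show "q_TW b R R' l \<noteq> 0" using l0 by (auto simp: X.q_def)
  then show "q_TW b R' R l = - 1 / (l * q_TW b R R' l)"
    using qq l0 by (simp add: X.q_def Y.q_def field_simps)
qed

lemma singular_m_N:
  assumes sys: "integral_system b R R'" and unbdd: "\<not> (\<exists>K. \<forall>x\<in>hintv b. R x \<le> K \<and> R' x \<le> K)"
    and l: "l \<notin> complex_of_real ` {0..}"
  shows "m_N b R R' l = q_TW b R R' l"
proof -
  obtain om where om: "0 < Re om" "0 < Re (- l * om)" by (rule rotation_exists[OF l])
  interpret X: admissible_system b R R' by (rule integral_system_admissible(1)[OF sys])
  interpret X: singular_system b R R' l om using om unbdd by unfold_locales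
  show ?thesis using X.m_N_eq_q[OF integral_system_admissible(2)[OF sys]] by (simp add: X.q_def)
qed

lemma primitive_restrict:
  assumes "stieltjes b R" "stieltjes b' T" and sub: "hintv b \<subseteq> hintv b'"
    and eq: "\<And>t. t \<in> hintv b \<Longrightarrow> R t = T t" and p: "stieltjes.primitive b' T F f"
  shows "stieltjes.primitive b R F f"
proof -
  interpret A: stieltjes b R by fact
  interpret B: stieltjes b' T by fact
  show ?thesis
    unfolding A.primitive_def A.locally_integrable_def
  proof (intro conjI ballI)
    fix x assume x: "x \<in> hintv b"
    then have x': "x \<in> hintv b'" using sub by blast
    have eq': "R t = T t" if "0 \<le> t" "t < x" for t using eq hintv_mono[OF x] that by simp
    show "set_integrable A.M {0..<x} f"
      using B.locally_integrableD[OF B.primitive_integrable[OF p] x']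
      by (subst set_integrable_LS_cong[OF A.b_pos A.dist x B.b_pos B.dist x' eq'])
    show "F x = F 0 + (LINT t:{0..<x}|A.M. f t)"
      using B.primitive_eq[OF p x']
      by (subst set_integral_LS_cong[OF A.b_pos A.dist x B.b_pos B.dist x' eq'])
  qed
qed

text \<open>Solutions for the longer interval restrict to solutions for the shorter one, where they are unique.\<close>

lemma fundamental_restrict:
  assumes "stieltjes_pair b R R'" "stieltjes_pair b' T T'" and sub: "hintv b \<subseteq> hintv b'"
    and eq: "\<And>t. t \<in> hintv b \<Longrightarrow> R t = T t" "\<And>t. t \<in> hintv b \<Longrightarrow> R' t = T' t" and x: "x \<in> hintv b"
  shows "c1 b R R' x l = c1 b' T T' x l" "c2 b R R' x l = c2 b' T T' x l"
    "s1 b R R' x l = s1 b' T T' x l" "s2 b R R' x l = s2 b' T T' x l"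
proof -
  interpret X: stieltjes_pair b R R' by fact
  interpret Y: stieltjes_pair b' T T' by fact
  have res: "X.solution l u1 u2" if "Y.solution l u1 u2" for u1 u2
    using that primitive_restrict[OF X.A.stieltjes_axioms Y.A.stieltjes_axioms sub eq(1)]
      primitive_restrict[OF X.B.stieltjes_axioms Y.B.stieltjes_axioms sub eq(2)]
    by (simp add: X.solution_def Y.solution_def)
  show "c1 b R R' x l = c1 b' T T' x l" "c2 b R R' x l = c2 b' T T' x l"
    using X.solution_eq[OF res[OF Y.solution_c] x] by (simp_all add: Y.c_init)
  show "s1 b R R' x l = s1 b' T T' x l" "s2 b R R' x l = s2 b' T T' x l"
    using X.solution_eq[OF res[OF Y.solution_s] x] by (simp_all add: Y.s_init)
qed

lemma (in stieltjes) primitive_const: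
  assumes F: "primitive F f" and xy: "x \<in> hintv b" "y \<in> hintv b" "x \<le> y" "R y = R x"
  shows "F y = F x"
proof -
  have "AE t in M. indicat_real {x..<y} t *\<^sub>R f t = 0"
    by (rule AE_I[of _ _ "{x..<y}"])
       (use emeasure_Ico[OF xy(1-3)] xy Ico_sets[OF xy(2) hintv_nonneg[OF xy(1)]] in \<open>auto simp: indicator_def\<close>)
  then have "(LINT t:{x..<y}|M. f t) = 0"
    unfolding set_lebesgue_integral_def by (rule integral_eq_zero_AE)
  then show ?thesis using primitive_diff[OF F xy(1-3)] by simp
qed

text \<open>The inverse of \<open>D_matrix l\<close> has rows \<open>(0, 1)\<close> and \<open>(- l, 0)\<close>; the four equations are the entries of the
  conjugated matrix.\<close>

lemma fund_matrix_conj: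
  assumes l: "l \<noteq> 0"
    and e: "c1 b' T T' x l = s2 b R R' x l" "c2 b' T T' x l = - l * s1 b R R' x l"
    "s1 b' T T' x l = - c2 b R R' x l / l" "s2 b' T T' x l = c1 b R R' x l"
  shows "fund_matrix b' T T' x l = matrix_inv (D_matrix l) ** fund_matrix b R R' x l ** D_matrix l"
proof -
  define E :: "complex^2^2" where "E = vector [vector [0, 1], vector [- l, 0]]"
  have DE: "D_matrix l ** E = mat 1" "E ** D_matrix l = mat 1"
    using l by (simp_all add: D_matrix_def E_def vec_eq_iff forall_2 matrix_matrix_mult_def sum_2 mat_def)
  have "matrix_inv (D_matrix l) = E"
  proof -
    have inv: "matrix_inv (D_matrix l) ** D_matrix l = mat 1"
      unfolding matrix_inv_def by (rule someI2[of _ E]) (simp_all add: DE)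
    have "matrix_inv (D_matrix l) = matrix_inv (D_matrix l) ** (D_matrix l ** E)" by (simp add: DE)
    also have "\<dots> = E" by (simp only: matrix_mul_assoc inv matrix_mul_lid)
    finally show ?thesis .
  qed
  then show ?thesis
    using l by (simp add: E_def D_matrix_def fund_matrix_def vec_eq_iff forall_2 matrix_matrix_mult_def sum_2 e field_simps)
qed

lemma cont_R2_unbounded:
  assumes "0 < B"
  shows "\<not> (\<exists>K. \<forall>x\<in>hintv \<infinity>. T x \<le> K \<and> cont_R2 (ereal B) R x \<le> K)"
proof
  assume "\<exists>K. \<forall>x\<in>hintv \<infinity>. T x \<le> K \<and> cont_R2 (ereal B) R x \<le> K"
  then obtain K where K: "\<And>x. 0 \<le> x \<Longrightarrow> cont_R2 (ereal B) R x \<le> K" by (auto simp: hintv_infinity)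
  obtain e where e: "real_of_ereal (end_val (ereal B) R) = e" by blast
  define y where "y = B + \<bar>K\<bar> + \<bar>e\<bar> + 1"
  have "cont_R2 (ereal B) R y \<le> K" using assms by (intro K) (simp add: y_def)
  moreover have "\<not> y < B" unfolding y_def by linarith
  then have "cont_R2 (ereal B) R y = e + y - B" by (simp add: cont_R2_def e)
  then have "cont_R2 (ereal B) R y = e + \<bar>K\<bar> + \<bar>e\<bar> + 1" by (simp add: y_def)
  ultimately show False by linarith
qed

text \<open>Beyond \<open>B\<close> the continued \<open>R1\<close> is constant, so \<open>c1\<close> and \<open>s1\<close> keep the values which, being left-continuous, they
approach from below \<open>B\<close>. Hence \<open>q\<close> of the singular continuation is the quotient at \<open>B\<close>; that it is neither \<open>0\<close> nor
a default value \<open>x / 0 = 0\<close> follows from \<open>singular_duality\<close>.\<close>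

lemma regular_continuation:
  assumes pair: "stieltjes_pair (ereal B) R1 R2" and T: "admissible_system \<infinity> (cont_R1 (ereal B) R1) (cont_R2 (ereal B) R2)"
    and l: "l \<notin> complex_of_real ` {0..}"
  defines "T1 \<equiv> cont_R1 (ereal B) R1" and "T2 \<equiv> cont_R2 (ereal B) R2"
  shows "Lim (at_end (ereal B)) (\<lambda>x. c1 (ereal B) R1 R2 x l) = c1 \<infinity> T1 T2 B l"
    and "Lim (at_end (ereal B)) (\<lambda>x. s1 (ereal B) R1 R2 x l) = s1 \<infinity> T1 T2 B l"
    and "q_TW (ereal B) R1 R2 l = q_TW \<infinity> T1 T2 l"
    and "q_TW \<infinity> T1 T2 l = s1 \<infinity> T1 T2 B l / c1 \<infinity> T1 T2 B l"
    and "c1 \<infinity> T1 T2 B l \<noteq> 0" "s1 \<infinity> T1 T2 B l \<noteq> 0"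
proof -
  interpret X: stieltjes_pair "ereal B" R1 R2 by (rule pair)
  interpret Y: admissible_system \<infinity> T1 T2 unfolding T1_def T2_def by (rule T)
  let ?b = "ereal B"
  have B: "0 < B" using X.A.b_pos by simp
  have BY: "B \<in> hintv \<infinity>" using B by (simp add: hintv_infinity)
  have sub: "hintv ?b \<subseteq> hintv \<infinity>" by (auto simp: hintv_def)
  have eq1: "R1 t = T1 t" and eq2: "R2 t = T2 t" if "t \<in> hintv ?b" for t
    using that by (auto simp: hintv_def T1_def T2_def cont_R1_def cont_R2_def)
  note res = fundamental_restrict[OF pair Y.stieltjes_pair_axioms sub eq1 eq2]
  have lim: "((\<lambda>x. c1 ?b R1 R2 x l) \<longlongrightarrow> c1 \<infinity> T1 T2 B l) (at_end ?b)"
    "((\<lambda>x. s1 ?b R1 R2 x l) \<longlongrightarrow> s1 \<infinity> T1 T2 B l) (at_end ?b)"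
  proof -
    have ev: "eventually (\<lambda>x. x \<in> hintv ?b) (at_end ?b)"
      using eventually_at_end_ge[OF X.A.zero_in X.A.b_pos] by (rule eventually_mono) simp
    have "(Y.C1 l \<longlongrightarrow> Y.C1 l B) (at_left B)" "(Y.S1 l \<longlongrightarrow> Y.S1 l B) (at_left B)"
      using Y.solution_c[of l] Y.solution_s[of l] by (auto simp: Y.solution_def intro!: Y.A.primitive_tendsto_left BY B)
    then have "(Y.C1 l \<longlongrightarrow> Y.C1 l B) (at_end ?b)" "(Y.S1 l \<longlongrightarrow> Y.S1 l B) (at_end ?b)"
      by (simp_all add: at_end_def)
    moreover have "eventually (\<lambda>x. Y.C1 l x = c1 ?b R1 R2 x l) (at_end ?b)"
      using ev by (rule eventually_mono) (simp add: res)
    moreover have "eventually (\<lambda>x. Y.S1 l x = s1 ?b R1 R2 x l) (at_end ?b)"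
      using ev by (rule eventually_mono) (simp add: res)
    ultimately show "((\<lambda>x. c1 ?b R1 R2 x l) \<longlongrightarrow> c1 \<infinity> T1 T2 B l) (at_end ?b)"
      "((\<lambda>x. s1 ?b R1 R2 x l) \<longlongrightarrow> s1 \<infinity> T1 T2 B l) (at_end ?b)"
      by (blast intro: Lim_transform_eventually)+
  qed
  note nb = at_end_nonbot[OF X.A.b_pos]
  show "Lim (at_end ?b) (\<lambda>x. c1 ?b R1 R2 x l) = c1 \<infinity> T1 T2 B l"
    "Lim (at_end ?b) (\<lambda>x. s1 ?b R1 R2 x l) = s1 \<infinity> T1 T2 B l"
    using lim by (auto intro: tendsto_Lim[OF nb])
  have const: "Y.C1 l x = Y.C1 l B" "Y.S1 l x = Y.S1 l B" if x: "B \<le> x" for x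
  proof -
    have "T1 x = T1 B" using x by (simp add: T1_def cont_R1_def)
    moreover have "x \<in> hintv \<infinity>" using x B by (simp add: hintv_infinity)
    ultimately show "Y.C1 l x = Y.C1 l B" "Y.S1 l x = Y.S1 l B"
      using Y.solution_c[of l] Y.solution_s[of l] x by (auto simp: Y.solution_def intro!: Y.A.primitive_const[OF _ BY])
  qed
  have unb: "\<not> (\<exists>K. \<forall>x\<in>hintv \<infinity>. T1 x \<le> K \<and> T2 x \<le> K)"
    using cont_R2_unbounded[OF B, of T1 R2] by (simp add: T2_def)
  note sd = singular_duality[OF Y.admissible_system_axioms unb l]
  have evB: "eventually (\<lambda>x. B \<le> x) (at_end \<infinity>)"
    by (simp add: at_end_def)
  have "((\<lambda>x. Y.S1 l B / Y.C1 l B) \<longlongrightarrow> q_TW \<infinity> T1 T2 l) (at_end \<infinity>)"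
    using sd(1)
  proof (rule Lim_transform_eventually)
    show "eventually (\<lambda>x. Y.S1 l x / Y.C1 l x = Y.S1 l B / Y.C1 l B) (at_end \<infinity>)"
      using evB
    proof (rule eventually_mono)
      fix x assume "B \<le> x"
      from const[OF this] show "Y.S1 l x / Y.C1 l x = Y.S1 l B / Y.C1 l B" by metis
    qed
  qed
  then show qeq: "q_TW \<infinity> T1 T2 l = s1 \<infinity> T1 T2 B l / c1 \<infinity> T1 T2 B l"
    using tendsto_unique[OF at_end_nonbot[OF Y.A.b_pos] _ tendsto_const] by blast
  show "s1 \<infinity> T1 T2 B l \<noteq> 0" "c1 \<infinity> T1 T2 B l \<noteq> 0" using sd(2) qeq by auto
  then have "((\<lambda>x. s1 ?b R1 R2 x l / c1 ?b R1 R2 x l) \<longlongrightarrow> s1 \<infinity> T1 T2 B l / c1 \<infinity> T1 T2 B l) (at_end ?b)"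
    by (intro tendsto_divide lim)
  then show "q_TW ?b R1 R2 l = q_TW \<infinity> T1 T2 l"
    unfolding qeq q_TW_def[of ?b] by (rule tendsto_Lim[OF nb])
qed

theorem theorem5p2:
  fixes b \<beta> :: ereal and R1 R2 Q1 Q2 :: "real \<Rightarrow> real"
  assumes system: "integral_system b R1 R2"
    and finite_end: "regular_system b R1 R2 \<Longrightarrow> b < \<infinity>"
    and dual: "\<beta> = dual_end b R1 R2" "Q1 = dual_Q1 b R1 R2" "Q2 = dual_Q2 b R1 R2"
    and dual_system: "integral_system \<beta> Q1 Q2"
  shows
    "(\<forall>x\<in>hintv b. \<forall>l::complex. l \<noteq> 0 \<longrightarrow>
        fund_matrix \<beta> Q1 Q2 x l
          = matrix_inv (D_matrix l) ** fund_matrix b R1 R2 x l ** D_matrix l)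
     \<and>
     (\<not> regular_system b R1 R2 \<longrightarrow> (\<forall>l::complex. l \<notin> \<real> \<longrightarrow>
        m_N b R1 R2 l \<noteq> 0 \<and>
        m_N \<beta> Q1 Q2 l = - 1 / (l * m_N b R1 R2 l)))
     \<and>
     (regular_system b R1 R2 \<longrightarrow> (\<forall>l::complex. l \<notin> \<real> \<longrightarrow>
        (let s2h = s2 \<beta> Q1 Q2 (real_of_ereal b) l;
             c2h = c2 \<beta> Q1 Q2 (real_of_ereal b) l;
             c1b = Lim (at_end b) (\<lambda>x. c1 b R1 R2 x l);
             s1b = Lim (at_end b) (\<lambda>x. s1 b R1 R2 x l)
         in c2h \<noteq> 0 \<and> s1b \<noteq> 0 \<and> c1b \<noteq> 0 \<and>
            m_N \<beta> Q1 Q2 l = s2h / c2h \<and>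
            s2h / c2h = - (c1b / (l * s1b)) \<and>
            - (c1b / (l * s1b)) = - 1 / (l * m_ND b R1 R2 l))))
     \<and>
     (\<forall>l::complex. l \<notin> complex_of_real ` {0..} \<longrightarrow>
        q_TW b R1 R2 l \<noteq> 0 \<and>
        q_TW \<beta> Q1 Q2 l = - 1 / (l * q_TW b R1 R2 l))"
proof (cases "regular_system b R1 R2")
  case False
  have \<beta>: "\<beta> = b" "Q1 = R2" "Q2 = R1"
    using dual False by (auto simp: dual_end_def dual_Q1_def dual_Q2_def)
  interpret X: admissible_system b R1 R2 by (rule integral_system_admissible(1)[OF system])
  have unb: "\<not> (\<exists>K. \<forall>x\<in>hintv b. R1 x \<le> K \<and> R2 x \<le> K)"
    using False regular_system_iff_bounded[OF X.A.b_pos X.A.dist X.B.dist] by simp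
  have unb': "\<not> (\<exists>K. \<forall>x\<in>hintv b. R2 x \<le> K \<and> R1 x \<le> K)" using unb by (simp add: conj_commute)
  have nonreal: "l \<notin> complex_of_real ` {0..}" if "l \<notin> \<real>" for l using that by auto
  note sd = singular_duality[OF X.admissible_system_axioms unb]
  have "m_N b R1 R2 l \<noteq> 0 \<and> m_N b R2 R1 l = - 1 / (l * m_N b R1 R2 l)" if "l \<notin> \<real>" for l
    using sd(2,3)[OF nonreal[OF that]] singular_m_N[OF system unb nonreal[OF that]]
      singular_m_N[OF dual_system[unfolded \<beta>] unb' nonreal[OF that]] by simp
  moreover have "fund_matrix b R2 R1 x l = matrix_inv (D_matrix l) ** fund_matrix b R1 R2 x l ** D_matrix l"
    if "x \<in> hintv b" "l \<noteq> 0" for x l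
    by (rule fund_matrix_conj[OF that(2)]) (rule X.swap_fundamental[OF that(2,1)])+
  ultimately show ?thesis using sd(2,3) False unfolding \<beta> by simp
next
  case True
  have "0 < b" using system by (simp add: integral_system_def)
  then obtain B where b: "b = ereal B" "0 < B" using finite_end[OF True] by (cases b) auto
  define T1 where "T1 = cont_R1 b R1"
  define T2 where "T2 = cont_R2 b R2"
  have \<beta>: "\<beta> = \<infinity>" "Q1 = T2" "Q2 = T1"
    using dual True by (auto simp: dual_end_def dual_Q1_def dual_Q2_def T1_def T2_def)
  interpret X: admissible_system b R1 R2 by (rule integral_system_admissible(1)[OF system])
  interpret Z: admissible_system \<infinity> T2 T1 using integral_system_admissible(1)[OF dual_system] by (simp add: \<beta>)
  interpret Y: admissible_system \<infinity> T1 T2 by (rule admissible_system_swap[OF Z.admissible_system_axioms])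
  have "admissible_system \<infinity> (cont_R1 (ereal B) R1) (cont_R2 (ereal B) R2)"
    using Y.admissible_system_axioms by (simp add: T1_def T2_def b)
  note rc = regular_continuation[OF X.stieltjes_pair_axioms[unfolded b(1)] this, folded b(1), folded T1_def T2_def]
  have unb: "\<not> (\<exists>K. \<forall>x\<in>hintv \<infinity>. T1 x \<le> K \<and> T2 x \<le> K)"
    using cont_R2_unbounded[OF b(2), of T1 R2] by (simp add: T2_def b(1))
  have unb': "\<not> (\<exists>K. \<forall>x\<in>hintv \<infinity>. T2 x \<le> K \<and> T1 x \<le> K)" using unb by (simp add: conj_commute)
  note sd = singular_duality[OF Y.admissible_system_axioms unb]
  have nonreal: "l \<notin> complex_of_real ` {0..}" "l \<noteq> 0" if "l \<notin> \<real>" for l using that by auto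
  have B: "B \<in> hintv \<infinity>" "real_of_ereal b = B" using b by (simp_all add: hintv_infinity)
  have sub: "hintv b \<subseteq> hintv \<infinity>" by (auto simp: hintv_def)
  have eq: "R1 t = T1 t" "R2 t = T2 t" if "t \<in> hintv b" for t
    using that by (auto simp: hintv_def T1_def T2_def cont_R1_def cont_R2_def)
  have "fund_matrix \<infinity> T2 T1 x l = matrix_inv (D_matrix l) ** fund_matrix b R1 R2 x l ** D_matrix l"
    if x: "x \<in> hintv b" and l: "l \<noteq> 0" for x l
    using Y.swap_fundamental[OF l, of x] sub x
      fundamental_restrict[OF X.stieltjes_pair_axioms Y.stieltjes_pair_axioms sub eq x, of l]
    by (intro fund_matrix_conj[OF l]) auto
  moreover have "let s2h = s2 \<infinity> T2 T1 (real_of_ereal b) l;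
             c2h = c2 \<infinity> T2 T1 (real_of_ereal b) l;
             c1b = Lim (at_end b) (\<lambda>x. c1 b R1 R2 x l);
             s1b = Lim (at_end b) (\<lambda>x. s1 b R1 R2 x l)
         in c2h \<noteq> 0 \<and> s1b \<noteq> 0 \<and> c1b \<noteq> 0 \<and>
            m_N \<infinity> T2 T1 l = s2h / c2h \<and>
            s2h / c2h = - (c1b / (l * s1b)) \<and>
            - (c1b / (l * s1b)) = - 1 / (l * m_ND b R1 R2 l)" if nl: "l \<notin> \<real>" for l
  proof -
    note l = nonreal[OF nl]
    have "m_N \<infinity> T2 T1 l = - 1 / (l * (Y.S1 l B / Y.C1 l B))"
      using singular_m_N[OF dual_system[unfolded \<beta>] unb' l(1)] sd(3)[OF l(1)] rc(4)[OF l(1)] by simp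
    then show ?thesis
      using rc(1,2,5,6)[OF l(1)] Y.swap_fundamental(2,4)[OF l(2) B(1)] l(2)
      by (simp add: Let_def B(2) m_ND_def)
  qed
  moreover have "q_TW b R1 R2 l \<noteq> 0 \<and> q_TW \<infinity> T2 T1 l = - 1 / (l * q_TW b R1 R2 l)"
    if l: "l \<notin> complex_of_real ` {0..}" for l
    using rc(3)[OF l] sd(2,3)[OF l] by simp
  ultimately show ?thesis using True unfolding \<beta> by simp
qed

end
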